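(* Let $X$ be a nonempty set and $H$ a Hilbert space. (1) Let $(\Omega,\mathbb{P})$ be a probability space and let $k\in rpd(\Omega,X,H)$. Define $K(s,t):=\mathbb{E}[k(\cdot,s,t)]=\int_\Omega k(\omega,s,t)\,d\mathbb{P}(\omega)$ for $s,t\in X$. Then $K\in pd(X,H)$. (2) Conversely, let $K\in pd(X,H)$ be such that $K(s,s)$ is of trace class for all $s\in X$. Then there exist a probability space $(\Omega,\mathbb{P})$ and an $H$-valued Gaussian process $\{W_s\}_{s\in X}$ in $L^2(\Omega,H)$ such that $$K(s,t)=\mathbb{E}\big[\,|W_s(\cdot)\rangle\langle W_t(\cdot)|\,\big],\qquad s,t\in X,$$ and such that $k(\omega,s,t):=|W_s(\omega)\rangle\langle W_t(\omega)|$ belongs to $rpd(\Omega,X,H)$. In particular, this $k$ is pathwise positive definite almost surely, i.e. for $\mathbb{P}$-almost every $\omega$ the kernel $(s,t)\mapsto k(\omega,s,t)$ belongs to $pd(X,H)$.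
   Context: Hilbert spaces are complex, with inner products linear in the second variable; $\mathcal{L}(H)$ denotes the bounded linear operators on $H$. For $u,v\in H$, $|u\rangle\langle v|$ is the rank-one operator $b\mapsto\langle v,b\rangle u$. $pd(X,H)$ is the set of positive definite kernels $K:X\times X\to\mathcal{L}(H)$, i.e. those with $\sum_{i,j=1}^N\langle a_i,K(s_i,s_j)a_j\rangle\ge 0$ for all $N\in\mathbb{N}$ and all finite families $\{(a_i,s_i)\}_{i=1}^N$ with $a_i\in H$, $s_i\in X$. $rpd(\Omega,X,H)$ is the set of random positive definite kernels: maps $k:\Omega\times X\times X\to\mathcal{L}(H)$ such that for all $s,t\in X$ the map $k(\cdot,s,t)$ is strongly measurable on $\Omega$ (i.e. $\omega\mapsto k(\omega,s,t)a$ is strongly measurable for each $a\in H$) and $\mathbb{E}\big[\sum_{i,j=1}^N\langle a_i,k(\cdot,s_i,s_j)a_j\rangle\big]\ge 0$ for all finite families $\{(a_i,s_i)\}_{i=1}^N$ with $a_i\in H$, $s_i\in X$. It is understood that $\omega\mapsto\langle a,k(\omega,s,t)b\rangle$ is integrable for all $s,t\in X$, $a,b\in H$; operator expectations are weak integrals, i.e. $\langle a,\mathbb{E}[k(\cdot,s,t)]b\rangle=\mathbb{E}[\langle a,k(\cdot,s,t)b\rangle]$ for all $a,b\in H$, with $\mathbb{E}[k(\cdot,s,t)]\in\mathcal{L}(H)$. An $H$-valued Gaussian process in $L^2(\Omega,H)$ is a family $\{W_s\}_{s\in X}\subset L^2(\Omega,H)$ such that the scalar random variables $\langle W_s,a\rangle$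 ($s\in X$, $a\in H$) are jointly centered Gaussian (meaning their real and imaginary parts are jointly centered real Gaussian). *)

theory Defs
  imports "HOL-Probability.Probability"
begin

(* Complex Hilbert spaces, with inner product linear in the second variable.  The complete
   norm and the real scalar multiplication come from the superclass banach. *)
class complex_hilbert = banach +
  fixes scaleC :: "complex \<Rightarrow> 'a \<Rightarrow> 'a" (infixr \<open>*\<^sub>C\<close> 75)
    and cinner :: "'a \<Rightarrow> 'a \<Rightarrow> complex"
  assumes scaleR_scaleC: "scaleR r x = complex_of_real r *\<^sub>C x"
    and scaleC_add_right: "c *\<^sub>C (x + y) = c *\<^sub>C x + c *\<^sub>C y"
    and scaleC_add_left: "(c + d) *\<^sub>C x = c *\<^sub>C x + d *\<^sub>C x"
    and scaleC_scaleC: "c *\<^sub>C d *\<^sub>C x = (c * d) *\<^sub>C x"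
    and cinner_commute: "cinner x y = cnj (cinner y x)"
    and cinner_add_right: "cinner x (y + z) = cinner x y + cinner x z"
    and cinner_scaleC_right: "cinner x (c *\<^sub>C y) = c * cinner x y"
    and cinner_self: "cinner x x = complex_of_real ((norm x)\<^sup>2)"

(* L(H) is represented by the functions on H satisfying this predicate. *)
definition bounded_clinear :: "('h::complex_hilbert \<Rightarrow> 'h) \<Rightarrow> bool" where
  "bounded_clinear T \<longleftrightarrow> bounded_linear T \<and> (\<forall>c x. T (c *\<^sub>C x) = c *\<^sub>C T x)"

definition ketbra :: "'h::complex_hilbert \<Rightarrow> 'h \<Rightarrow> 'h \<Rightarrow> 'h" where
  "ketbra u v = (\<lambda>b. cinner v b *\<^sub>C u)"

(* 0 \<le> z for complex z means that z is real and nonnegative. *)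

definition positive_op :: "('h::complex_hilbert \<Rightarrow> 'h) \<Rightarrow> bool" where
  "positive_op T \<longleftrightarrow> bounded_clinear T \<and> (\<forall>x. 0 \<le> cinner x (T x))"

(* P = |T|, the positive square root of T* T: as P is self-adjoint, the second conjunct
   says P P = T* T. *)
definition is_abs_op :: "('h::complex_hilbert \<Rightarrow> 'h) \<Rightarrow> ('h \<Rightarrow> 'h) \<Rightarrow> bool" where
  "is_abs_op T P \<longleftrightarrow> positive_op P \<and> (\<forall>x y. cinner (P x) (P y) = cinner (T x) (T y))"

(* Orthonormal bases, as maximal orthonormal sets. *)
definition is_onb :: "'h::complex_hilbert set \<Rightarrow> bool" where
  "is_onb B \<longleftrightarrow> (\<forall>e\<in>B. \<forall>f\<in>B. cinner e f = (if e = f then 1 else 0)) \<and>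
     (\<forall>x. (\<forall>e\<in>B. cinner e x = 0) \<longrightarrow> x = 0)"

(* The sum of <e, |T| e> over an orthonormal basis does not depend on the basis. *)
definition trace_class :: "('h::complex_hilbert \<Rightarrow> 'h) \<Rightarrow> bool" where
  "trace_class T \<longleftrightarrow> bounded_clinear T \<and>
     (\<exists>P B. is_abs_op T P \<and> is_onb B \<and> (\<lambda>e. cinner e (P e)) summable_on B)"

definition pd :: "'x set \<Rightarrow> ('x \<Rightarrow> 'x \<Rightarrow> 'h::complex_hilbert \<Rightarrow> 'h) set" where
  "pd X = {K. (\<forall>s\<in>X. \<forall>t\<in>X. bounded_clinear (K s t)) \<and>
     (\<forall>(N::nat) a s. (\<forall>i<N. s i \<in> X) \<longrightarrow>
        0 \<le> (\<Sum>i<N. \<Sum>j<N. cinner (a i) (K (s i) (s j) (a j))))}"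

(* Pointwise limits of simple functions.  For nonseparable H this is stronger than
   Borel measurability. *)
definition strongly_measurable :: "'w measure \<Rightarrow> ('w \<Rightarrow> 'h::complex_hilbert) \<Rightarrow> bool" where
  "strongly_measurable M f \<longleftrightarrow>
     (\<exists>F. (\<forall>n::nat. simple_function M (F n)) \<and>
          (\<forall>\<omega>\<in>space M. (\<lambda>n. F n \<omega>) \<longlonglongrightarrow> f \<omega>))"

definition rpd ::
  "'w measure \<Rightarrow> 'x set \<Rightarrow> ('w \<Rightarrow> 'x \<Rightarrow> 'x \<Rightarrow> 'h::complex_hilbert \<Rightarrow> 'h) set" where
  "rpd M X = {k.
     (\<forall>\<omega>\<in>space M. \<forall>s\<in>X. \<forall>t\<in>X. bounded_clinear (k \<omega> s t)) \<and>
     (\<forall>s\<in>X. \<forall>t\<in>X. \<forall>a. strongly_measurable M (\<lambda>\<omega>. k \<omega> s t a)) \<and>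
     (\<forall>s\<in>X. \<forall>t\<in>X. \<forall>a b. integrable M (\<lambda>\<omega>. cinner a (k \<omega> s t b))) \<and>
     (\<forall>(N::nat) a s. (\<forall>i<N. s i \<in> X) \<longrightarrow>
        0 \<le> (\<integral>\<omega>. (\<Sum>i<N. \<Sum>j<N. cinner (a i) (k \<omega> (s i) (s j) (a j))) \<partial>M))}"

(* T is the weak (sesquilinear) expectation of the operator-valued map F. *)
definition has_op_expectation ::
  "'w measure \<Rightarrow> ('w \<Rightarrow> 'h::complex_hilbert \<Rightarrow> 'h) \<Rightarrow> ('h \<Rightarrow> 'h) \<Rightarrow> bool" where
  "has_op_expectation M F T \<longleftrightarrow> bounded_clinear T \<and>
     (\<forall>a b. integrable M (\<lambda>\<omega>. cinner a (F \<omega> b)) \<and>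
            cinner a (T b) = (\<integral>\<omega>. cinner a (F \<omega> b) \<partial>M))"

definition op_expectation ::
  "'w measure \<Rightarrow> ('w \<Rightarrow> 'h::complex_hilbert \<Rightarrow> 'h) \<Rightarrow> 'h \<Rightarrow> 'h" where
  "op_expectation M F = (THE T. has_op_expectation M F T)"

lemma cinner_ext:
  fixes x y :: "'h::complex_hilbert"
  assumes "\<And>a. cinner a x = cinner a y"
  shows "x = y"
proof -
  have "cinner (x - y) x = cinner (x - y) (x - y) + cinner (x - y) y"
    by (metis cinner_add_right diff_add_cancel)
  then have "cinner (x - y) (x - y) = 0"
    using assms[of "x - y"] by simp
  then show ?thesis
    by (simp add: cinner_self)
qed

lemma op_expectation_eqI:
  assumes "has_op_expectation M F T"
  shows "op_expectation M F = T"
  unfolding op_expectation_def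
proof (rule the_equality[where P = "has_op_expectation M F"])
  fix S assume "has_op_expectation M F S"
  with assms show "S = T"
    unfolding has_op_expectation_def by (intro ext cinner_ext) simp
qed (fact assms)

(* Centered real Gaussian variables, including the degenerate one of variance 0. *)
definition centered_gaussian :: "'w measure \<Rightarrow> ('w \<Rightarrow> real) \<Rightarrow> bool" where
  "centered_gaussian M Y \<longleftrightarrow> Y \<in> borel_measurable M \<and>
     ((AE \<omega> in M. Y \<omega> = 0) \<or>
      (\<exists>\<sigma>>0. distributed M lborel Y (\<lambda>x. ennreal (normal_density 0 \<sigma> x))))"

definition jointly_centered_gaussian ::
  "'w measure \<Rightarrow> 'i set \<Rightarrow> ('i \<Rightarrow> 'w \<Rightarrow> real) \<Rightarrow> bool" where
  "jointly_centered_gaussian M I Y \<longleftrightarrow>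
     (\<forall>J c. finite J \<longrightarrow> J \<subseteq> I \<longrightarrow> centered_gaussian M (\<lambda>\<omega>. \<Sum>j\<in>J. c j * Y j \<omega>))"

(* The boolean index selects the real or the imaginary part. *)
definition jointly_centered_gaussian_complex ::
  "'w measure \<Rightarrow> 'i set \<Rightarrow> ('i \<Rightarrow> 'w \<Rightarrow> complex) \<Rightarrow> bool" where
  "jointly_centered_gaussian_complex M I Z \<longleftrightarrow>
     jointly_centered_gaussian M (I \<times> (UNIV :: bool set))
       (\<lambda>(i, re) \<omega>. if re then Re (Z i \<omega>) else Im (Z i \<omega>))"

(* Elements of L^2 are given by representatives. *)
definition in_L2 :: "'w measure \<Rightarrow> ('w \<Rightarrow> 'h::complex_hilbert) \<Rightarrow> bool" where
  "in_L2 M f \<longleftrightarrow> strongly_measurable M f \<and> integrable M (\<lambda>\<omega>. (norm (f \<omega>))\<^sup>2)"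

definition gaussian_process ::
  "'w measure \<Rightarrow> 'x set \<Rightarrow> ('x \<Rightarrow> 'w \<Rightarrow> 'h::complex_hilbert) \<Rightarrow> bool" where
  "gaussian_process M X W \<longleftrightarrow> (\<forall>s\<in>X. in_L2 M (W s)) \<and>
     jointly_centered_gaussian_complex M (X \<times> (UNIV :: 'h set))
       (\<lambda>(s, a) \<omega>. cinner (W s \<omega>) a)"

end

theory Submission
  imports Defs
begin

text \<open>
  For the first part: once the weak expectation of \<open>k(\<cdot>, s, t)\<close> is known to be
  a bounded operator, positivity passes through the integral by linearity.  Boundedness is the
  point: the hypothesis only says that the functions \<open>\<langle>a, k(\<cdot>, s, t) b\<rangle>\<close> are integrable.  By Fatou's
  lemma the \<open>L\<^sup>1\<close> norms of these functions are lower semicontinuous seminorms in \<open>a\<close> and in \<open>b\<close>, and a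
  finite lower semicontinuous seminorm on a Banach space is bounded by the Baire category theorem
  (\<open>lsc_seminorm_bounded\<close>).  Riesz representation then yields the operator
  (\<open>weak_expectation_exists\<close>).

  For the second part: formally, a kernel of the form
  \<open>K(s, t) = V\<^sub>s\<^sup>* V\<^sub>t\<close> with \<open>V\<^sub>s : H \<rightarrow> L\<close> is the covariance of \<open>W\<^sub>s = \<Sum>\<^sub>l Z\<^sub>l V\<^sub>s\<^sup>* e\<^sub>l\<close> for an
  orthonormal basis \<open>e\<^sub>l\<close> of \<open>L\<close> and independent standard normal variables \<open>Z\<^sub>l\<close>, and
  \<open>\<Sum>\<^sub>l \<parallel>V\<^sub>s\<^sup>* e\<^sub>l\<parallel>\<^sup>2\<close> is the trace of \<open>K(s, s)\<close>.  Instead of the space \<open>L\<close>, the vectors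
  \<open>v\<^sub>s\<^sub>,\<^sub>l = V\<^sub>s\<^sup>* e\<^sub>l\<close> are constructed directly.  The scalar kernel \<open>\<langle>a, K(s, t) b\<rangle>\<close> on the
  index set of the pairs \<open>(s, a)\<close> is factored as \<open>\<Sum>\<^sub>l cnj (\<phi>\<^sub>l (s, a)) \<phi>\<^sub>l (t, b)\<close> by Cholesky elimination
  along a well-order of the pairs (\<open>pd_kernel_Cholesky\<close>).  There is one row \<open>\<phi>\<^sub>l\<close> for each pair \<open>l\<close>, so
  that the noise lives on the functions from pairs to numbers.  Each row is a bounded linear functional
  \<open>\<langle>v\<^sub>s\<^sub>,\<^sub>l, \<cdot>\<rangle>\<close> of its second component (\<open>features_representable\<close>).

  Square summability of the vectors needs the trace of \<open>K(s, s)\<close>, whereas the trace class condition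
  bounds that of \<open>|K(s, s)|\<close>; the two agree by uniqueness of positive square roots
  (\<open>positive_op_eqI\<close>).  With Parseval's identity this gives \<open>features_square_summable\<close>.

  The series converges almost surely along a suitable sequence of finite sets of indices and in mean
  square along all of them (\<open>noise_series_exists\<close>).  Gaussianity of the limit follows from convergence
  of characteristic functions (\<open>centered_gaussian_L2_limit\<close>), and the covariance is the limit of the
  finite covariances (\<open>noise_series_covariance\<close>).  The kernel \<open>|W\<^sub>s\<rangle>\<langle>W\<^sub>t|\<close> is positive definite for
  every sample point, because its quadratic form is \<open>|\<Sum>\<^sub>j \<langle>W\<^sub>s\<^sub>j, a\<^sub>j\<rangle>|\<^sup>2\<close>.
\<close>

section \<open>Complex Hilbert spaces\<close>

lemma scaleC_zero_left [simp]: "0 *\<^sub>C (x::'h::complex_hilbert) = 0"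
  by (metis add_cancel_left_left scaleC_add_left)

lemma scaleC_zero_right [simp]: "c *\<^sub>C (0::'h::complex_hilbert) = 0"
  by (metis add_cancel_left_left scaleC_add_right)

lemma scaleC_one [simp]: "1 *\<^sub>C (x::'h::complex_hilbert) = x"
  using scaleR_scaleC[of 1 x] by simp

lemma cinner_add_left: "cinner (x + y) (z::'h::complex_hilbert) = cinner x z + cinner y z"
  by (metis cinner_add_right cinner_commute complex_cnj_add)

lemma cinner_scaleC_left: "cinner (c *\<^sub>C x) (y::'h::complex_hilbert) = cnj c * cinner x y"
  by (metis cinner_commute cinner_scaleC_right complex_cnj_mult)

lemma cinner_zero_right [simp]: "cinner x (0::'h::complex_hilbert) = 0"
  by (metis cinner_add_right add_cancel_left_left)

lemma cinner_zero_left [simp]: "cinner (0::'h::complex_hilbert) x = 0"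
  by (metis cinner_add_left add_cancel_left_left)

lemma cinner_minus_right: "cinner x (- (y::'h::complex_hilbert)) = - cinner x y"
  by (metis add.inverse_unique add.right_inverse cinner_add_right cinner_zero_right)

lemma cinner_minus_left: "cinner (- x) (y::'h::complex_hilbert) = - cinner x y"
  by (metis add.inverse_unique add.right_inverse cinner_add_left cinner_zero_left)

lemma cinner_diff_right: "cinner x (y - (z::'h::complex_hilbert)) = cinner x y - cinner x z"
  by (simp only: diff_conv_add_uminus cinner_add_right cinner_minus_right)

lemma cinner_diff_left: "cinner (x - y) (z::'h::complex_hilbert) = cinner x z - cinner y z"
  by (simp only: diff_conv_add_uminus cinner_add_left cinner_minus_left)

lemma cinner_scaleR_right: "cinner x (r *\<^sub>R (y::'h::complex_hilbert)) = complex_of_real r * cinner x y"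
  by (simp add: scaleR_scaleC cinner_scaleC_right)

lemma cinner_scaleR_left: "cinner (r *\<^sub>R x) (y::'h::complex_hilbert) = complex_of_real r * cinner x y"
  by (simp add: scaleR_scaleC cinner_scaleC_left)

lemma cinner_sum_right: "cinner x (\<Sum>i\<in>A. f i) = (\<Sum>i\<in>A. cinner x (f i :: 'h::complex_hilbert))"
  by (induction A rule: infinite_finite_induct) (simp_all add: cinner_add_right)

lemma cinner_sum_left: "cinner (\<Sum>i\<in>A. f i) x = (\<Sum>i\<in>A. cinner (f i :: 'h::complex_hilbert) x)"
  by (induction A rule: infinite_finite_induct) (simp_all add: cinner_add_left)

lemmas cinner_simps = cinner_add_left cinner_add_right cinner_diff_left cinner_diff_right
  cinner_minus_left cinner_minus_right cinner_scaleC_left cinner_scaleC_right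
  cinner_scaleR_left cinner_scaleR_right cinner_sum_left cinner_sum_right

lemma norm_scaleC [simp]: "norm (c *\<^sub>C (x::'h::complex_hilbert)) = cmod c * norm x"
proof -
  have "complex_of_real ((norm (c *\<^sub>C x))\<^sup>2) = complex_of_real ((cmod c * norm x)\<^sup>2)"
    unfolding cinner_self[symmetric] cinner_scaleC_left cinner_scaleC_right power_mult_distrib of_real_mult
    by (simp add: complex_norm_square cinner_self mult_ac del: of_real_power)
  then have "(norm (c *\<^sub>C x))\<^sup>2 = (cmod c * norm x)\<^sup>2"
    by (simp only: of_real_eq_iff)
  then show ?thesis by (simp add: power2_eq_iff_nonneg)
qed

lemma norm_add_square:
  "(norm (x + (y::'h::complex_hilbert)))\<^sup>2 = (norm x)\<^sup>2 + (norm y)\<^sup>2 + 2 * Re (cinner x y)"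
proof -
  have "Re (cinner y x) = Re (cinner x y)" by (metis cinner_commute complex_cnj(1) complex.collapse complex.sel(1))
  then have "Re (cinner (x + y) (x + y)) = Re (cinner x x) + Re (cinner y y) + 2 * Re (cinner x y)"
    by (simp add: cinner_simps)
  then show ?thesis by (simp add: cinner_self del: of_real_power)
qed

lemma norm_diff_square:
  "(norm (x - (y::'h::complex_hilbert)))\<^sup>2 = (norm x)\<^sup>2 + (norm y)\<^sup>2 - 2 * Re (cinner x y)"
  using norm_add_square[of x "- y"] by (simp add: cinner_minus_right)

lemma parallelogram_law:
  "(norm (x + (y::'h::complex_hilbert)))\<^sup>2 + (norm (x - y))\<^sup>2 = 2 * (norm x)\<^sup>2 + 2 * (norm y)\<^sup>2"
  by (simp add: norm_add_square norm_diff_square)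

lemma norm_cinner_commute: "cmod (cinner x y) = cmod (cinner y (x::'h::complex_hilbert))"
  by (metis cinner_commute complex_mod_cnj)

lemma cinner_Cauchy_Schwarz: "cmod (cinner x y) \<le> norm x * norm (y::'h::complex_hilbert)"
proof (cases "x = 0")
  case False
  then have nx: "(norm x)\<^sup>2 > 0" by simp
  \<comment> \<open>\<open>c *\<^sub>C x\<close> is the projection of \<open>y\<close> onto the line of \<open>x\<close>.\<close>
  define c where "c = cinner x y / complex_of_real ((norm x)\<^sup>2)"
  have "0 \<le> (norm (y - c *\<^sub>C x))\<^sup>2" by simp
  also have "\<dots> = (norm y)\<^sup>2 + (cmod c * norm x)\<^sup>2 - 2 * Re (c * cnj (cinner x y))"
    unfolding norm_diff_square using cinner_commute[of y x] by (simp add: cinner_scaleC_right)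
  also have "c * cnj (cinner x y) = complex_of_real ((cmod (cinner x y))\<^sup>2 / (norm x)\<^sup>2)"
    by (simp only: c_def of_real_divide complex_norm_square times_divide_eq_left)
  also have "(cmod c * norm x)\<^sup>2 = (cmod (cinner x y))\<^sup>2 / (norm x)\<^sup>2"
    using nx unfolding c_def norm_divide norm_of_real by (simp add: power2_eq_square field_simps)
  finally have "(cmod (cinner x y))\<^sup>2 / (norm x)\<^sup>2 \<le> (norm y)\<^sup>2" by simp
  then have "(cmod (cinner x y))\<^sup>2 \<le> (norm x * norm y)\<^sup>2"
    using nx by (simp add: pos_divide_le_eq power_mult_distrib mult.commute)
  then show ?thesis by (rule power2_le_imp_le) simp
qed simp

lemma bounded_linear_cinner_right: "bounded_linear (\<lambda>y. cinner x (y::'h::complex_hilbert))"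
  by (rule bounded_linear_intro[where K = "norm x"])
     (auto simp: cinner_simps scaleR_conv_of_real cinner_Cauchy_Schwarz mult.commute[of _ "norm x"])

lemma bounded_linear_cinner_left: "bounded_linear (\<lambda>x. cinner x (y::'h::complex_hilbert))"
  by (rule bounded_linear_intro[where K = "norm y"])
     (auto simp: cinner_simps scaleR_conv_of_real cinner_Cauchy_Schwarz)

lemma bounded_bilinear_cinner: "bounded_bilinear (cinner :: 'h::complex_hilbert \<Rightarrow> 'h \<Rightarrow> complex)"
  by (rule bounded_bilinear.intro)
     (auto simp: cinner_simps scaleR_conv_of_real cinner_Cauchy_Schwarz intro!: exI[of _ 1])

lemma bounded_bilinear_scaleC: "bounded_bilinear (scaleC :: complex \<Rightarrow> 'h::complex_hilbert \<Rightarrow> 'h)"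
  by (rule bounded_bilinear.intro)
     (auto simp: scaleC_add_left scaleC_add_right scaleR_scaleC scaleC_scaleC scaleR_conv_of_real mult.commute
       intro!: exI[of _ 1])

lemmas tendsto_cinner [tendsto_intros] = bounded_bilinear.tendsto[OF bounded_bilinear_cinner]
lemmas tendsto_scaleC [tendsto_intros] = bounded_bilinear.tendsto[OF bounded_bilinear_scaleC]

text \<open>Along a minimizing sequence of the quadratic functional
  \<open>J x = \<parallel>x\<parallel>\<^sup>2 / 2 - Re (f x)\<close> the parallelogram law forces the Cauchy property, and the
  first-order condition at the minimizer says that it represents \<open>f\<close>.\<close>

lemma Riesz_representation:
  fixes f :: "'h::complex_hilbert \<Rightarrow> complex"
  assumes add: "\<And>x y. f (x + y) = f x + f y"
    and scale: "\<And>c x. f (c *\<^sub>C x) = c * f x"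
    and bound: "\<And>x. cmod (f x) \<le> C * norm x"
  shows "\<exists>v. \<forall>x. f x = cinner v x"
proof -
  define J where "J x = (norm x)\<^sup>2 / 2 - Re (f x)" for x
  have Jlow: "- (C\<^sup>2 / 2) \<le> J x" for x
  proof -
    have "0 \<le> (norm x - C)\<^sup>2" by simp
    moreover have "Re (f x) \<le> C * norm x" using bound[of x] complex_Re_le_cmod[of "f x"] by linarith
    ultimately show ?thesis unfolding J_def by (simp add: power2_diff algebra_simps)
  qed
  define I where "I = (INF x. J x)"
  have bdd: "bdd_below (range J)" using Jlow by (intro bdd_belowI2)
  have IJ: "I \<le> J x" for x unfolding I_def by (rule cINF_lower[OF bdd]) simp
  have "\<exists>x. J x < I + (1/2)^n" for n :: nat
  proof -
    have "\<exists>x\<in>UNIV. J x < I + (1/2)^n"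
      by (subst cINF_less_iff[OF _ bdd, symmetric]) (auto simp: I_def[symmetric])
    then show ?thesis by simp
  qed
  then obtain X where X: "\<And>n::nat. J (X n) < I + (1/2)^n" by metis
  have key: "(norm (x - y))\<^sup>2 \<le> 4 * ((J x - I) + (J y - I))" for x y
  proof -
    have "(norm (x + y))\<^sup>2 / 4 = (norm ((1/2) *\<^sub>R (x + y)))\<^sup>2"
      by (simp only: norm_scaleR power_mult_distrib) (simp add: power2_eq_square)
    moreover have "f ((1/2) *\<^sub>R (x + y)) = (f x + f y) / 2"
      by (simp add: scaleR_scaleC scale add)
    then have "Re (f ((1/2) *\<^sub>R (x + y))) = (Re (f x) + Re (f y)) / 2"
      by (simp only: Re_divide_numeral plus_complex.simps)
    ultimately have "J ((1/2) *\<^sub>R (x + y)) = (norm (x + y))\<^sup>2 / 8 - (Re (f x) + Re (f y)) / 2"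
      unfolding J_def by simp
    note this IJ[of "(1/2) *\<^sub>R (x + y)"]
    with parallelogram_law[of x y] show ?thesis
      unfolding J_def by (simp add: field_simps)
  qed
  have "Cauchy X"
  proof (rule metric_CauchyI)
    fix e :: real assume e: "0 < e"
    then obtain N where N': "(1/2)^N < e\<^sup>2 / 8"
      using real_arch_pow_inv[of "e\<^sup>2 / 8" "1/2"] by auto
    define \<delta> where "\<delta> = (1/2::real)^N"
    have N: "\<delta> < e\<^sup>2 / 8" using N' by (simp add: \<delta>_def)
    show "\<exists>M. \<forall>m\<ge>M. \<forall>n\<ge>M. dist (X m) (X n) < e"
    proof (intro exI[of _ N] allI impI)
      fix m n assume "N \<le> m" "N \<le> n"
      then have "(1/2::real)^m \<le> \<delta>" "(1/2::real)^n \<le> \<delta>"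
        unfolding \<delta>_def by (auto intro: power_decreasing)
      then have "J (X m) - I < \<delta>" "J (X n) - I < \<delta>" using X[of m] X[of n] by linarith+
      then have "(norm (X m - X n))\<^sup>2 < 8 * \<delta>" using key[of "X m" "X n"] by argo
      also have "\<dots> < e\<^sup>2" using N by simp
      finally have "(norm (X m - X n))\<^sup>2 < e\<^sup>2" .
      then show "dist (X m) (X n) < e" using e by (simp add: dist_norm power2_less_imp_less)
    qed
  qed
  then obtain v where v: "X \<longlonglongrightarrow> v" using Cauchy_convergent convergent_def by blast
  have "bounded_linear f"
    by (rule bounded_linear_intro[where K = C])
       (auto simp: add scaleR_scaleC scale scaleR_conv_of_real bound mult.commute)
  then have "(\<lambda>n. f (X n)) \<longlonglongrightarrow> f v" using v by (rule bounded_linear.tendsto)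
  then have "(\<lambda>n. J (X n)) \<longlonglongrightarrow> J v" unfolding J_def by (intro tendsto_intros v) auto
  moreover have "(\<lambda>n. I + (1/2)^n) \<longlonglongrightarrow> I + 0"
    by (intro tendsto_intros LIMSEQ_realpow_zero) auto
  ultimately have "J v \<le> I" using X by (intro LIMSEQ_le[where X = "\<lambda>n. J (X n)"]) (auto intro: less_imp_le)
  then have min: "J v \<le> J x" for x using IJ[of x] by linarith
  have Reeq: "Re (f x) = Re (cinner v x)" for x
  proof (rule ccontr)
    assume ne: "Re (f x) \<noteq> Re (cinner v x)"
    then have "x \<noteq> 0" using scale[of 0 0] by auto
    then have nx: "(norm x)\<^sup>2 > 0" by simp
    \<comment> \<open>Moving from \<open>v\<close> by the optimal step \<open>t\<close> in direction \<open>x\<close> would lower \<open>J\<close>.\<close>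
    define d where "d = Re (f x) - Re (cinner v x)"
    define t where "t = d / (norm x)\<^sup>2"
    have "J (v + t *\<^sub>R x) = J v + (t\<^sup>2 * (norm x)\<^sup>2 / 2 - t * d)"
      unfolding J_def norm_add_square d_def
      by (simp add: add scaleR_scaleC scale cinner_simps power_mult_distrib field_simps)
    also have "t\<^sup>2 * (norm x)\<^sup>2 / 2 - t * d = - (d\<^sup>2 / (norm x)\<^sup>2 / 2)"
      using nx by (simp add: t_def power2_eq_square field_simps)
    finally have "J (v + t *\<^sub>R x) < J v" using nx ne by (simp add: d_def)
    with min[of "v + t *\<^sub>R x"] show False by simp
  qed
  have "f x = cinner v x" for x
  proof (rule complex_eqI)
    \<comment> \<open>The imaginary part is a real part at \<open>\<i> *\<^sub>C x\<close>.\<close>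
    show "Im (f x) = Im (cinner v x)"
      using Reeq[of "\<i> *\<^sub>C x"] by (simp add: scale cinner_simps)
  qed (rule Reeq)
  then show ?thesis by blast
qed

lemma norm_sum_orthogonal_square:
  fixes f :: "'i \<Rightarrow> 'h::complex_hilbert"
  assumes "finite F" and "\<And>i j. i \<in> F \<Longrightarrow> j \<in> F \<Longrightarrow> i \<noteq> j \<Longrightarrow> cinner (f i) (f j) = 0"
  shows "(norm (\<Sum>i\<in>F. f i))\<^sup>2 = (\<Sum>i\<in>F. (norm (f i))\<^sup>2)"
  using assms
proof (induction F rule: finite_induct)
  case (insert a F)
  have "cinner (f a) (\<Sum>i\<in>F. f i) = 0"
    unfolding cinner_sum_right using insert.hyps insert.prems by (intro sum.neutral) auto
  then show ?case using insert by (simp add: norm_add_square)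
qed simp

lemma convergent_if_summable_increments:
  fixes X :: "nat \<Rightarrow> 'b::banach"
  assumes "summable (\<lambda>n. norm (X (Suc n) - X n))"
  shows "convergent X"
proof -
  have "convergent (\<lambda>n. (\<Sum>i<n. X (Suc i) - X i))"
    using summable_norm_cancel[OF assms] by (simp add: summable_iff_convergent)
  then have "convergent (\<lambda>n. X n - X 0)" by (simp add: sum_lessThan_telescope)
  then obtain z where "(\<lambda>n. X n - X 0) \<longlonglongrightarrow> z" by (auto simp: convergent_def)
  then have "(\<lambda>n. (X n - X 0) + X 0) \<longlonglongrightarrow> z + X 0" by (intro tendsto_intros)
  then show ?thesis by (auto simp: convergent_def)
qed

lemma exhausting_finite_sets:
  fixes f :: "'i \<Rightarrow> real"
  assumes f: "(f has_sum s) A" "\<And>x. 0 \<le> f x" and e: "\<And>n::nat. 0 < e n"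
  shows "\<exists>F. \<forall>n. finite (F n) \<and> F n \<subseteq> A \<and> F n \<subseteq> F (Suc n) \<and> s - e n < sum f (F n)"
proof -
  have "\<exists>F. finite F \<and> F \<subseteq> A \<and> s - e n < sum f F" for n
  proof -
    have "\<forall>\<^sub>F F in finite_subsets_at_top A. s - e n < sum f F"
      using f(1) e[of n] unfolding has_sum_def by (intro order_tendstoD(1)) auto
    then show ?thesis unfolding eventually_finite_subsets_at_top by blast
  qed
  then obtain F0 where F0: "\<And>n. finite (F0 n)" "\<And>n. F0 n \<subseteq> A" "\<And>n. s - e n < sum f (F0 n)" by metis
  define F where "F n = (\<Union>i\<le>n. F0 i)" for n
  have "finite (F n)" "F n \<subseteq> A" for n using F0 unfolding F_def by auto
  moreover have "F n \<subseteq> F (Suc n)" for n unfolding F_def by (intro UN_mono) auto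
  moreover have "s - e n < sum f (F n)" for n
  proof -
    have "sum f (F0 n) \<le> sum f (F n)" using F0(1) f(2) unfolding F_def by (intro sum_mono2) auto
    then show ?thesis using F0(3)[of n] by linarith
  qed
  ultimately show ?thesis by (intro exI[of _ F]) simp
qed

text \<open>The finite parts of the expansion of \<open>x\<close> that nearly attain the supremum of
  \<open>\<Sum>\<^sub>e |\<langle>e, x\<rangle>|\<^sup>2\<close> form a Cauchy sequence.  Its limit \<open>y\<close> has the same coefficients as \<open>x\<close>, since
  a missed nonzero coefficient would raise the sum above its supremum, and maximality of the
  orthonormal set gives \<open>y = x\<close>.\<close>

lemma Parseval_onb:
  fixes x :: "'h::complex_hilbert"
  assumes B: "is_onb B"
  shows "((\<lambda>e. (cmod (cinner e x))\<^sup>2) has_sum (norm x)\<^sup>2) B"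
proof -
  have on: "cinner e f = (if e = f then 1 else 0)" if "e \<in> B" "f \<in> B" for e f
    using B that unfolding is_onb_def by blast
  have max: "y = 0" if "\<And>e. e \<in> B \<Longrightarrow> cinner e y = 0" for y
    using B that unfolding is_onb_def by blast
  define q where "q F = (\<Sum>e\<in>F. (cmod (cinner e x))\<^sup>2)" for F
  define P where "P F = (\<Sum>e\<in>F. cinner e x *\<^sub>C e)" for F
  have nP: "(norm (P F))\<^sup>2 = q F" if "finite F" "F \<subseteq> B" for F
  proof -
    have one: "norm e = 1" if "e \<in> B" for e
    proof -
      have "complex_of_real ((norm e)\<^sup>2) = 1" using on[OF that that] cinner_self[of e] by simp
      then have "(norm e)\<^sup>2 = 1" using of_real_eq_1_iff by blast
      then show ?thesis by (simp add: power2_eq_1_iff) (metis norm_ge_zero neg_0_le_iff_le not_one_le_zero)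
    qed
    have "(norm (P F))\<^sup>2 = (\<Sum>e\<in>F. (norm (cinner e x *\<^sub>C e))\<^sup>2)"
      unfolding P_def using that on
      by (intro norm_sum_orthogonal_square) (auto simp: cinner_simps subset_iff)
    also have "\<dots> = q F" unfolding q_def using that one by (intro sum.cong) auto
    finally show ?thesis .
  qed
  have xP: "cinner (P F) x = complex_of_real (q F)" for F
    unfolding P_def q_def cinner_sum_left of_real_sum
    by (rule sum.cong) (auto simp: cinner_simps complex_norm_square mult.commute simp del: of_real_power)
  have diff: "(norm (x - P F))\<^sup>2 = (norm x)\<^sup>2 - q F" if "finite F" "F \<subseteq> B" for F
  proof -
    have "Re (cinner x (P F)) = q F" using xP[of F] cinner_commute[of x "P F"] by simp
    then show ?thesis unfolding norm_diff_square nP[OF that] by simp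
  qed
  have qle: "q F \<le> (norm x)\<^sup>2" if "finite F" "F \<subseteq> B" for F
    using diff[OF that] by (smt (verit) zero_le_power2)
  have summ: "(\<lambda>e. (cmod (cinner e x))\<^sup>2) summable_on B"
    by (rule nonneg_bdd_above_summable_on) (auto intro!: bdd_aboveI2 qle simp: q_def[symmetric])
  define s where "s = infsum (\<lambda>e. (cmod (cinner e x))\<^sup>2) B"
  have hs: "((\<lambda>e. (cmod (cinner e x))\<^sup>2) has_sum s) B" unfolding s_def by (rule has_sum_infsum[OF summ])
  have qs: "q F \<le> s" if "finite F" "F \<subseteq> B" for F
    unfolding q_def by (rule finite_sum_le_has_sum[OF hs]) (use that in auto)
  obtain F where F: "\<And>n. finite (F n)" "\<And>n. F n \<subseteq> B" "\<And>n. s - (1/4)^n < q (F n)" "\<And>n. F n \<subseteq> F (Suc n)"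
    using exhausting_finite_sets[OF hs, of "\<lambda>n. (1/4)^n"] unfolding q_def by auto
  have Fmono: "F m \<subseteq> F n" if "m \<le> n" for m n using that F(4) by (rule lift_Suc_mono_le[rotated])
  have Pdiff: "(norm (P F' - P G))\<^sup>2 = q F' - q G" if "finite F'" "F' \<subseteq> B" "G \<subseteq> F'" for F' G
  proof -
    have "P F' - P G = P (F' - G)" unfolding P_def using that by (simp add: sum_diff)
    moreover have "q F' - q G = q (F' - G)" unfolding q_def using that by (simp add: sum_diff)
    ultimately show ?thesis using nP[of "F' - G"] that by auto
  qed
  have "norm (P (F (Suc n)) - P (F n)) \<le> (1/2)^n" for n
  proof -
    have "(norm (P (F (Suc n)) - P (F n)))\<^sup>2 \<le> (1/4)^n"
      using Pdiff[OF F(1,2,4), of n] qs[OF F(1,2), of "Suc n"] F(3)[of n] by linarith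
    also have "(1/4::real)^n = ((1/2)^n)\<^sup>2" by (simp add: power2_eq_square flip: power_mult_distrib)
    finally show ?thesis by (rule power2_le_imp_le) simp
  qed
  then have "convergent (\<lambda>n. P (F n))"
    by (intro convergent_if_summable_increments summable_comparison_test'[OF summable_geometric[of "1/2"]]) auto
  then obtain y where y: "(\<lambda>n. P (F n)) \<longlonglongrightarrow> y" by (auto simp: convergent_def)
  have "cinner e (x - y) = 0" if e: "e \<in> B" for e
  proof -
    have lim: "(\<lambda>n. cinner e (P (F n))) \<longlonglongrightarrow> cinner e y" by (intro tendsto_intros y)
    have ip: "cinner e (P (F n)) = (if e \<in> F n then cinner e x else 0)" for n
    proof -
      have "cinner e (P (F n)) = (\<Sum>f\<in>F n. if f = e then cinner e x else 0)"
        unfolding P_def cinner_sum_right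
        by (intro sum.cong) (use e F(2)[of n] on in \<open>auto simp: cinner_simps subset_iff\<close>)
      then show ?thesis using F(1) by simp
    qed
    have "cinner e y = cinner e x"
    proof (cases "\<exists>n. e \<in> F n")
      case True
      then obtain n where "e \<in> F n" by blast
      then have "\<forall>\<^sub>F m in sequentially. cinner e (P (F m)) = cinner e x"
        unfolding eventually_sequentially ip using Fmono by (intro exI[of _ n]) auto
      then have "(\<lambda>n. cinner e (P (F n))) \<longlonglongrightarrow> cinner e x" by (rule tendsto_eventually)
      with lim show ?thesis by (rule LIMSEQ_unique)
    next
      case False
      have "(cmod (cinner e x))\<^sup>2 \<le> (1/4)^n" for n
      proof -
        have "q (insert e (F n)) = (cmod (cinner e x))\<^sup>2 + q (F n)"
          using False F(1) by (simp add: q_def)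
        with qs[of "insert e (F n)"] F[of n] e show ?thesis by auto
      qed
      moreover have "(\<lambda>n. (1/4::real)^n) \<longlonglongrightarrow> 0" by (intro LIMSEQ_realpow_zero) auto
      ultimately have "(cmod (cinner e x))\<^sup>2 \<le> 0" by (intro LIMSEQ_le_const) auto
      then have "cinner e x = 0" by simp
      with False lim ip have "(\<lambda>n. 0) \<longlonglongrightarrow> cinner e y" by simp
      then show ?thesis using \<open>cinner e x = 0\<close> LIMSEQ_unique tendsto_const by metis
    qed
    then show ?thesis by (simp add: cinner_simps)
  qed
  then have "x - y = 0" by (rule max)
  then have "(\<lambda>n. (norm (x - P (F n)))\<^sup>2) \<longlonglongrightarrow> (norm (x - x))\<^sup>2" using y by (intro tendsto_intros) auto
  then have "(\<lambda>n. (norm x)\<^sup>2 - q (F n)) \<longlonglongrightarrow> 0" by (simp add: diff F(1,2))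
  moreover have "(norm x)\<^sup>2 - s \<le> (norm x)\<^sup>2 - q (F n)" for n using qs[OF F(1,2)] by simp
  ultimately have "(norm x)\<^sup>2 - s \<le> 0" by (intro LIMSEQ_le_const) auto
  moreover have "s \<le> (norm x)\<^sup>2" by (rule has_sum_le_finite_sums[OF hs]) (use qle in \<open>auto simp: q_def\<close>)
  ultimately show ?thesis using hs by simp
qed

section \<open>Transfinite Cholesky factorization of positive definite kernels\<close>

definition kernel_form :: "('i \<Rightarrow> 'i \<Rightarrow> complex) \<Rightarrow> 'i set \<Rightarrow> ('i \<Rightarrow> complex) \<Rightarrow> complex" where
  "kernel_form G J c = (\<Sum>i\<in>J. \<Sum>j\<in>J. cnj (c i) * c j * G i j)"

definition pd_kernel :: "('i \<Rightarrow> 'i \<Rightarrow> complex) \<Rightarrow> bool" where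
  "pd_kernel G \<longleftrightarrow> (\<forall>J c. finite J \<longrightarrow> 0 \<le> kernel_form G J c)"

lemma kernel_form_rank_one:
  "kernel_form (\<lambda>i j. cnj (f i) * f j) J c = complex_of_real ((cmod (\<Sum>j\<in>J. c j * f j))\<^sup>2)"
proof -
  have "complex_of_real ((cmod (\<Sum>j\<in>J. c j * f j))\<^sup>2) = (\<Sum>i\<in>J. cnj (c i * f i)) * (\<Sum>j\<in>J. c j * f j)"
    unfolding complex_norm_square cnj_sum by (rule mult.commute)
  then show ?thesis unfolding kernel_form_def sum_product by (simp add: mult_ac)
qed

lemma kernel_form_diff:
  "kernel_form (\<lambda>i j. A i j - B i j) J c = kernel_form A J c - kernel_form B J c"
  unfolding kernel_form_def by (simp add: right_diff_distrib sum_subtractf)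

lemma pd_kernelD: "pd_kernel G \<Longrightarrow> finite J \<Longrightarrow> 0 \<le> kernel_form G J c"
  unfolding pd_kernel_def by blast

lemma pd_kernel_diag: "pd_kernel G \<Longrightarrow> 0 \<le> G i i"
proof -
  assume "pd_kernel G"
  then have "0 \<le> kernel_form G {i} (\<lambda>_. 1)" by (intro pd_kernelD) simp_all
  then show ?thesis by (simp add: kernel_form_def)
qed

lemma pd_kernel_pair:
  assumes "pd_kernel G" "i \<noteq> j"
  shows "0 \<le> cnj a * a * G i i + cnj b * b * G j j + cnj a * b * G i j + cnj b * a * G j i"
proof -
  have "0 \<le> kernel_form G {i, j} (\<lambda>k. if k = i then a else b)" by (intro pd_kernelD assms) simp
  also have "kernel_form G {i, j} (\<lambda>k. if k = i then a else b)
      = cnj a * a * G i i + cnj b * b * G j j + cnj a * b * G i j + cnj b * a * G j i"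
    using assms(2) by (simp add: kernel_form_def)
  finally show ?thesis .
qed

lemma pd_kernel_hermitian:
  assumes "pd_kernel G"
  shows "G j i = cnj (G i j)"
proof (cases "i = j")
  case True
  then show ?thesis using pd_kernel_diag[OF assms, of i] by (simp add: less_eq_complex_def complex_eq_iff)
next
  case False
  have "Im (G i j + G j i) = 0"
    using pd_kernel_pair[OF assms False, of 1 1] pd_kernel_diag[OF assms, of i] pd_kernel_diag[OF assms, of j]
    by (simp add: less_eq_complex_def)
  moreover have "Re (G i j) = Re (G j i)"
    using pd_kernel_pair[OF assms False, of 1 \<i>] pd_kernel_diag[OF assms, of i] pd_kernel_diag[OF assms, of j]
    by (simp add: less_eq_complex_def)
  ultimately show ?thesis by (simp add: complex_eq_iff)
qed

lemma pd_kernel_diag_real: "pd_kernel G \<Longrightarrow> G i i = complex_of_real (Re (G i i))"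
  using pd_kernel_diag[of G i] by (simp add: less_eq_complex_def complex_eq_iff)

lemma pd_kernel_zero_diag:
  assumes "pd_kernel G" "G j j = 0"
  shows "G i j = 0"
proof (cases "i = j")
  case False
  define g where "g = (cmod (G i j))\<^sup>2"
  define d where "d = Re (G i i)"
  have d0: "d \<ge> 0" using pd_kernel_diag[OF assms(1), of i] by (simp add: d_def less_eq_complex_def)
  have hji: "G j i = cnj (G i j)" by (rule pd_kernel_hermitian[OF assms(1)])
  have "0 \<le> d - 2 * t * g" for t :: real
  proof -
    let ?b = "- complex_of_real t * cnj (G i j)"
    have e1: "?b * G i j = - complex_of_real (t * g)"
      unfolding g_def of_real_mult complex_norm_square by simp
    have e2: "cnj ?b * G j i = - complex_of_real (t * g)"
      unfolding hji
      unfolding g_def of_real_mult complex_norm_square by simp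
    have "0 \<le> G i i + ?b * G i j + cnj ?b * G j i"
      using pd_kernel_pair[OF assms(1) False, of 1 ?b]
      by (simp only: assms(2) mult_zero_right complex_cnj_one mult_1 mult_1_right add_0_right)
    then show ?thesis unfolding e1 e2 by (simp add: less_eq_complex_def d_def mult_ac)
  qed
  \<comment> \<open>For \<open>g \<noteq> 0\<close> this value of \<open>t\<close> makes the right-hand side equal to \<open>-1\<close>.\<close>
  from this[of "(d + 1) / (2 * g)"] have "g = 0" using d0 by (cases "g = 0") auto
  then show ?thesis by (simp add: g_def)
qed (use assms in simp)

text \<open>This is positivity of the Schur complement.  Replacing the coefficient at \<open>m\<close> by the one that
  minimizes the quadratic form lowers its value by exactly \<open>|\<Sum>\<^sub>j c\<^sub>j G(m, j)|\<^sup>2 / G(m, m)\<close>.\<close>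

lemma pd_kernel_Schur:
  assumes G: "pd_kernel G" and pos: "G m m \<noteq> 0" and J: "finite J"
  shows "(cmod (\<Sum>j\<in>J. c j * (G m j / complex_of_real (sqrt (Re (G m m))))))\<^sup>2 \<le> Re (kernel_form G J c)"
proof -
  define r where "r = Re (G m m)"
  have Gmm: "G m m = complex_of_real r" unfolding r_def by (rule pd_kernel_diag_real[OF G])
  have r: "r > 0" using pos pd_kernel_diag[OF G, of m] Gmm by (auto simp: less_eq_complex_def)
  have *: "(cmod (\<Sum>j\<in>J. c j * G m j))\<^sup>2 / r \<le> Re (kernel_form G J c)" if J: "finite J" and m: "m \<in> J" for J c
  proof -
    define S where "S = (\<Sum>j\<in>J. c j * G m j)"
    \<comment> \<open>\<open>c - z u\<close> is the minimizer of the form among the coefficients that differ from \<open>c\<close> at \<open>m\<close> only.\<close>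
    define u where "u j = (if j = m then 1 else 0 :: complex)" for j
    define z where "z = S / complex_of_real r"
    have a1: "(\<Sum>i\<in>J. \<Sum>j\<in>J. cnj (u i) * (c j * G i j)) = S"
    proof -
      have "(\<Sum>j\<in>J. cnj (u i) * (c j * G i j)) = (if i = m then S else 0)" for i
        by (simp add: u_def S_def)
      then show ?thesis using m J by simp
    qed
    have a2: "(\<Sum>i\<in>J. \<Sum>j\<in>J. cnj (c i) * (u j * G i j)) = cnj S"
    proof -
      have "(\<Sum>j\<in>J. cnj (c i) * (u j * G i j)) = cnj (c i * G m i)" for i
      proof -
        have "(\<Sum>j\<in>J. cnj (c i) * (u j * G i j)) = (\<Sum>j\<in>J. if j = m then cnj (c i) * G i m else 0)"
          by (intro sum.cong) (auto simp: u_def)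
        then show ?thesis using m J pd_kernel_hermitian[OF G, of i m] by simp
      qed
      then show ?thesis by (simp add: S_def)
    qed
    have a3: "(\<Sum>i\<in>J. \<Sum>j\<in>J. cnj (u i) * (u j * G i j)) = complex_of_real r"
    proof -
      have "(\<Sum>j\<in>J. cnj (u i) * (u j * G i j)) = (if i = m then complex_of_real r else 0)" for i
      proof -
        have "(\<Sum>j\<in>J. cnj (u i) * (u j * G i j)) = (\<Sum>j\<in>J. if j = m then cnj (u i) * G i m else 0)"
          by (intro sum.cong) (auto simp: u_def)
        then show ?thesis using m J Gmm by (simp add: u_def)
      qed
      then show ?thesis using m J by simp
    qed
    have "kernel_form G J (\<lambda>j. c j - z * u j) = (\<Sum>i\<in>J. \<Sum>j\<in>J. cnj (c i) * c j * G i j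
        - z * (cnj (c i) * (u j * G i j)) - cnj z * (cnj (u i) * (c j * G i j))
        + cnj z * z * (cnj (u i) * (u j * G i j)))"
      unfolding kernel_form_def by (intro sum.cong refl) (simp add: algebra_simps)
    also have "\<dots> = kernel_form G J c - z * (\<Sum>i\<in>J. \<Sum>j\<in>J. cnj (c i) * (u j * G i j))
        - cnj z * (\<Sum>i\<in>J. \<Sum>j\<in>J. cnj (u i) * (c j * G i j))
        + cnj z * z * (\<Sum>i\<in>J. \<Sum>j\<in>J. cnj (u i) * (u j * G i j))"
      unfolding kernel_form_def by (simp only: sum.distrib sum_subtractf sum_distrib_left)
    also have "\<dots> = kernel_form G J c - z * cnj S - cnj z * S + cnj z * z * complex_of_real r"
      unfolding a1 a2 a3 ..
    also have "\<dots> = kernel_form G J c - complex_of_real ((cmod S)\<^sup>2 / r)"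
    proof -
      have "z * cnj S = complex_of_real ((cmod S)\<^sup>2 / r)" "cnj z * S = complex_of_real ((cmod S)\<^sup>2 / r)"
        "cnj z * z * complex_of_real r = complex_of_real ((cmod S)\<^sup>2 / r)"
        unfolding z_def of_real_divide complex_norm_square using r by simp_all
      then show ?thesis by simp
    qed
    finally have "0 \<le> kernel_form G J c - complex_of_real ((cmod S)\<^sup>2 / r)"
      using pd_kernelD[OF G J] by metis
    then show ?thesis by (simp add: less_eq_complex_def S_def)
  qed
  have "(cmod (\<Sum>j\<in>J. c j * G m j))\<^sup>2 / r \<le> Re (kernel_form G J c)"
  proof (cases "m \<in> J")
    case False
    define c' where "c' = c(m := 0)"
    have "(\<Sum>j\<in>insert m J. c' j * G m j) = (\<Sum>j\<in>J. c j * G m j)"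
      using J False by (simp add: c'_def) (intro sum.cong, auto)
    moreover have "kernel_form G (insert m J) c' = kernel_form G J c"
    proof -
      have c: "c' i = c i" if "i \<in> J" for i using that False by (auto simp: c'_def)
      have "c' m = 0" by (simp add: c'_def)
      then show ?thesis unfolding kernel_form_def using J False c by simp
    qed
    ultimately show ?thesis using *[of "insert m J" c'] J by simp
  qed (use * J in auto)
  moreover have "(\<Sum>j\<in>J. c j * (G m j / complex_of_real (sqrt r))) = (\<Sum>j\<in>J. c j * G m j) / complex_of_real (sqrt r)"
    by (simp add: sum_divide_distrib)
  ultimately show ?thesis using r
    by (simp add: r_def[symmetric] norm_divide power_divide)
qed

lemma summable_on_cnj_mult:
  fixes f g :: "'i \<Rightarrow> complex"
  assumes "(\<lambda>l. (cmod (f l))\<^sup>2) summable_on D" "(\<lambda>l. (cmod (g l))\<^sup>2) summable_on D"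
  shows "(\<lambda>l. cnj (f l) * g l) summable_on D"
proof (rule abs_summable_summable, rule summable_on_comparison_test)
  show "(\<lambda>l. (cmod (f l))\<^sup>2 + (cmod (g l))\<^sup>2) summable_on D" using assms by (rule summable_on_add)
  fix l
  show "cmod (cnj (f l) * g l) \<le> (cmod (f l))\<^sup>2 + (cmod (g l))\<^sup>2"
  proof -
    have "0 \<le> cmod (f l) * cmod (g l)" by simp
    with sum_squares_bound[of "cmod (f l)" "cmod (g l)"] show ?thesis
      unfolding norm_mult complex_mod_cnj by linarith
  qed
qed simp

lemma has_sum_finite_sum:
  fixes f :: "'i \<Rightarrow> 'l \<Rightarrow> 'b::topological_comm_monoid_add"
  assumes "finite J" "\<And>j. j \<in> J \<Longrightarrow> (f j has_sum s j) D"
  shows "((\<lambda>l. \<Sum>j\<in>J. f j l) has_sum (\<Sum>j\<in>J. s j)) D"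
  using assms by (induction J rule: finite_induct) (auto intro: has_sum_add)

lemma kernel_form_has_sum:
  assumes J: "finite J" and sum: "\<And>i j. i \<in> J \<Longrightarrow> j \<in> J \<Longrightarrow> ((\<lambda>l. cnj (\<phi> l i) * \<phi> l j) has_sum S i j) D"
  shows "((\<lambda>l. (cmod (\<Sum>j\<in>J. c j * \<phi> l j))\<^sup>2) has_sum Re (kernel_form S J c)) D"
proof -
  have "((\<lambda>l. kernel_form (\<lambda>i j. cnj (\<phi> l i) * \<phi> l j) J c) has_sum kernel_form S J c) D"
    unfolding kernel_form_def using sum J
    by (intro has_sum_finite_sum has_sum_cmult_right)
  then show ?thesis using has_sum_Re unfolding kernel_form_rank_one by fastforce
qed

text \<open>The transfinite Cholesky factor along a strict well-order \<open>r\<close>: at stage \<open>m\<close> the row \<open>m\<close>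
  of the kernel that remains after the earlier stages is normalized by its diagonal entry.  Where
  this entry is zero, the convention \<open>x / 0 = 0\<close> yields the zero row.\<close>

definition residual :: "('i \<Rightarrow> 'i \<Rightarrow> complex) \<Rightarrow> ('i \<Rightarrow> 'i \<Rightarrow> complex) \<Rightarrow> 'i set \<Rightarrow> 'i \<Rightarrow> 'i \<Rightarrow> complex" where
  "residual G \<phi> D i j = G i j - (\<Sum>\<^sub>\<infinity>l\<in>D. cnj (\<phi> l i) * \<phi> l j)"

definition cholesky :: "('i \<times> 'i) set \<Rightarrow> ('i \<Rightarrow> 'i \<Rightarrow> complex) \<Rightarrow> 'i \<Rightarrow> 'i \<Rightarrow> complex" where
  "cholesky r G = wfrec r (\<lambda>\<phi> m j. residual G \<phi> {l. (l, m) \<in> r} m j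
     / complex_of_real (sqrt (Re (residual G \<phi> {l. (l, m) \<in> r} m m))))"

lemma cholesky_unfold:
  assumes "wf r"
  shows "cholesky r G m j = residual G (cholesky r G) {l. (l, m) \<in> r} m j
     / complex_of_real (sqrt (Re (residual G (cholesky r G) {l. (l, m) \<in> r} m m)))"
proof -
  have "residual G (cut f r m) {l. (l, m) \<in> r} = residual G f {l. (l, m) \<in> r}" for f
    unfolding residual_def cut_def by (intro ext arg_cong2[where f = "(-)"] infsum_cong refl) simp
  then show ?thesis unfolding cholesky_def by (subst wfrec[OF assms]) simp
qed

text \<open>If every finite sum of the rank-one forms of the rows is dominated by the form of \<open>G\<close>, the
  infinite sum converges and what remains of \<open>G\<close> is still positive definite.\<close>

lemma pd_kernel_residual:
  fixes G :: "'i \<Rightarrow> 'i \<Rightarrow> complex"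
  assumes G: "pd_kernel G"
    and dom: "\<And>F J c. finite F \<Longrightarrow> F \<subseteq> D \<Longrightarrow> finite J \<Longrightarrow>
      (\<Sum>l\<in>F. (cmod (\<Sum>j\<in>J. c j * \<phi> l j))\<^sup>2) \<le> Re (kernel_form G J c)"
  shows "pd_kernel (residual G \<phi> D)"
    and "\<And>i j. ((\<lambda>l. cnj (\<phi> l i) * \<phi> l j) has_sum (G i j - residual G \<phi> D i j)) D"
    and "\<And>J c. finite J \<Longrightarrow> ((\<lambda>l. (cmod (\<Sum>j\<in>J. c j * \<phi> l j))\<^sup>2) has_sum
          Re (kernel_form G J c) - Re (kernel_form (residual G \<phi> D) J c)) D"
proof -
  have sq: "(\<lambda>l. (cmod (\<phi> l i))\<^sup>2) summable_on D" for i
  proof (rule nonneg_bdd_above_summable_on)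
    have "(\<Sum>l\<in>F. (cmod (\<phi> l i))\<^sup>2) \<le> Re (kernel_form G {i} (\<lambda>_. 1))" if "finite F" "F \<subseteq> D" for F
      using dom[OF that, of "{i}" "\<lambda>_. 1"] by simp
    then show "bdd_above (sum (\<lambda>l. (cmod (\<phi> l i))\<^sup>2) ` {F. F \<subseteq> D \<and> finite F})"
      by (intro bdd_aboveI2) auto
  qed simp
  show hs: "((\<lambda>l. cnj (\<phi> l i) * \<phi> l j) has_sum (G i j - residual G \<phi> D i j)) D" for i j
    unfolding residual_def using has_sum_infsum[OF summable_on_cnj_mult[OF sq sq]] by simp
  show hq: "((\<lambda>l. (cmod (\<Sum>j\<in>J. c j * \<phi> l j))\<^sup>2) has_sum
          Re (kernel_form G J c) - Re (kernel_form (residual G \<phi> D) J c)) D" if J: "finite J" for J c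
  proof -
    have "((\<lambda>l. (cmod (\<Sum>j\<in>J. c j * \<phi> l j))\<^sup>2) has_sum
        Re (kernel_form (\<lambda>i j. G i j - residual G \<phi> D i j) J c)) D"
      by (rule kernel_form_has_sum[OF J hs])
    then show ?thesis by (simp add: kernel_form_diff)
  qed
  have herm: "residual G \<phi> D j i = cnj (residual G \<phi> D i j)" for i j
  proof -
    have "((\<lambda>l. cnj (\<phi> l i) * \<phi> l j) has_sum cnj (G j i - residual G \<phi> D j i)) D"
      using has_sum_cnj_iff[THEN iffD2, OF hs[of j i]] by (simp add: mult.commute[of "cnj _"])
    then have "G i j - residual G \<phi> D i j = cnj (G j i - residual G \<phi> D j i)"
      using hs[of i j] has_sum_unique by blast
    then show ?thesis using pd_kernel_hermitian[OF G, of i j] by simp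
  qed
  show "pd_kernel (residual G \<phi> D)"
    unfolding pd_kernel_def
  proof (intro allI impI)
    fix J :: "'i set" and c :: "'i \<Rightarrow> complex" assume J: "finite J"
    have "Re (kernel_form G J c) - Re (kernel_form (residual G \<phi> D) J c) \<le> Re (kernel_form G J c)"
      by (rule has_sum_le_finite_sums[OF hq[OF J]]) (use dom J in auto)
    moreover have "Im (kernel_form (residual G \<phi> D) J c) = 0"
    proof -
      have "kernel_form (residual G \<phi> D) J c = cnj (kernel_form (residual G \<phi> D) J c)"
        unfolding kernel_form_def cnj_sum
        by (subst sum.swap) (auto intro!: sum.cong simp: herm mult_ac simp flip: herm)
      then show ?thesis by (metis cnj.simps(2) equal_neg_zero)
    qed
    ultimately show "0 \<le> kernel_form (residual G \<phi> D) J c" by (simp add: less_eq_complex_def)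
  qed
qed

text \<open>Well-founded induction on the largest stage \<open>m\<close> of \<open>F\<close>: the earlier stages leave a positive
  definite residual, and by the Schur complement it dominates the form of row \<open>m\<close>.  Limit
  stages need no separate argument, because a finite set always has a largest element.\<close>

lemma cholesky_dominated:
  fixes G :: "'i \<Rightarrow> 'i \<Rightarrow> complex"
  assumes wo: "well_order_on UNIV R" and r: "r = R - Id" and G: "pd_kernel G"
    and F: "finite F" and J: "finite J"
  shows "(\<Sum>l\<in>F. (cmod (\<Sum>j\<in>J. c j * cholesky r G l j))\<^sup>2) \<le> Re (kernel_form G J c)"
proof -
  have lin: "linear_order_on UNIV R" and wf: "wf r" using wo unfolding well_order_on_def r by auto
  have tot: "(a, b) \<in> r \<or> a = b \<or> (b, a) \<in> r" for a b
    using lin unfolding linear_order_on_def total_on_def r by auto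
  have trans: "(a, b) \<in> r \<Longrightarrow> (b, c) \<in> r \<Longrightarrow> (a, c) \<in> r" for a b c
    using lin unfolding linear_order_on_def partial_order_on_def preorder_on_def trans_def antisym_def r by blast
  let ?\<phi> = "cholesky r G"
  have maxex: "\<exists>m\<in>F. \<forall>l\<in>F. (l, m) \<in> r \<or> l = m" if "finite F" "F \<noteq> {}" for F
    using that
  proof (induction F rule: finite_ne_induct)
    case (insert x F)
    then obtain m where "m \<in> F" "\<forall>l\<in>F. (l, m) \<in> r \<or> l = m" by blast
    then show ?case using tot[of x m] trans by (metis insert_iff)
  qed simp
  have G0: "0 \<le> Re (kernel_form G J c)" if "finite J" for J c
    using pd_kernelD[OF G that] by (simp add: less_eq_complex_def)
  have main: "\<forall>F J c. finite F \<longrightarrow> finite J \<longrightarrow> (\<forall>l\<in>F. (l, m) \<in> r \<or> l = m) \<longrightarrow>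
      (\<Sum>l\<in>F. (cmod (\<Sum>j\<in>J. c j * ?\<phi> l j))\<^sup>2) \<le> Re (kernel_form G J c)" for m
    using wf
  proof (induction m rule: wf_induct_rule)
    case (less m)
    let ?D = "{l. (l, m) \<in> r}"
    have dom: "(\<Sum>l\<in>F. (cmod (\<Sum>j\<in>J. c j * ?\<phi> l j))\<^sup>2) \<le> Re (kernel_form G J c)"
      if "finite F" "F \<subseteq> ?D" "finite J" for F J c
    proof (cases "F = {}")
      case False
      then obtain l where "l \<in> F" "\<forall>k\<in>F. (k, l) \<in> r \<or> k = l" using maxex \<open>finite F\<close> by blast
      then show ?thesis using less.IH[of l] that by blast
    qed (use G0 that in simp)
    note res = pd_kernel_residual[OF G dom, of ?D, simplified]
    show ?case
    proof (intro allI impI)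
      fix F and J :: "'i set" and c :: "'i \<Rightarrow> complex"
      assume F: "finite F" and J: "finite J" and Fm: "\<forall>l\<in>F. (l, m) \<in> r \<or> l = m"
      let ?q = "\<lambda>l. (cmod (\<Sum>j\<in>J. c j * ?\<phi> l j))\<^sup>2"
      let ?R = "residual G ?\<phi> ?D"
      have "m \<notin> ?D" by (simp add: r)
      have q: "?q m \<le> Re (kernel_form ?R J c)"
      proof (cases "?R m m = 0")
        case True
        then have "?\<phi> m j = 0" for j by (subst cholesky_unfold[OF wf]) simp
        then show ?thesis using pd_kernelD[OF res(1) J] by (simp add: less_eq_complex_def)
      next
        case False
        have "?\<phi> m = (\<lambda>j. ?R m j / complex_of_real (sqrt (Re (?R m m))))"
          by (rule ext, rule cholesky_unfold[OF wf])
        then show ?thesis using pd_kernel_Schur[OF res(1) False J] by simp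
      qed
      have "sum ?q (F - {m}) \<le> Re (kernel_form G J c) - Re (kernel_form ?R J c)"
        by (rule finite_sum_le_has_sum[OF res(3)[OF J]]) (use F Fm in auto)
      moreover have "sum ?q F \<le> sum ?q (insert m (F - {m}))"
        using F by (intro sum_mono2) auto
      moreover have "\<dots> = ?q m + sum ?q (F - {m})"
        using F by (intro sum.insert) auto
      ultimately show "sum ?q F \<le> Re (kernel_form G J c)" using q by linarith
    qed
  qed
  show ?thesis
  proof (cases "F = {}")
    case False
    then obtain m where "m \<in> F" "\<forall>l\<in>F. (l, m) \<in> r \<or> l = m" using maxex F by blast
    then show ?thesis using main F J by blast
  qed (use G0 J in simp)
qed

text \<open>Stage \<open>m\<close> reduces the diagonal entry at \<open>m\<close> to zero, so the residual after all stages has zero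
  diagonal; a positive definite kernel with zero diagonal vanishes.\<close>

theorem pd_kernel_Cholesky:
  fixes G :: "'i \<Rightarrow> 'i \<Rightarrow> complex"
  assumes G: "pd_kernel G"
  shows "\<exists>\<phi> :: 'i \<Rightarrow> 'i \<Rightarrow> complex. \<forall>i j. ((\<lambda>l. cnj (\<phi> l i) * \<phi> l j) has_sum G i j) UNIV"
proof -
  obtain R :: "('i \<times> 'i) set" where wo: "well_order_on UNIV R" using well_order_on by blast
  define r where "r = R - Id"
  have wf: "wf r" using wo unfolding well_order_on_def r_def by simp
  define \<phi> where "\<phi> = cholesky r G"
  have dom: "(\<Sum>l\<in>F. (cmod (\<Sum>j\<in>J. c j * \<phi> l j))\<^sup>2) \<le> Re (kernel_form G J c)"
    if "finite F" "finite J" for F J c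
    unfolding \<phi>_def by (rule cholesky_dominated[OF wo r_def G that])
  note total = pd_kernel_residual[OF G dom, of UNIV, simplified]
  let ?S = "residual G \<phi> UNIV"
  have "?S m m = 0" for m
  proof -
    let ?D = "{l. (l, m) \<in> r}"
    note part = pd_kernel_residual[OF G dom, of ?D, simplified]
    let ?R = "residual G \<phi> ?D"
    define d where "d = Re (?R m m)"
    have d0: "0 \<le> d" using pd_kernel_diag[OF part(1), of m] by (simp add: d_def less_eq_complex_def)
    have Rd: "?R m m = complex_of_real d" unfolding d_def by (rule pd_kernel_diag_real[OF part(1)])
    have "\<phi> m m = ?R m m / complex_of_real (sqrt (Re (?R m m)))"
      unfolding \<phi>_def by (rule cholesky_unfold[OF wf])
    also have "\<dots> = complex_of_real (d / sqrt d)" by (simp add: Rd)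
    finally have pm: "(cmod (\<phi> m m))\<^sup>2 = d" using d0 by (simp add: real_div_sqrt)
    have one: "kernel_form K {m} (\<lambda>_. 1) = K m m" for K :: "'i \<Rightarrow> 'i \<Rightarrow> complex"
      by (simp add: kernel_form_def)
    have "((\<lambda>l. (cmod (\<phi> l m))\<^sup>2) has_sum Re (G m m) - d) ?D"
      using part(3)[of "{m}" "\<lambda>_. 1"] by (simp add: one d_def)
    then have "((\<lambda>l. (cmod (\<phi> l m))\<^sup>2) has_sum (cmod (\<phi> m m))\<^sup>2 + (Re (G m m) - d)) (insert m ?D)"
      by (rule has_sum_insert[rotated]) (simp add: r_def)
    then have h1: "((\<lambda>l. (cmod (\<phi> l m))\<^sup>2) has_sum Re (G m m)) (insert m ?D)" by (simp add: pm)
    have h2: "((\<lambda>l. (cmod (\<phi> l m))\<^sup>2) has_sum Re (G m m) - Re (?S m m)) UNIV"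
      using total(3)[of "{m}" "\<lambda>_. 1"] by (simp add: one)
    have "Re (G m m) \<le> Re (G m m) - Re (?S m m)"
      by (rule has_sum_mono2[OF h1 h2]) auto
    then have "Re (?S m m) = 0" using pd_kernel_diag[OF total(1), of m] by (simp add: less_eq_complex_def)
    then show "?S m m = 0" using pd_kernel_diag_real[OF total(1), of m] by simp
  qed
  then have "?S i j = 0" for i j using pd_kernel_zero_diag[OF total(1)] by blast
  then have "((\<lambda>l. cnj (\<phi> l i) * \<phi> l j) has_sum G i j) UNIV" for i j
    using total(2)[of i j] by simp
  then show ?thesis by blast
qed

section \<open>Positive operators and the trace\<close>

lemma bounded_clinearD:
  assumes "bounded_clinear T"
  shows "T (x + y) = T x + T y" "T (x - y) = T x - T y" "T (r *\<^sub>R x) = r *\<^sub>R T x"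
    "T (c *\<^sub>C x) = c *\<^sub>C T x" "T 0 = 0" "T (\<Sum>i\<in>A. f i) = (\<Sum>i\<in>A. T (f i))"
  using assms unfolding bounded_clinear_def
  by (auto simp: linear_simps linear_sum[OF bounded_linear.linear])

lemma bounded_clinear_bound:
  assumes "bounded_clinear T"
  shows "\<exists>K>0. \<forall>x. norm (T x) \<le> norm x * K"
  using assms bounded_linear.pos_bounded unfolding bounded_clinear_def by blast

text \<open>Viewing a positive operator as a positive definite kernel on the vectors makes its
  self-adjointness an instance of the Hermitian symmetry of such kernels.\<close>

lemma pd_kernel_positive_op:
  assumes "positive_op T"
  shows "pd_kernel (\<lambda>x y. cinner x (T y))"
  unfolding pd_kernel_def
proof (intro allI impI)
  fix J :: "'a set" and c
  have T: "bounded_clinear T" using assms by (simp add: positive_op_def)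
  have "kernel_form (\<lambda>x y. cinner x (T y)) J c = cinner (\<Sum>x\<in>J. c x *\<^sub>C x) (T (\<Sum>x\<in>J. c x *\<^sub>C x))"
    unfolding kernel_form_def bounded_clinearD(6)[OF T] bounded_clinearD(4)[OF T] cinner_sum_left cinner_sum_right
    by (subst sum.swap) (simp add: cinner_simps mult_ac)
  then show "0 \<le> kernel_form (\<lambda>x y. cinner x (T y)) J c"
    using assms by (simp add: positive_op_def)
qed

lemma positive_op_selfadjoint:
  assumes "positive_op T"
  shows "cinner (T x) y = cinner x (T y)"
  using pd_kernel_hermitian[OF pd_kernel_positive_op[OF assms], of x y] cinner_commute[of "T x" y] by simp

text \<open>This is the uniqueness of positive square roots.  Let \<open>D = T - P\<close> and \<open>S = T + P\<close>.  The hypothesis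
  gives \<open>Re \<langle>S x, D x\<rangle> = \<parallel>T x\<parallel>\<^sup>2 - \<parallel>P x\<parallel>\<^sup>2 = 0\<close>.  For an approximate eigenvector \<open>x\<close> of the
  self-adjoint operator \<open>D\<close> with eigenvalue \<open>\<plusminus>\<parallel>D\<parallel>\<close> this makes \<open>\<parallel>D\<parallel> \<langle>x, S x\<rangle>\<close> small, while
  \<open>|\<langle>x, D x\<rangle>|\<close> is close to \<open>\<parallel>D\<parallel>\<close> and at most \<open>\<langle>x, S x\<rangle>\<close>.\<close>

lemma positive_op_eqI:
  fixes T P :: "'h::complex_hilbert \<Rightarrow> 'h"
  assumes T: "positive_op T" and P: "positive_op P" and eq: "\<And>x. norm (T x) = norm (P x)"
  shows "T = P"
proof -
  have bT: "bounded_clinear T" and bP: "bounded_clinear P" using T P by (auto simp: positive_op_def)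
  obtain K1 where K1: "K1 > 0" "\<And>x. norm (T x) \<le> norm x * K1" using bounded_clinear_bound[OF bT] by blast
  obtain K2 where K2: "K2 > 0" "\<And>x. norm (P x) \<le> norm x * K2" using bounded_clinear_bound[OF bP] by blast
  define K where "K = K1 + K2"
  have K: "K > 0" using K1 K2 by (simp add: K_def)
  define D where "D x = T x - P x" for x
  define S where "S x = T x + P x" for x
  have Dlin: "D (x + y) = D x + D y" "D (x - y) = D x - D y" "D (r *\<^sub>R x) = r *\<^sub>R D x" for x y r
    using bounded_clinearD[OF bT] bounded_clinearD[OF bP] by (simp_all add: D_def algebra_simps)
  have Dsa: "cinner (D x) y = cinner x (D y)" for x y
    by (simp add: D_def cinner_simps positive_op_selfadjoint[OF T] positive_op_selfadjoint[OF P])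
  have nD: "norm (D x) \<le> norm x * K" for x
    using norm_triangle_ineq4[of "T x" "P x"] K1(2)[of x] K2(2)[of x] by (simp add: D_def K_def algebra_simps)
  have nS: "norm (S x) \<le> norm x * K" for x
    using norm_triangle_ineq[of "T x" "P x"] K1(2)[of x] K2(2)[of x] by (simp add: S_def K_def algebra_simps)
  have orth: "Re (cinner (S x) (D x)) = 0" for x
  proof -
    have "Re (cinner (P x) (T x)) = Re (cinner (T x) (P x))"
      using cinner_commute[of "P x" "T x"] by simp
    then show ?thesis by (simp add: S_def D_def cinner_simps cinner_self eq)
  qed
  define Q where "Q x = Re (cinner x (D x))" for x
  define m where "m = (SUP x\<in>cball 0 1. \<bar>Q x\<bar>)"
  have Qb: "\<bar>Q x\<bar> \<le> K" if "x \<in> cball 0 1" for x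
  proof -
    have "\<bar>Q x\<bar> \<le> norm x * norm (D x)"
      using abs_Re_le_cmod[of "cinner x (D x)"] cinner_Cauchy_Schwarz[of x "D x"] by (simp add: Q_def)
    also have "\<dots> \<le> 1 * (1 * K)" using that nD[of x] K
      by (intro mult_mono order_trans[OF nD] mult_right_mono) auto
    finally show ?thesis by simp
  qed
  have bdd: "bdd_above ((\<lambda>x. \<bar>Q x\<bar>) ` cball 0 1)" using Qb by (intro bdd_aboveI2)
  have Qm1: "\<bar>Q x\<bar> \<le> m" if "x \<in> cball 0 1" for x unfolding m_def by (rule cSUP_upper[OF that bdd])
  have m0: "0 \<le> m" using Qm1[of 0] by (simp add: Q_def)
  have Qscale: "Q (r *\<^sub>R x) = r\<^sup>2 * Q x" for r x
    by (simp add: Q_def Dlin cinner_simps power2_eq_square)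
  have Qm: "\<bar>Q x\<bar> \<le> m * (norm x)\<^sup>2" for x
  proof (cases "x = 0")
    case False
    have "\<bar>Q ((1 / norm x) *\<^sub>R x)\<bar> \<le> m" using False by (intro Qm1) simp
    then show ?thesis using False unfolding Qscale by (simp add: abs_mult power_divide field_simps)
  qed (simp add: Q_def)
  have nDm: "norm (D y) \<le> m * norm y" for y
  proof (cases "D y = 0 \<or> y = 0")
    case False
    \<comment> \<open>Polarization against the vector of length \<open>\<parallel>y\<parallel>\<close> in the direction of \<open>D y\<close>.\<close>
    define x where "x = (norm y / norm (D y)) *\<^sub>R D y"
    have nx: "norm x = norm y" using False by (simp add: x_def)
    have "Re (cinner x (D y)) = norm y * norm (D y)"
      using False by (simp add: x_def cinner_simps cinner_self power2_eq_square)
    moreover have "4 * Re (cinner x (D y)) = Q (x + y) - Q (x - y)"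
    proof -
      have "Re (cinner y (D x)) = Re (cinner x (D y))"
        using Dsa[of x y] cinner_commute[of y "D x"] by simp
      then show ?thesis by (simp add: Q_def Dlin cinner_simps)
    qed
    moreover have "Q (x + y) - Q (x - y) \<le> m * ((norm (x + y))\<^sup>2 + (norm (x - y))\<^sup>2)"
      using Qm[of "x + y"] Qm[of "x - y"] by (simp add: algebra_simps)
    ultimately have "4 * (norm y * norm (D y)) \<le> m * (4 * (norm y)\<^sup>2)"
      unfolding parallelogram_law nx by simp
    then have "norm y * norm (D y) \<le> norm y * (m * norm y)" by (simp add: power2_eq_square mult_ac)
    then show ?thesis using False by simp
  qed (use m0 Dlin(3)[of 0 0] in auto)
  have ineq: "m * (m - e) \<le> K * sqrt (2 * m * e)" if e: "e > 0" for e
  proof -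
    have "\<exists>x\<in>cball 0 1. m - e < \<bar>Q x\<bar>"
      by (subst less_cSUP_iff[OF _ bdd, symmetric]) (use e in \<open>auto simp: m_def[symmetric]\<close>)
    then obtain x where x: "norm x \<le> 1" "m - e < \<bar>Q x\<bar>" by auto
    \<comment> \<open>\<open>x\<close> is an approximate eigenvector for \<open>l = \<plusminus>m\<close>, and \<open>w\<close> is the error.\<close>
    define l where "l = (if Q x \<ge> 0 then m else - m)"
    have lQ: "l * Q x = m * \<bar>Q x\<bar>" "l\<^sup>2 = m\<^sup>2" by (auto simp: l_def)
    define w where "w = D x - l *\<^sub>R x"
    have x2: "(norm x)\<^sup>2 \<le> 1" using x(1) by (simp add: power_le_one)
    have "(norm w)\<^sup>2 = (norm (D x))\<^sup>2 + m\<^sup>2 * (norm x)\<^sup>2 - 2 * (m * \<bar>Q x\<bar>)"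
    proof -
      have "Re (cinner (D x) (l *\<^sub>R x)) = l * Q x" by (simp add: Dsa Dlin cinner_simps Q_def)
      then show ?thesis unfolding w_def norm_diff_square lQ(1)[symmetric] lQ(2)[symmetric]
        by (simp add: power_mult_distrib)
    qed
    also have "(norm (D x))\<^sup>2 \<le> m\<^sup>2 * (norm x)\<^sup>2"
      using power_mono[OF nDm[of x] norm_ge_zero, of 2] by (simp add: power_mult_distrib)
    also have "m\<^sup>2 * (norm x)\<^sup>2 + m\<^sup>2 * (norm x)\<^sup>2 - 2 * (m * \<bar>Q x\<bar>) \<le> m\<^sup>2 + m\<^sup>2 - 2 * (m * (m - e))"
    proof -
      have "m\<^sup>2 * (norm x)\<^sup>2 \<le> m\<^sup>2" using x2 by (simp add: mult_left_le)
      moreover have "m * (m - e) \<le> m * \<bar>Q x\<bar>" using x(2) m0 by (intro mult_left_mono) auto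
      ultimately show ?thesis by linarith
    qed
    also have "\<dots> = 2 * m * e" by (simp add: power2_eq_square algebra_simps)
    finally have nw: "norm w \<le> sqrt (2 * m * e)" by (intro real_le_rsqrt) simp
    have Sx: "Re (cinner x (S x)) \<ge> \<bar>Q x\<bar>"
      using T P unfolding Q_def S_def D_def positive_op_def
      by (simp add: cinner_simps less_eq_complex_def abs_le_iff)
    have "D x = l *\<^sub>R x + w" by (simp add: w_def)
    then have "0 = Re (cinner (S x) (l *\<^sub>R x + w))" using orth[of x] by simp
    also have "\<dots> = l * Re (cinner (S x) x) + Re (cinner (S x) w)" by (simp add: cinner_simps)
    also have "Re (cinner (S x) x) = Re (cinner x (S x))" using cinner_commute[of "S x" x] by simp
    finally have "\<bar>l * Re (cinner x (S x))\<bar> = \<bar>Re (cinner (S x) w)\<bar>" by linarith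
    also have "\<bar>l * Re (cinner x (S x))\<bar> = m * Re (cinner x (S x))"
      using m0 Sx by (auto simp: l_def abs_mult)
    also have "\<bar>Re (cinner (S x) w)\<bar> \<le> norm (S x) * norm w"
      using abs_Re_le_cmod cinner_Cauchy_Schwarz order_trans by blast
    also have "\<dots> \<le> K * sqrt (2 * m * e)"
    proof (intro mult_mono nw)
      have "norm x * K \<le> 1 * K" using x K by (intro mult_right_mono) auto
      then show "norm (S x) \<le> K" using nS[of x] by simp
    qed (use K in auto)
    finally have "m * Re (cinner x (S x)) \<le> K * sqrt (2 * m * e)" .
    moreover have "m * (m - e) \<le> m * Re (cinner x (S x))" using x(2) Sx m0 by (intro mult_left_mono) auto
    ultimately show ?thesis by linarith
  qed
  have "m * (m - 0) \<le> K * sqrt (2 * m * 0)"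
  proof (rule tendsto_le)
    show "((\<lambda>e. K * sqrt (2 * m * e)) \<longlongrightarrow> K * sqrt (2 * m * 0)) (at_right 0)" by (intro tendsto_intros)
    show "((\<lambda>e. m * (m - e)) \<longlongrightarrow> m * (m - 0)) (at_right 0)" by (intro tendsto_intros)
    show "\<forall>\<^sub>F e in at_right 0. m * (m - e) \<le> K * sqrt (2 * m * e)"
      using ineq eventually_at_right_less[of 0] by (auto elim: eventually_mono)
  qed simp
  then have "m\<^sup>2 \<le> 0" by (simp add: power2_eq_square)
  then have "m = 0" by simp
  then have "D y = 0" for y using nDm[of y] by simp
  then show ?thesis by (auto simp: D_def)
qed

text \<open>For a positive operator, \<open>|T| = T\<close> by uniqueness of the square root.\<close>

lemma trace_class_positive_summable:
  assumes "positive_op T" "trace_class T"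
  shows "\<exists>B. is_onb B \<and> (\<lambda>e. Re (cinner e (T e))) summable_on B"
proof -
  obtain P B where P: "is_abs_op T P" and B: "is_onb B" "(\<lambda>e. cinner e (P e)) summable_on B"
    using assms(2) unfolding trace_class_def by blast
  have "norm (T x) = norm (P x)" for x
  proof -
    have "complex_of_real ((norm (T x))\<^sup>2) = complex_of_real ((norm (P x))\<^sup>2)"
      using P unfolding cinner_self[symmetric] is_abs_op_def by simp
    then have "(norm (T x))\<^sup>2 = (norm (P x))\<^sup>2" by (simp only: of_real_eq_iff)
    then show ?thesis by (simp add: power2_eq_iff_nonneg)
  qed
  then have "T = P" using positive_op_eqI assms(1) P unfolding is_abs_op_def by blast
  then show ?thesis using B summable_on_Re by blast
qed

section \<open>Weak operator expectations\<close>

text \<open>By the Baire category theorem some sublevel set \<open>{x. p x \<le> n}\<close> contains a ball; by symmetry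
  and subadditivity \<open>p\<close> is then bounded on a ball around the origin.\<close>

lemma lsc_seminorm_bounded:
  fixes p :: "'a::banach \<Rightarrow> real"
  assumes tri: "\<And>x y. p (x + y) \<le> p x + p y"
    and scale: "\<And>r x. p (r *\<^sub>R x) = \<bar>r\<bar> * p x"
    and closed: "\<And>c. closed {x. p x \<le> c}"
  shows "\<exists>C\<ge>0. \<forall>x. p x \<le> C * norm x"
proof -
  define A where "A n = {x. p x \<le> real n}" for n
  have "\<exists>n. interior (A n) \<noteq> {}"
  proof (rule ccontr)
    assume "\<nexists>n. interior (A n) \<noteq> {}"
    then have "interior (\<Union>(range A)) = {}"
      using Met_TC.metric_Baire_category_alt[where \<G> = "range A"] closed complete_UNIV
      by (auto simp: A_def)
    moreover have "\<Union>(range A) = UNIV" using real_arch_simple unfolding A_def by auto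
    ultimately show False by simp
  qed
  then obtain n x0 where "x0 \<in> interior (A n)" by blast
  then obtain e where e: "e > 0" "ball x0 e \<subseteq> A n" using mem_interior by blast
  define K where "K = real n + p x0"
  have small: "p y \<le> K" if "norm y < e" for y
  proof -
    have "x0 + y \<in> A n" using e(2) that by (auto simp: subset_iff dist_norm)
    moreover have "p y \<le> p (x0 + y) + p ((-1) *\<^sub>R x0)" using tri[of "x0 + y" "(-1) *\<^sub>R x0"] by simp
    ultimately show ?thesis unfolding scale by (simp add: A_def K_def)
  qed
  have K0: "0 \<le> K" using small[of 0] scale[of 0 0] e(1) by simp
  have "p x \<le> (2 * K / e) * norm x" for x
  proof (cases "x = 0")
    case False
    have "\<bar>e / (2 * norm x)\<bar> * p x \<le> K"
      unfolding scale[symmetric] using False e(1) by (intro small) simp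
    then show ?thesis using False e(1) by (simp add: field_simps)
  qed (use scale[of 0 0] in simp)
  then show ?thesis using K0 e(1) by (intro exI[of _ "2 * K / e"]) auto
qed

text \<open>Lower semicontinuity of the \<open>L\<^sup>1\<close> norm under pointwise convergence is Fatou's lemma.\<close>

lemma closed_L1_sublevel:
  fixes g :: "'a::metric_space \<Rightarrow> 'w \<Rightarrow> complex"
  assumes int: "\<And>x. integrable M (g x)"
    and cont: "\<And>\<omega>. \<omega> \<in> space M \<Longrightarrow> continuous_on UNIV (\<lambda>x. g x \<omega>)"
  shows "closed {x. (\<integral>\<omega>. cmod (g x \<omega>) \<partial>M) \<le> c}"
  unfolding closed_sequential_limits
proof (intro allI impI, elim conjE)
  fix X x assume X: "\<forall>n. X n \<in> {x. (\<integral>\<omega>. cmod (g x \<omega>) \<partial>M) \<le> c}" and lim: "X \<longlonglongrightarrow> x"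
  have [measurable]: "g y \<in> borel_measurable M" for y using int by (rule borel_measurable_integrable)
  have eq: "(\<integral>\<^sup>+\<omega>. ennreal (cmod (g y \<omega>)) \<partial>M) = ennreal (\<integral>\<omega>. cmod (g y \<omega>) \<partial>M)" for y
    by (intro nn_integral_eq_integral integrable_norm int) auto
  have "0 \<le> (\<integral>\<omega>. cmod (g (X 0) \<omega>) \<partial>M)" by (rule Bochner_Integration.integral_nonneg) simp
  also have "\<dots> \<le> c" using X[rule_format, of 0] by simp
  finally have c0: "0 \<le> c" .
  have "(\<integral>\<^sup>+\<omega>. ennreal (cmod (g x \<omega>)) \<partial>M) = (\<integral>\<^sup>+\<omega>. liminf (\<lambda>n. ennreal (cmod (g (X n) \<omega>))) \<partial>M)"
  proof (rule nn_integral_cong)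
    fix \<omega> assume "\<omega> \<in> space M"
    then have "(\<lambda>n. g (X n) \<omega>) \<longlonglongrightarrow> g x \<omega>"
      using continuous_on_tendsto_compose[OF cont lim] by auto
    then have "(\<lambda>n. ennreal (cmod (g (X n) \<omega>))) \<longlonglongrightarrow> ennreal (cmod (g x \<omega>))"
      by (intro tendsto_ennrealI tendsto_norm)
    then show "ennreal (cmod (g x \<omega>)) = liminf (\<lambda>n. ennreal (cmod (g (X n) \<omega>)))"
      by (intro lim_imp_Liminf[symmetric]) auto
  qed
  also have "\<dots> \<le> liminf (\<lambda>n. \<integral>\<^sup>+\<omega>. ennreal (cmod (g (X n) \<omega>)) \<partial>M)"
    by (rule nn_integral_liminf) measurable
  also have "\<dots> \<le> limsup (\<lambda>n. \<integral>\<^sup>+\<omega>. ennreal (cmod (g (X n) \<omega>)) \<partial>M)"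
    by (intro Liminf_le_Limsup) auto
  also have "\<dots> \<le> ennreal c"
    unfolding eq using X by (intro Limsup_bounded always_eventually) (auto intro: ennreal_leI)
  finally show "x \<in> {x. (\<integral>\<omega>. cmod (g x \<omega>) \<partial>M) \<le> c}" using c0 by (simp add: eq)
qed

lemma L1_family_bounded:
  fixes g :: "'a::banach \<Rightarrow> 'w \<Rightarrow> complex"
  assumes int: "\<And>x. integrable M (g x)"
    and lin: "\<And>\<omega>. \<omega> \<in> space M \<Longrightarrow> bounded_linear (\<lambda>x. g x \<omega>)"
  shows "\<exists>C\<ge>0. \<forall>x. cmod (\<integral>\<omega>. g x \<omega> \<partial>M) \<le> C * norm x"
proof -
  have "\<exists>C\<ge>0. \<forall>x. (\<integral>\<omega>. cmod (g x \<omega>) \<partial>M) \<le> C * norm x"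
  proof (rule lsc_seminorm_bounded)
    show "(\<integral>\<omega>. cmod (g (x + y) \<omega>) \<partial>M) \<le> (\<integral>\<omega>. cmod (g x \<omega>) \<partial>M) + (\<integral>\<omega>. cmod (g y \<omega>) \<partial>M)" for x y
      unfolding Bochner_Integration.integral_add[OF integrable_norm[OF int] integrable_norm[OF int], symmetric]
      by (intro integral_mono integrable_norm int Bochner_Integration.integrable_add)
         (simp add: linear_simps[OF lin] norm_triangle_ineq)
    show "(\<integral>\<omega>. cmod (g (r *\<^sub>R x) \<omega>) \<partial>M) = \<bar>r\<bar> * (\<integral>\<omega>. cmod (g x \<omega>) \<partial>M)" for r x
      unfolding integral_mult_right_zero[symmetric]
      by (intro Bochner_Integration.integral_cong refl) (simp add: linear_simps[OF lin])
    show "closed {x. (\<integral>\<omega>. cmod (g x \<omega>) \<partial>M) \<le> c}" for c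
      by (intro closed_L1_sublevel int linear_continuous_on lin)
  qed
  then obtain C where "C \<ge> 0" "\<And>x. (\<integral>\<omega>. cmod (g x \<omega>) \<partial>M) \<le> C * norm x" by blast
  then show ?thesis by (intro exI[of _ C]) (auto intro: order_trans[OF integral_norm_bound])
qed

text \<open>Weak integrability alone makes the sesquilinear form \<open>\<integral> \<langle>a, F \<omega> b\<rangle>\<close> bounded: Fatou's lemma
  and category give boundedness in each variable, and a second appeal to category makes the
  bound uniform.\<close>

lemma weak_expectation_exists:
  fixes F :: "'w \<Rightarrow> 'h::complex_hilbert \<Rightarrow> 'h"
  assumes op: "\<And>\<omega>. \<omega> \<in> space M \<Longrightarrow> bounded_clinear (F \<omega>)"
    and int: "\<And>a b. integrable M (\<lambda>\<omega>. cinner a (F \<omega> b))"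
  shows "\<exists>T. has_op_expectation M F T"
proof -
  define B where "B a b = (\<integral>\<omega>. cinner a (F \<omega> b) \<partial>M)" for a b
  have B: "B (a + a') b = B a b + B a' b" "B a (b + b') = B a b + B a b'"
      "B (c *\<^sub>C a) b = cnj c * B a b" "B a (c *\<^sub>C b) = c * B a b" for a a' b b' c
  proof -
    show "B (a + a') b = B a b + B a' b" "B (c *\<^sub>C a) b = cnj c * B a b"
      unfolding B_def cinner_add_left cinner_scaleC_left
      by (simp_all add: Bochner_Integration.integral_add[OF int int])
    have "B a (b + b') = (\<integral>\<omega>. cinner a (F \<omega> b) + cinner a (F \<omega> b') \<partial>M)"
      unfolding B_def by (intro Bochner_Integration.integral_cong refl) (simp add: bounded_clinearD[OF op] cinner_simps)
    then show "B a (b + b') = B a b + B a b'"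
      unfolding B_def by (simp add: Bochner_Integration.integral_add[OF int int])
    have "B a (c *\<^sub>C b) = (\<integral>\<omega>. c * cinner a (F \<omega> b) \<partial>M)"
      unfolding B_def by (intro Bochner_Integration.integral_cong refl) (simp add: bounded_clinearD[OF op] cinner_simps)
    then show "B a (c *\<^sub>C b) = c * B a b" unfolding B_def by simp
  qed
  have BR: "B a (r *\<^sub>R b) = r *\<^sub>R B a b" for a b r by (simp add: scaleR_scaleC B scaleR_conv_of_real)
  have "\<exists>C\<ge>0. \<forall>b. cmod (B a b) \<le> C * norm b" for a
    unfolding B_def
  proof (rule L1_family_bounded[OF int])
    fix \<omega> assume "\<omega> \<in> space M"
    then have "bounded_linear (F \<omega>)" using op by (simp add: bounded_clinear_def)
    then show "bounded_linear (\<lambda>b. cinner a (F \<omega> b))"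
      by (rule bounded_linear_compose[OF bounded_linear_cinner_right])
  qed
  then obtain C0 where C0: "\<And>a b. cmod (B a b) \<le> C0 a * norm b" by metis
  have contB: "continuous_on UNIV (B a)" for a
    by (intro linear_continuous_on bounded_linear_intro[where K = "C0 a"] B(2) BR)
       (simp add: C0 mult.commute[of _ "C0 a"])
  have "\<exists>C\<ge>0. \<forall>a. cmod (B a b) \<le> C * norm a" for b
    unfolding B_def by (intro L1_family_bounded[OF int] bounded_linear_cinner_left)
  then obtain D where D: "\<And>b. 0 \<le> D b" "\<And>a b. cmod (B a b) \<le> D b * norm a" by metis
  \<comment> \<open>The norm of the functional \<open>B (\<cdot>) b\<close>; it is lower semicontinuous as a supremum of continuous functions of \<open>b\<close>.\<close>
  define p where "p b = (SUP a\<in>cball 0 1. cmod (B a b))" for b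
  have bdd: "bdd_above ((\<lambda>a. cmod (B a b)) ` cball 0 1)" for b
  proof (rule bdd_aboveI2)
    fix a :: 'h assume "a \<in> cball 0 1"
    then show "cmod (B a b) \<le> D b" using D(2)[of a b] D(1)[of b]
      by (intro order_trans[OF D(2)]) (simp add: mult_left_le)
  qed
  have up: "cmod (B a b) \<le> p b" if "norm a \<le> 1" for a b
    unfolding p_def using that by (intro cSUP_upper bdd) simp
  have least: "p b \<le> c \<longleftrightarrow> (\<forall>a\<in>cball 0 1. cmod (B a b) \<le> c)" for b c
    unfolding p_def by (intro cSUP_le_iff bdd) auto
  have "\<exists>C\<ge>0. \<forall>b. p b \<le> C * norm b"
  proof (rule lsc_seminorm_bounded)
    show "p (x + y) \<le> p x + p y" for x y
    proof -
      have "cmod (B a (x + y)) \<le> p x + p y" if "norm a \<le> 1" for a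
        unfolding B(2) by (rule norm_triangle_le, rule add_mono) (rule up[OF that])+
      then show ?thesis unfolding least by simp
    qed
    show "p (r *\<^sub>R x) = \<bar>r\<bar> * p x" for r x
    proof (cases "r = 0")
      case True
      have "p 0 \<le> 0" unfolding least using B(4)[of _ 0 0] by simp
      moreover have "0 \<le> p 0" by (rule order_trans[OF norm_ge_zero up[of 0 0]]) simp
      ultimately show ?thesis using True by simp
    next
      case False
      have le: "p (r *\<^sub>R x) \<le> \<bar>r\<bar> * p x" for r x
      proof -
        have "cmod (B a (r *\<^sub>R x)) \<le> \<bar>r\<bar> * p x" if "norm a \<le> 1" for a r x
          unfolding BR norm_scaleR by (rule mult_left_mono[OF up[OF that]]) simp
        then show ?thesis unfolding least by simp
      qed
      have "\<bar>r\<bar> * p x = \<bar>r\<bar> * p ((1 / r) *\<^sub>R r *\<^sub>R x)" using False by simp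
      also have "\<dots> \<le> \<bar>r\<bar> * (\<bar>1 / r\<bar> * p (r *\<^sub>R x))" by (intro mult_left_mono le) simp
      also have "\<dots> = p (r *\<^sub>R x)" using False by simp
      finally show ?thesis using le[of r x] by simp
    qed
    show "closed {b. p b \<le> c}" for c
    proof -
      have "{b. p b \<le> c} = (\<Inter>a\<in>cball 0 1. {b. cmod (B a b) \<le> c})" unfolding least by auto
      also have "closed \<dots>"
        by (intro closed_INT ballI closed_Collect_le continuous_intros continuous_on_norm contB)
      finally show ?thesis .
    qed
  qed
  then obtain C where C: "C \<ge> 0" "\<And>b. p b \<le> C * norm b" by blast
  have bound: "cmod (B a b) \<le> C * norm b * norm a" for a b
  proof (cases "a = 0")
    case False
    have "cmod (B ((1 / norm a) *\<^sub>R a) b) \<le> C * norm b"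
      using False by (intro order_trans[OF up C(2)]) simp
    then have "cmod (B a b) / norm a \<le> C * norm b"
      by (simp add: scaleR_scaleC B norm_mult norm_divide)
    then show ?thesis using False by (simp add: field_simps)
  qed (use D(2)[of 0 b] in simp)
  have "\<exists>v. \<forall>a. cnj (B a b) = cinner v a" for b
    by (rule Riesz_representation[where C = "C * norm b"]) (simp_all add: B bound)
  then obtain T where T: "\<And>a b. cnj (B a b) = cinner (T b) a" by metis
  have BT: "B a b = cinner a (T b)" for a b
    using T[of a b] cinner_commute[of a "T b"] by (metis complex_cnj_cnj)
  have "bounded_clinear T"
    unfolding bounded_clinear_def
  proof (intro conjI allI)
    show "T (c *\<^sub>C b) = c *\<^sub>C T b" for c b
      by (rule cinner_ext) (simp add: BT[symmetric] B cinner_scaleC_right)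
    then have "T (r *\<^sub>R b) = r *\<^sub>R T b" for r b by (simp add: scaleR_scaleC)
    moreover have "T (x + y) = T x + T y" for x y
      by (rule cinner_ext) (simp add: BT[symmetric] B cinner_add_right)
    moreover have "norm (T b) \<le> norm b * C" for b
    proof (cases "T b = 0")
      case False
      have "norm (T b) * norm (T b) = cmod (B (T b) b)"
        unfolding BT cinner_self by (simp add: norm_power power2_eq_square norm_mult)
      also have "\<dots> \<le> (norm b * C) * norm (T b)" using bound[of "T b" b] by (simp add: mult_ac)
      finally show ?thesis using False by simp
    qed (use C in simp)
    ultimately show "bounded_linear T" by (intro bounded_linear_intro) auto
  qed
  then show ?thesis using BT int unfolding has_op_expectation_def B_def by metis
qed

lemma op_expectation_rpd_in_pd:
  assumes k: "k \<in> rpd M X"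
  shows "(\<lambda>s t. op_expectation M (\<lambda>\<omega>. k \<omega> s t)) \<in> pd X"
proof -
  have E: "has_op_expectation M (\<lambda>\<omega>. k \<omega> s t) (op_expectation M (\<lambda>\<omega>. k \<omega> s t))"
    if "s \<in> X" "t \<in> X" for s t
  proof -
    have "\<exists>T. has_op_expectation M (\<lambda>\<omega>. k \<omega> s t) T"
      using k that by (intro weak_expectation_exists) (auto simp: rpd_def)
    then show ?thesis using op_expectation_eqI by metis
  qed
  show ?thesis
    unfolding pd_def mem_Collect_eq
  proof (intro conjI ballI allI impI)
    show "bounded_clinear (op_expectation M (\<lambda>\<omega>. k \<omega> s t))" if "s \<in> X" "t \<in> X" for s t
      using E[OF that] by (simp add: has_op_expectation_def)
    fix N :: nat and a s assume s: "\<forall>i<N. s i \<in> X"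
    have "(\<Sum>i<N. \<Sum>j<N. cinner (a i) (op_expectation M (\<lambda>\<omega>. k \<omega> (s i) (s j)) (a j)))
        = (\<Sum>i<N. \<Sum>j<N. \<integral>\<omega>. cinner (a i) (k \<omega> (s i) (s j) (a j)) \<partial>M)"
      using E s by (intro sum.cong refl) (auto simp: has_op_expectation_def)
    also have "\<dots> = (\<integral>\<omega>. (\<Sum>i<N. \<Sum>j<N. cinner (a i) (k \<omega> (s i) (s j) (a j))) \<partial>M)"
      using E s unfolding has_op_expectation_def
      by (subst Bochner_Integration.integral_sum)
         (auto intro!: Bochner_Integration.integrable_sum sum.cong Bochner_Integration.integral_sum[symmetric])
    finally show "0 \<le> (\<Sum>i<N. \<Sum>j<N. cinner (a i) (op_expectation M (\<lambda>\<omega>. k \<omega> (s i) (s j)) (a j)))"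
      using k s unfolding rpd_def by auto
  qed
qed

section \<open>Strongly measurable maps\<close>

lemma strongly_measurable_continuous:
  fixes g :: "'h::complex_hilbert \<Rightarrow> 'b::metric_space"
  assumes "strongly_measurable M f" "continuous_on UNIV g"
  shows "(\<lambda>\<omega>. g (f \<omega>)) \<in> borel_measurable M"
proof -
  obtain F where F: "\<And>n::nat. simple_function M (F n)" "\<And>\<omega>. \<omega> \<in> space M \<Longrightarrow> (\<lambda>n. F n \<omega>) \<longlonglongrightarrow> f \<omega>"
    using assms(1) unfolding strongly_measurable_def by blast
  show ?thesis
  proof (rule borel_measurable_LIMSEQ_metric)
    show "(\<lambda>\<omega>. g (F n \<omega>)) \<in> borel_measurable M" for n
      by (rule borel_measurable_simple_function[OF simple_function_compose1[OF F(1)]])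
    show "(\<lambda>n. g (F n \<omega>)) \<longlonglongrightarrow> g (f \<omega>)" if "\<omega> \<in> space M" for \<omega>
      using continuous_on_tendsto_compose[OF assms(2) F(2)[OF that]] by simp
  qed
qed

text \<open>The values of approximating simple functions form a countable set \<open>d\<close> whose closure
  contains the range of the limit \<open>f\<close>.  Picking among \<open>d\<^sub>0, \<dots>, d\<^sub>n\<close> the first point closest to \<open>f \<omega>\<close>
  yields simple functions, because the distances \<open>dist (f \<omega>) (d\<^sub>i)\<close> are measurable.\<close>

lemma strongly_measurable_LIMSEQ:
  fixes f :: "'w \<Rightarrow> 'h::complex_hilbert"
  assumes sm: "\<And>n::nat. strongly_measurable M (g n)"
    and lim: "\<And>\<omega>. \<omega> \<in> space M \<Longrightarrow> (\<lambda>n. g n \<omega>) \<longlonglongrightarrow> f \<omega>"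
  shows "strongly_measurable M f"
proof (cases "space M = {}")
  case True
  then show ?thesis unfolding strongly_measurable_def by (intro exI[of _ "\<lambda>_ _. 0"]) auto
next
  case False
  obtain F where F: "\<And>n m::nat. simple_function M (F n m)"
    "\<And>n \<omega>. \<omega> \<in> space M \<Longrightarrow> (\<lambda>m. F n m \<omega>) \<longlonglongrightarrow> g n \<omega>"
    using sm unfolding strongly_measurable_def by metis
  define D where "D = (\<Union>n m. F n m ` space M)"
  have "countable D" unfolding D_def
    by (intro countable_UN[OF countableI_type] countable_finite simple_functionD(1)[OF F(1)])
  moreover have "D \<noteq> {}" using False by (auto simp: D_def)
  ultimately obtain d :: "nat \<Rightarrow> 'h" where d: "range d = D" by (metis range_from_nat_into)
  have [measurable]: "(\<lambda>\<omega>. dist (f \<omega>) x) \<in> borel_measurable M" for x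
  proof (rule borel_measurable_LIMSEQ_metric)
    show "(\<lambda>\<omega>. dist (g n \<omega>) x) \<in> borel_measurable M" for n
      by (rule strongly_measurable_continuous[OF sm]) (intro continuous_intros)
    show "(\<lambda>n. dist (g n \<omega>) x) \<longlonglongrightarrow> dist (f \<omega>) x" if "\<omega> \<in> space M" for \<omega>
      by (intro tendsto_intros lim that)
  qed
  define P where "P N \<omega> i \<longleftrightarrow> i \<le> N \<and> (\<forall>j\<in>{..N}. dist (f \<omega>) (d i) \<le> dist (f \<omega>) (d j))" for N \<omega> i
  define idx where "idx N \<omega> = (LEAST i. P N \<omega> i)" for N \<omega>
  have P: "P N \<omega> (idx N \<omega>)" for N \<omega>
  proof -
    have "Min ((\<lambda>j. dist (f \<omega>) (d j)) ` {..N}) \<in> (\<lambda>j. dist (f \<omega>) (d j)) ` {..N}"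
      by (intro Min_in) auto
    then obtain i where "i \<in> {..N}" "Min ((\<lambda>j. dist (f \<omega>) (d j)) ` {..N}) = dist (f \<omega>) (d i)" by (rule imageE)
    moreover have "\<forall>j\<in>{..N}. Min ((\<lambda>j. dist (f \<omega>) (d j)) ` {..N}) \<le> dist (f \<omega>) (d j)" by simp
    ultimately have "P N \<omega> i" unfolding P_def by auto
    then show ?thesis unfolding idx_def by (rule LeastI)
  qed
  have "simple_function M (idx N)" for N
  proof -
    have [measurable]: "(\<lambda>\<omega>. P N \<omega> i) \<in> measurable M (count_space UNIV)" for i
      unfolding P_def by measurable
    have meas: "idx N \<in> measurable M (count_space UNIV)" unfolding idx_def by measurable
    have "idx N ` space M \<subseteq> {..N}" using P unfolding P_def by auto
    then have "finite (idx N ` space M)" by (rule finite_subset) simp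
    then show ?thesis unfolding simple_function_def using measurable_sets[OF meas] by simp
  qed
  then have simp: "simple_function M (\<lambda>\<omega>. d (idx N \<omega>))" for N by (rule simple_function_compose1)
  have "(\<lambda>N. d (idx N \<omega>)) \<longlonglongrightarrow> f \<omega>" if \<omega>: "\<omega> \<in> space M" for \<omega>
  proof (rule metric_LIMSEQ_I)
    fix e :: real assume e: "0 < e"
    obtain n where n: "dist (g n \<omega>) (f \<omega>) < e / 2"
      using metric_LIMSEQ_D[OF lim[OF \<omega>], of "e / 2"] e by auto
    obtain m where m: "dist (F n m \<omega>) (g n \<omega>) < e / 2"
      using metric_LIMSEQ_D[OF F(2)[OF \<omega>], of "e / 2" n] e by auto
    have "F n m \<omega> \<in> D" unfolding D_def using \<omega> by blast
    then obtain j where j: "d j = F n m \<omega>" using d by (metis imageE)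
    have dj: "dist (f \<omega>) (d j) < e"
      using n m dist_triangle[of "f \<omega>" "d j" "g n \<omega>"] unfolding j by (simp add: dist_commute)
    show "\<exists>N0. \<forall>N\<ge>N0. dist (d (idx N \<omega>)) (f \<omega>) < e"
    proof (intro exI[of _ j] allI impI)
      fix N assume "j \<le> N"
      then have "dist (f \<omega>) (d (idx N \<omega>)) \<le> dist (f \<omega>) (d j)" using P[of N \<omega>] unfolding P_def by simp
      then show "dist (d (idx N \<omega>)) (f \<omega>) < e" using dj by (simp add: dist_commute)
    qed
  qed
  with simp show ?thesis unfolding strongly_measurable_def
    by (intro exI[of _ "\<lambda>N \<omega>. d (idx N \<omega>)"]) auto
qed

lemma strongly_measurable_const: "strongly_measurable M (\<lambda>_. c)"
  unfolding strongly_measurable_def by (intro exI[of _ "\<lambda>_ _. c"]) auto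

lemma strongly_measurable_add:
  assumes "strongly_measurable M f" "strongly_measurable M g"
  shows "strongly_measurable M (\<lambda>\<omega>. f \<omega> + g \<omega>)"
proof -
  obtain F G where "\<And>n::nat. simple_function M (F n)" "\<And>\<omega>. \<omega> \<in> space M \<Longrightarrow> (\<lambda>n. F n \<omega>) \<longlonglongrightarrow> f \<omega>"
    "\<And>n::nat. simple_function M (G n)" "\<And>\<omega>. \<omega> \<in> space M \<Longrightarrow> (\<lambda>n. G n \<omega>) \<longlonglongrightarrow> g \<omega>"
    using assms unfolding strongly_measurable_def by metis
  then show ?thesis unfolding strongly_measurable_def
    by (intro exI[of _ "\<lambda>n \<omega>. F n \<omega> + G n \<omega>"] conjI allI ballI tendsto_add
        simple_function_compose2[where h = "(+)"])
qed

lemma strongly_measurable_scaleC: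
  fixes c :: "'w \<Rightarrow> complex"
  assumes "c \<in> borel_measurable M" "strongly_measurable M f"
  shows "strongly_measurable M (\<lambda>\<omega>. c \<omega> *\<^sub>C f \<omega>)"
proof -
  obtain C where "\<And>n. simple_function M (C n)" "\<And>\<omega>. \<omega> \<in> space M \<Longrightarrow> (\<lambda>n. C n \<omega>) \<longlonglongrightarrow> c \<omega>"
    using borel_measurable_implies_sequence_metric[OF assms(1), of 0] by auto
  moreover obtain F where "\<And>n::nat. simple_function M (F n)" "\<And>\<omega>. \<omega> \<in> space M \<Longrightarrow> (\<lambda>n. F n \<omega>) \<longlonglongrightarrow> f \<omega>"
    using assms(2) unfolding strongly_measurable_def by metis
  ultimately show ?thesis unfolding strongly_measurable_def
    by (intro exI[of _ "\<lambda>n \<omega>. C n \<omega> *\<^sub>C F n \<omega>"] conjI allI ballI tendsto_scaleC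
        simple_function_compose2[where h = scaleC])
qed

lemma strongly_measurable_sum:
  assumes "\<And>i. i \<in> A \<Longrightarrow> strongly_measurable M (f i)"
  shows "strongly_measurable M (\<lambda>\<omega>. \<Sum>i\<in>A. f i \<omega>)"
  using assms by (induction A rule: infinite_finite_induct)
    (auto intro: strongly_measurable_const strongly_measurable_add)

lemma strongly_measurable_norm:
  "strongly_measurable M f \<Longrightarrow> (\<lambda>\<omega>. norm (f \<omega>)) \<in> borel_measurable M"
  by (rule strongly_measurable_continuous) (auto intro: continuous_intros)

lemma strongly_measurable_cinner:
  assumes "strongly_measurable M f"
  shows "(\<lambda>\<omega>. cinner a (f \<omega>)) \<in> borel_measurable M" "(\<lambda>\<omega>. cinner (f \<omega>) a) \<in> borel_measurable M"
  by (rule strongly_measurable_continuous[OF assms],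
      rule linear_continuous_on bounded_linear_cinner_right bounded_linear_cinner_left,
      rule linear_continuous_on bounded_linear_cinner_right bounded_linear_cinner_left)+

lemma strongly_measurable_diff:
  assumes "strongly_measurable M f" "strongly_measurable M g"
  shows "strongly_measurable M (\<lambda>\<omega>. f \<omega> - g \<omega>)"
proof -
  have "strongly_measurable M (\<lambda>\<omega>. f \<omega> + (-1) *\<^sub>C g \<omega>)"
    by (intro strongly_measurable_add strongly_measurable_scaleC assms) auto
  moreover have "(-1) *\<^sub>C x = - x" for x :: 'b using scaleR_scaleC[of "-1" x] by simp
  ultimately show ?thesis by simp
qed

section \<open>Gaussian white noise\<close>

lemma mult_le_weighted_squares:
  fixes x y t :: real
  assumes "t > 0" "x \<ge> 0" "y \<ge> 0"
  shows "x * y \<le> t * x\<^sup>2 + y\<^sup>2 / t"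
proof -
  have "0 \<le> (t * x - y)\<^sup>2 / t" using assms by simp
  also have "\<dots> = t * x\<^sup>2 + y\<^sup>2 / t - 2 * (x * y)"
    using assms by (simp add: power2_eq_square field_simps)
  finally show ?thesis using mult_nonneg_nonneg[OF assms(2,3)] by linarith
qed

lemma integrable_mult_L2:
  fixes f g :: "'w \<Rightarrow> 'b::{real_normed_field, banach, second_countable_topology}"
  assumes [measurable]: "f \<in> borel_measurable M" "g \<in> borel_measurable M"
    and "integrable M (\<lambda>\<omega>. (norm (f \<omega>))\<^sup>2)" "integrable M (\<lambda>\<omega>. (norm (g \<omega>))\<^sup>2)"
  shows "integrable M (\<lambda>\<omega>. f \<omega> * g \<omega>)"
proof (rule Bochner_Integration.integrable_bound)
  show "integrable M (\<lambda>\<omega>. (norm (f \<omega>))\<^sup>2 + (norm (g \<omega>))\<^sup>2)" using assms(3,4) by (rule Bochner_Integration.integrable_add)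
  have "norm (f \<omega> * g \<omega>) \<le> norm ((norm (f \<omega>))\<^sup>2 + (norm (g \<omega>))\<^sup>2)" for \<omega>
    using mult_le_weighted_squares[of 1 "norm (f \<omega>)" "norm (g \<omega>)"] by (simp add: norm_mult)
  then show "AE \<omega> in M. norm (f \<omega> * g \<omega>) \<le> norm ((norm (f \<omega>))\<^sup>2 + (norm (g \<omega>))\<^sup>2)" by simp
qed measurable

lemma integrable_norm_diff_square:
  fixes f g :: "'w \<Rightarrow> 'b::{real_normed_field, banach, second_countable_topology}"
  assumes [measurable]: "f \<in> borel_measurable M" "g \<in> borel_measurable M"
    and "integrable M (\<lambda>\<omega>. (norm (f \<omega>))\<^sup>2)" "integrable M (\<lambda>\<omega>. (norm (g \<omega>))\<^sup>2)"
  shows "integrable M (\<lambda>\<omega>. (norm (f \<omega> - g \<omega>))\<^sup>2)"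
proof (rule Bochner_Integration.integrable_bound)
  show "integrable M (\<lambda>\<omega>. 2 * (norm (f \<omega>))\<^sup>2 + 2 * (norm (g \<omega>))\<^sup>2)" using assms(3,4) by auto
  have "(norm (f \<omega> - g \<omega>))\<^sup>2 \<le> 2 * (norm (f \<omega>))\<^sup>2 + 2 * (norm (g \<omega>))\<^sup>2" for \<omega>
  proof -
    have "(norm (f \<omega> - g \<omega>))\<^sup>2 \<le> (norm (f \<omega>) + norm (g \<omega>))\<^sup>2" by (intro power_mono norm_triangle_ineq4) simp
    also have "\<dots> \<le> 2 * (norm (f \<omega>))\<^sup>2 + 2 * (norm (g \<omega>))\<^sup>2"
      using sum_squares_bound[of "norm (f \<omega>)" "norm (g \<omega>)"] by (simp add: power2_sum)
    finally show ?thesis .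
  qed
  then show "AE \<omega> in M. norm ((norm (f \<omega> - g \<omega>))\<^sup>2) \<le> norm (2 * (norm (f \<omega>))\<^sup>2 + 2 * (norm (g \<omega>))\<^sup>2)" by simp
qed measurable

text \<open>The weighted inequality \<open>x y \<le> t x\<^sup>2 + y\<^sup>2 / t\<close>, with \<open>t\<close> small, bounds the products of a fixed
  function with a small error.\<close>

lemma L2_mult_tendsto:
  fixes f g :: "'w \<Rightarrow> 'b::{real_normed_field, banach, second_countable_topology}"
    and fF gF :: "'k \<Rightarrow> 'w \<Rightarrow> 'b"
  assumes [measurable]: "f \<in> borel_measurable M" "g \<in> borel_measurable M"
      "\<And>F. fF F \<in> borel_measurable M" "\<And>F. gF F \<in> borel_measurable M"
    and int: "integrable M (\<lambda>\<omega>. (norm (f \<omega>))\<^sup>2)" "integrable M (\<lambda>\<omega>. (norm (g \<omega>))\<^sup>2)"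
      "\<And>F. integrable M (\<lambda>\<omega>. (norm (fF F \<omega>))\<^sup>2)" "\<And>F. integrable M (\<lambda>\<omega>. (norm (gF F \<omega>))\<^sup>2)"
    and lim: "((\<lambda>F. \<integral>\<omega>. (norm (f \<omega> - fF F \<omega>))\<^sup>2 \<partial>M) \<longlongrightarrow> 0) L"
      "((\<lambda>F. \<integral>\<omega>. (norm (g \<omega> - gF F \<omega>))\<^sup>2 \<partial>M) \<longlongrightarrow> 0) L"
  shows "((\<lambda>F. \<integral>\<omega>. fF F \<omega> * gF F \<omega> \<partial>M) \<longlongrightarrow> (\<integral>\<omega>. f \<omega> * g \<omega> \<partial>M)) L"
proof -
  define E where "E = (\<integral>\<omega>. (norm (f \<omega>))\<^sup>2 \<partial>M) + (\<integral>\<omega>. (norm (g \<omega>))\<^sup>2 \<partial>M)"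
  define A where "A F = (\<integral>\<omega>. (norm (f \<omega> - fF F \<omega>))\<^sup>2 \<partial>M) + (\<integral>\<omega>. (norm (g \<omega> - gF F \<omega>))\<^sup>2 \<partial>M)" for F
  have E0: "E \<ge> 0" unfolding E_def by simp
  have A: "(A \<longlongrightarrow> 0) L" using tendsto_add[OF lim] unfolding A_def by simp
  have iu: "integrable M (\<lambda>\<omega>. (norm (f \<omega> - fF F \<omega>))\<^sup>2)" for F
    by (rule integrable_norm_diff_square) (use int in measurable)
  have iv: "integrable M (\<lambda>\<omega>. (norm (g \<omega> - gF F \<omega>))\<^sup>2)" for F
    by (rule integrable_norm_diff_square) (use int in measurable)
  have ifg: "integrable M (\<lambda>\<omega>. f \<omega> * g \<omega>)" by (rule integrable_mult_L2) (use int in measurable)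
  have ifgF: "integrable M (\<lambda>\<omega>. fF F \<omega> * gF F \<omega>)" for F by (rule integrable_mult_L2) (use int in measurable)
  have bound: "norm ((\<integral>\<omega>. fF F \<omega> * gF F \<omega> \<partial>M) - (\<integral>\<omega>. f \<omega> * g \<omega> \<partial>M)) \<le> t * E + (1 + 1 / t) * A F"
    if t: "t > 0" for t F
  proof -
    let ?h = "\<lambda>\<omega>. t * ((norm (f \<omega>))\<^sup>2 + (norm (g \<omega>))\<^sup>2)
      + (1 + 1 / t) * ((norm (f \<omega> - fF F \<omega>))\<^sup>2 + (norm (g \<omega> - gF F \<omega>))\<^sup>2)"
    have "norm (fF F \<omega> * gF F \<omega> - f \<omega> * g \<omega>) \<le> ?h \<omega>" for \<omega>
    proof -
      define u where "u = f \<omega> - fF F \<omega>"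
      define v where "v = g \<omega> - gF F \<omega>"
      have "fF F \<omega> * gF F \<omega> - f \<omega> * g \<omega> = u * v - f \<omega> * v - g \<omega> * u"
        by (simp add: u_def v_def algebra_simps)
      then have "norm (fF F \<omega> * gF F \<omega> - f \<omega> * g \<omega>) \<le> norm u * norm v + norm (f \<omega>) * norm v + norm (g \<omega>) * norm u"
        using norm_triangle_ineq4[of "u * v - f \<omega> * v" "g \<omega> * u"] norm_triangle_ineq4[of "u * v" "f \<omega> * v"]
        by (simp add: norm_mult)
      also have "norm u * norm v \<le> (norm u)\<^sup>2 + (norm v)\<^sup>2"
        using mult_le_weighted_squares[of 1 "norm u" "norm v"] by simp
      also have "norm (f \<omega>) * norm v \<le> t * (norm (f \<omega>))\<^sup>2 + (norm v)\<^sup>2 / t"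
        by (rule mult_le_weighted_squares[OF t]) auto
      also have "norm (g \<omega>) * norm u \<le> t * (norm (g \<omega>))\<^sup>2 + (norm u)\<^sup>2 / t"
        by (rule mult_le_weighted_squares[OF t]) auto
      finally show ?thesis unfolding u_def v_def by (simp add: algebra_simps)
    qed
    then have "(\<integral>\<omega>. norm (fF F \<omega> * gF F \<omega> - f \<omega> * g \<omega>) \<partial>M) \<le> (\<integral>\<omega>. ?h \<omega> \<partial>M)"
      using int ifg ifgF iu iv by (intro integral_mono) auto
    also have "(\<integral>\<omega>. ?h \<omega> \<partial>M) = t * E + (1 + 1 / t) * A F"
      unfolding E_def A_def using int iu iv by simp
    finally show ?thesis
      using integral_norm_bound[of M "\<lambda>\<omega>. fF F \<omega> * gF F \<omega> - f \<omega> * g \<omega>"] ifg ifgF by simp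
  qed
  show ?thesis
  proof (rule tendstoI)
    fix e :: real assume e: "e > 0"
    define t where "t = e / (2 * (E + 1))"
    have t: "t > 0" using e E0 by (simp add: t_def)
    have tE: "t * E < e / 2"
    proof -
      have "t * E < t * (E + 1)" using t by simp
      also have "\<dots> = e / 2" using E0 by (simp add: t_def field_simps)
      finally show ?thesis .
    qed
    have "((\<lambda>F. (1 + 1 / t) * A F) \<longlongrightarrow> (1 + 1 / t) * 0) L" by (intro tendsto_intros A)
    then have "\<forall>\<^sub>F F in L. (1 + 1 / t) * A F < e / 2" using e by (intro order_tendstoD(2)) auto
    then show "\<forall>\<^sub>F F in L. dist (\<integral>\<omega>. fF F \<omega> * gF F \<omega> \<partial>M) (\<integral>\<omega>. f \<omega> * g \<omega> \<partial>M) < e"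
    proof (rule eventually_mono)
      fix F assume "(1 + 1 / t) * A F < e / 2"
      with bound[OF t, of F] tE show "dist (\<integral>\<omega>. fF F \<omega> * gF F \<omega> \<partial>M) (\<integral>\<omega>. f \<omega> * g \<omega> \<partial>M) < e"
        unfolding dist_norm by linarith
    qed
  qed
qed

text \<open>The coordinates are real standard normal variables regarded as complex numbers.  Real noise is
  enough, because joint Gaussianity of complex variables refers to their real and imaginary parts.\<close>

definition white_noise :: "('i \<Rightarrow> complex) measure" where
  "white_noise = PiM UNIV (\<lambda>_. distr std_normal_distribution borel complex_of_real)"

definition noise :: "'i \<Rightarrow> ('i \<Rightarrow> complex) \<Rightarrow> real" where
  "noise m \<omega> = Re (\<omega> m)"

lemma prob_space_coordinate: "prob_space (distr std_normal_distribution borel complex_of_real)"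
proof -
  interpret real_distribution std_normal_distribution by (rule real_dist_normal_dist)
  show ?thesis by (rule prob_space_distr) measurable
qed

interpretation white_noise: prob_space "white_noise :: ('i \<Rightarrow> complex) measure"
  unfolding white_noise_def by (rule prob_space_PiM[OF prob_space_coordinate])

lemma coordinate_measurable: "(\<lambda>\<omega>. \<omega> m) \<in> measurable white_noise borel"
proof -
  have "(\<lambda>\<omega>. \<omega> m) \<in> measurable white_noise (distr std_normal_distribution borel complex_of_real)"
    unfolding white_noise_def by (rule measurable_component_singleton) simp
  then show ?thesis by (simp add: measurable_def)
qed

lemma noise_measurable [measurable]: "noise m \<in> borel_measurable white_noise"
  unfolding noise_def using coordinate_measurable by measurable

lemma distr_coordinate: "distr white_noise borel (\<lambda>\<omega>. \<omega> m) = distr std_normal_distribution borel complex_of_real"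
proof -
  have "distr white_noise (distr std_normal_distribution borel complex_of_real) (\<lambda>\<omega>. \<omega> m)
      = distr std_normal_distribution borel complex_of_real"
    unfolding white_noise_def by (rule distr_PiM_component[OF prob_space_coordinate]) simp
  moreover have "distr white_noise (distr std_normal_distribution borel complex_of_real) (\<lambda>\<omega>. \<omega> m)
      = distr white_noise borel (\<lambda>\<omega>. \<omega> m)" by (rule distr_cong) simp_all
  ultimately show ?thesis by simp
qed

lemma distr_noise: "distr white_noise borel (noise m) = std_normal_distribution"
proof -
  have "distr white_noise borel (noise m) = distr (distr white_noise borel (\<lambda>\<omega>. \<omega> m)) borel Re"
    by (subst distr_distr) (simp_all add: coordinate_measurable comp_def noise_def[abs_def])
  also have "\<dots> = distr std_normal_distribution borel (\<lambda>x. x)"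
    unfolding distr_coordinate by (subst distr_distr) (simp_all add: comp_def)
  also have "\<dots> = std_normal_distribution" by (rule distr_id2) simp
  finally show ?thesis .
qed

lemma indep_noise: "white_noise.indep_vars (\<lambda>_. borel) noise (UNIV :: 'i set)"
proof -
  have "white_noise.indep_vars (\<lambda>_. borel) (\<lambda>(m::'i) \<omega>. \<omega> m) UNIV"
  proof (subst white_noise.indep_vars_iff_distr_eq_PiM)
    show "(\<lambda>\<omega>. \<omega> i) \<in> measurable white_noise borel" for i :: 'i by (rule coordinate_measurable)
    have "distr white_noise (PiM UNIV (\<lambda>_. borel)) (\<lambda>\<omega>. \<lambda>i\<in>UNIV. \<omega> (i::'i)) = distr white_noise white_noise (\<lambda>\<omega>. \<omega>)"
    proof (rule distr_cong)
      show "sets (PiM UNIV (\<lambda>_::'i. borel)) = sets white_noise"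
        unfolding white_noise_def by (rule sets_PiM_cong) simp_all
    qed (simp_all add: restrict_UNIV)
    also have "\<dots> = white_noise" by (rule distr_id)
    finally show "distr white_noise (PiM UNIV (\<lambda>_. borel)) (\<lambda>\<omega>. \<lambda>i\<in>UNIV. \<omega> (i::'i))
        = PiM UNIV (\<lambda>i::'i. distr white_noise borel (\<lambda>\<omega>. \<omega> i))"
      unfolding distr_coordinate by (simp add: white_noise_def)
  qed simp
  then show ?thesis unfolding noise_def
    by (rule white_noise.indep_vars_compose2) simp
qed

lemma noise_moment: "integrable white_noise (\<lambda>\<omega>. noise m \<omega> ^ k)"
    "(\<integral>\<omega>. noise m \<omega> ^ k \<partial>white_noise) = (\<integral>x. x ^ k \<partial>std_normal_distribution)"
proof -
  have "integrable (distr white_noise borel (noise m)) (\<lambda>x. x ^ k)"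
    unfolding distr_noise by (rule integrable_std_normal_distribution_moment)
  then show "integrable white_noise (\<lambda>\<omega>. noise m \<omega> ^ k)" by (subst (asm) integrable_distr_eq) auto
  have "(\<integral>x. x ^ k \<partial>distr white_noise borel (noise m)) = (\<integral>\<omega>. noise m \<omega> ^ k \<partial>white_noise)"
    by (subst integral_distr) auto
  then show "(\<integral>\<omega>. noise m \<omega> ^ k \<partial>white_noise) = (\<integral>x. x ^ k \<partial>std_normal_distribution)"
    unfolding distr_noise by simp
qed

lemma noise_orthonormal:
  "integrable white_noise (\<lambda>\<omega>. noise m \<omega> * noise l \<omega>)"
  "(\<integral>\<omega>. noise m \<omega> * noise l \<omega> \<partial>white_noise) = (if m = l then 1 else 0)"
proof -
  show "integrable white_noise (\<lambda>\<omega>. noise m \<omega> * noise l \<omega>)"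
    using noise_moment(1)[of _ 2] by (intro integrable_mult_L2) auto
  show "(\<integral>\<omega>. noise m \<omega> * noise l \<omega> \<partial>white_noise) = (if m = l then 1 else 0)"
  proof (cases "m = l")
    case True
    then show ?thesis using noise_moment(2)[of m 2] std_normal_distribution_even_moments(1)[of 1]
      by (simp add: power2_eq_square)
  next
    case False
    have "(\<integral>\<omega>. (\<Prod>i\<in>{m, l}. noise i \<omega>) \<partial>white_noise) = (\<Prod>i\<in>{m, l}. \<integral>\<omega>. noise i \<omega> \<partial>white_noise)"
      using noise_moment(1)[of _ 1]
      by (intro white_noise.indep_vars_lebesgue_integral white_noise.indep_vars_subset[OF indep_noise]) auto
    moreover have "(\<integral>\<omega>. noise i \<omega> \<partial>white_noise) = 0" for i :: 'a
      using noise_moment(2)[of i 1] integral_std_normal_distribution_moment_odd[of 1] by simp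
    ultimately show ?thesis using False by simp
  qed
qed

definition noise_sum :: "('i \<Rightarrow> 'h::complex_hilbert) \<Rightarrow> 'i set \<Rightarrow> ('i \<Rightarrow> complex) \<Rightarrow> 'h" where
  "noise_sum v F \<omega> = (\<Sum>m\<in>F. noise m \<omega> *\<^sub>R v m)"

lemma strongly_measurable_noise_sum: "strongly_measurable white_noise (noise_sum v F)"
  unfolding noise_sum_def scaleR_scaleC
  by (intro strongly_measurable_sum strongly_measurable_scaleC strongly_measurable_const) measurable

lemma integral_noise_quadratic:
  fixes c :: "'i \<Rightarrow> 'i \<Rightarrow> complex"
  assumes "finite F"
  shows "integrable white_noise (\<lambda>\<omega>. \<Sum>m\<in>F. \<Sum>l\<in>F. complex_of_real (noise m \<omega> * noise l \<omega>) * c m l)"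
    and "(\<integral>\<omega>. (\<Sum>m\<in>F. \<Sum>l\<in>F. complex_of_real (noise m \<omega> * noise l \<omega>) * c m l) \<partial>white_noise) = (\<Sum>m\<in>F. c m m)"
proof -
  have i: "integrable white_noise (\<lambda>\<omega>. complex_of_real (noise m \<omega> * noise l \<omega>) * c m l)" for m l
    by (intro integrable_mult_left integrable_of_real noise_orthonormal)
  then show "integrable white_noise (\<lambda>\<omega>. \<Sum>m\<in>F. \<Sum>l\<in>F. complex_of_real (noise m \<omega> * noise l \<omega>) * c m l)"
    by (intro Bochner_Integration.integrable_sum)
  have "(\<integral>\<omega>. complex_of_real (noise m \<omega> * noise l \<omega>) * c m l \<partial>white_noise) = (if l = m then c m m else 0)" for m l
    using noise_orthonormal(2)[of m l]
    by (simp only: integral_mult_left_zero integral_complex_of_real) auto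
  then show "(\<integral>\<omega>. (\<Sum>m\<in>F. \<Sum>l\<in>F. complex_of_real (noise m \<omega> * noise l \<omega>) * c m l) \<partial>white_noise) = (\<Sum>m\<in>F. c m m)"
    using assms i by (simp add: Bochner_Integration.integral_sum Bochner_Integration.integrable_sum)
qed

lemma noise_sum_covariance:
  fixes v w :: "'i \<Rightarrow> 'h::complex_hilbert"
  assumes "finite F"
  shows "(\<integral>\<omega>. cinner a (noise_sum v F \<omega>) * cinner (noise_sum w F \<omega>) b \<partial>white_noise)
    = (\<Sum>m\<in>F. cinner a (v m) * cinner (w m) b)"
proof -
  have "cinner a (noise_sum v F \<omega>) * cinner (noise_sum w F \<omega>) b
      = (\<Sum>m\<in>F. \<Sum>l\<in>F. complex_of_real (noise m \<omega> * noise l \<omega>) * (cinner a (v m) * cinner (w l) b))" for \<omega>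
    unfolding noise_sum_def cinner_sum_left cinner_sum_right cinner_scaleR_left cinner_scaleR_right sum_product
    by (intro sum.cong refl) (simp add: mult_ac)
  then show ?thesis using integral_noise_quadratic(2)[OF assms] by simp
qed

lemma noise_sum_norm_square:
  fixes v :: "'i \<Rightarrow> 'h::complex_hilbert"
  assumes "finite F"
  shows "integrable white_noise (\<lambda>\<omega>. (norm (noise_sum v F \<omega>))\<^sup>2)"
    and "(\<integral>\<omega>. (norm (noise_sum v F \<omega>))\<^sup>2 \<partial>white_noise) = (\<Sum>m\<in>F. (norm (v m))\<^sup>2)"
proof -
  let ?Q = "\<lambda>\<omega>. \<Sum>m\<in>F. \<Sum>l\<in>F. complex_of_real (noise m \<omega> * noise l \<omega>) * cinner (v m) (v l)"
  have "complex_of_real ((norm (noise_sum v F \<omega>))\<^sup>2) = ?Q \<omega>" for \<omega>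
    unfolding cinner_self[symmetric] noise_sum_def cinner_sum_left
    unfolding cinner_sum_right cinner_scaleR_left cinner_scaleR_right by (simp add: mult_ac)
  then have eq: "(norm (noise_sum v F \<omega>))\<^sup>2 = Re (?Q \<omega>)" for \<omega> by (metis Re_complex_of_real)
  show "integrable white_noise (\<lambda>\<omega>. (norm (noise_sum v F \<omega>))\<^sup>2)"
    unfolding eq by (intro integrable_Re integral_noise_quadratic assms)
  show "(\<integral>\<omega>. (norm (noise_sum v F \<omega>))\<^sup>2 \<partial>white_noise) = (\<Sum>m\<in>F. (norm (v m))\<^sup>2)"
    unfolding eq integral_Re[OF integral_noise_quadratic(1)[OF assms]] integral_noise_quadratic(2)[OF assms]
    by (simp add: cinner_self del: of_real_power)
qed

section \<open>Gaussian series\<close>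

lemma noise_sum_dist_square:
  fixes v :: "'i \<Rightarrow> 'h::complex_hilbert"
  assumes "finite F" "finite G"
  shows "integrable white_noise (\<lambda>\<omega>. (norm (noise_sum v F \<omega> - noise_sum v G \<omega>))\<^sup>2)"
    and "(\<integral>\<omega>. (norm (noise_sum v F \<omega> - noise_sum v G \<omega>))\<^sup>2 \<partial>white_noise)
      = (\<Sum>m\<in>F - G. (norm (v m))\<^sup>2) + (\<Sum>m\<in>G - F. (norm (v m))\<^sup>2)"
proof -
  \<comment> \<open>The common terms cancel, and the others form a sum over the symmetric difference.\<close>
  let ?w = "\<lambda>m. (if m \<in> F then v m else - v m)"
  have split: "sum h F = sum h (F - G) + sum h (F \<inter> G)" "sum h G = sum h (G - F) + sum h (F \<inter> G)" for h :: "'i \<Rightarrow> 'h"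
    using assms by (metis sum.Int_Diff add.commute, metis sum.Int_Diff add.commute Int_commute)
  have un: "sum h ((F - G) \<union> (G - F)) = sum h (F - G) + sum h (G - F)" for h :: "'i \<Rightarrow> 'c::comm_monoid_add"
    using assms by (intro sum.union_disjoint) auto
  have eq: "noise_sum v F \<omega> - noise_sum v G \<omega> = noise_sum ?w ((F - G) \<union> (G - F)) \<omega>" for \<omega>
    unfolding noise_sum_def split un by (simp add: sum_negf)
  have fin: "finite ((F - G) \<union> (G - F))" using assms by simp
  show "integrable white_noise (\<lambda>\<omega>. (norm (noise_sum v F \<omega> - noise_sum v G \<omega>))\<^sup>2)"
    unfolding eq by (rule noise_sum_norm_square(1)[OF fin])
  show "(\<integral>\<omega>. (norm (noise_sum v F \<omega> - noise_sum v G \<omega>))\<^sup>2 \<partial>white_noise)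
      = (\<Sum>m\<in>F - G. (norm (v m))\<^sup>2) + (\<Sum>m\<in>G - F. (norm (v m))\<^sup>2)"
    unfolding eq noise_sum_norm_square(2)[OF fin] un by simp
qed

definition noise_series :: "('i \<Rightarrow> 'h::complex_hilbert) \<Rightarrow> (('i \<Rightarrow> complex) \<Rightarrow> 'h) \<Rightarrow> bool" where
  "noise_series v W \<longleftrightarrow> in_L2 white_noise W \<and>
    (\<forall>F. finite F \<longrightarrow> integrable white_noise (\<lambda>\<omega>. (norm (W \<omega> - noise_sum v F \<omega>))\<^sup>2)) \<and>
    ((\<lambda>F. \<integral>\<omega>. (norm (W \<omega> - noise_sum v F \<omega>))\<^sup>2 \<partial>white_noise) \<longlongrightarrow> 0) (finite_subsets_at_top UNIV)"

text \<open>Along finite sets \<open>F\<^sub>n\<close> that capture the square sum up to \<open>16\<^sup>-\<^sup>n\<close>, consecutive partial sums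
  differ by at most \<open>2 \<cdot> 4\<^sup>-\<^sup>n\<close> in mean, so they converge almost surely.  Fatou's lemma bounds the
  distance in \<open>L\<^sup>2\<close> between the limit and an arbitrary finite partial sum by the corresponding tail.\<close>

lemma noise_series_exists:
  fixes v :: "'i \<Rightarrow> 'h::complex_hilbert"
  assumes v: "(\<lambda>m. (norm (v m))\<^sup>2) summable_on UNIV"
  shows "\<exists>W. noise_series v W"
proof -
  define f where "f m = (norm (v m))\<^sup>2" for m
  define s where "s = infsum f UNIV"
  have hs: "(f has_sum s) UNIV" unfolding s_def f_def by (rule has_sum_infsum[OF v])
  have f0: "0 \<le> f m" for m by (simp add: f_def)
  have le_s: "sum f F \<le> s" if "finite F" for F by (rule finite_sum_le_has_sum[OF hs]) (use that f0 in auto)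
  have outside: "sum f (F - G) \<le> s - sum f G" if "finite F" "finite G" for F G
  proof -
    have "sum f (F - G) + sum f G = sum f (F \<union> G)" using that by (metis sum.union_diff2 sum.subset_diff Un_Diff_cancel2 finite_UnI Un_upper2 Diff_cancel Un_Diff sup_bot_right)
    then show ?thesis using le_s[of "F \<union> G"] that by simp
  qed
  obtain F where F: "\<And>n. finite (F n)" "\<And>n. F n \<subseteq> F (Suc n)" "\<And>n. s - (1/16)^n < sum f (F n)"
    using exhausting_finite_sets[OF hs f0, of "\<lambda>n. (1/16)^n"] by auto
  define X where "X n = noise_sum v (F n)" for n
  have smX: "strongly_measurable white_noise (X n)" for n unfolding X_def by (rule strongly_measurable_noise_sum)
  have dX: "integrable white_noise (\<lambda>\<omega>. (norm (X n \<omega> - noise_sum v G \<omega>))\<^sup>2)"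
      "(\<integral>\<omega>. (norm (X n \<omega> - noise_sum v G \<omega>))\<^sup>2 \<partial>white_noise) \<le> (1/16)^n + (s - sum f G)" if "finite G" for n G
  proof -
    show "integrable white_noise (\<lambda>\<omega>. (norm (X n \<omega> - noise_sum v G \<omega>))\<^sup>2)"
      unfolding X_def by (rule noise_sum_dist_square(1)[OF F(1) that])
    show "(\<integral>\<omega>. (norm (X n \<omega> - noise_sum v G \<omega>))\<^sup>2 \<partial>white_noise) \<le> (1/16)^n + (s - sum f G)"
      unfolding X_def noise_sum_dist_square(2)[OF F(1) that] f_def[symmetric]
      using outside[OF F(1)[of n] that] outside[OF that F(1)[of n]] F(3)[of n] by linarith
  qed
  define Y where "Y n \<omega> = norm (X (Suc n) \<omega> - X n \<omega>)" for n \<omega>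
  have [measurable]: "Y n \<in> borel_measurable white_noise" for n
    unfolding Y_def by (intro strongly_measurable_norm strongly_measurable_diff smX)
  have Y2: "integrable white_noise (\<lambda>\<omega>. (Y n \<omega>)\<^sup>2)" "(\<integral>\<omega>. (Y n \<omega>)\<^sup>2 \<partial>white_noise) \<le> (1/16)^n" for n
  proof -
    show "integrable white_noise (\<lambda>\<omega>. (Y n \<omega>)\<^sup>2)"
      unfolding Y_def X_def by (rule noise_sum_dist_square(1)[OF F(1) F(1)])
    have e: "F n - F (Suc n) = {}" using F(2) by blast
    then show "(\<integral>\<omega>. (Y n \<omega>)\<^sup>2 \<partial>white_noise) \<le> (1/16)^n"
      unfolding Y_def X_def noise_sum_dist_square(2)[OF F(1) F(1)] f_def[symmetric] e sum.empty
      using outside[OF F(1) F(1), of "Suc n" n] F(3)[of n] by linarith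
  qed
  have Y1: "(\<integral>\<^sup>+\<omega>. ennreal (Y n \<omega>) \<partial>white_noise) \<le> ennreal (2 * (1/4)^n)" for n
  proof -
    \<comment> \<open>The weight \<open>\<delta>\<close> balances both terms of \<open>Y \<le> \<delta> + Y\<^sup>2 / \<delta>\<close>, as \<open>E Y\<^sup>2 \<le> \<delta>\<^sup>2\<close>.\<close>
    define \<delta> where "\<delta> = (1/4::real)^n"
    have \<delta>: "\<delta> > 0" "(1/16)^n = \<delta> * \<delta>" by (simp_all add: \<delta>_def flip: power_mult_distrib)
    have "Y n \<omega> \<le> \<delta> + (Y n \<omega>)\<^sup>2 / \<delta>" for \<omega>
      using mult_le_weighted_squares[OF \<delta>(1), of 1 "Y n \<omega>"] by (simp add: Y_def)
    then have "(\<integral>\<^sup>+\<omega>. ennreal (Y n \<omega>) \<partial>white_noise) \<le> (\<integral>\<^sup>+\<omega>. ennreal (\<delta> + (Y n \<omega>)\<^sup>2 / \<delta>) \<partial>white_noise)"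
      by (intro nn_integral_mono ennreal_leI)
    also have "\<dots> = ennreal (\<integral>\<omega>. \<delta> + (Y n \<omega>)\<^sup>2 / \<delta> \<partial>white_noise)"
      using \<delta>(1) Y2(1)[of n] by (intro nn_integral_eq_integral) auto
    also have "(\<integral>\<omega>. \<delta> + (Y n \<omega>)\<^sup>2 / \<delta> \<partial>white_noise) = \<delta> + (\<integral>\<omega>. (Y n \<omega>)\<^sup>2 \<partial>white_noise) / \<delta>"
      using Y2(1)[of n] by (subst Bochner_Integration.integral_add) (auto simp: white_noise.prob_space)
    also have "ennreal \<dots> \<le> ennreal (2 * \<delta>)"
    proof (rule ennreal_leI)
      have "(\<integral>\<omega>. (Y n \<omega>)\<^sup>2 \<partial>white_noise) \<le> \<delta> * \<delta>" using Y2(2)[of n] \<delta>(2) by simp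
      then have "(\<integral>\<omega>. (Y n \<omega>)\<^sup>2 \<partial>white_noise) / \<delta> \<le> \<delta>" using \<delta>(1) by (simp add: pos_divide_le_eq)
      then show "\<delta> + (\<integral>\<omega>. (Y n \<omega>)\<^sup>2 \<partial>white_noise) / \<delta> \<le> 2 * \<delta>" by simp
    qed
    finally show ?thesis by (simp add: \<delta>_def)
  qed
  have "(\<integral>\<^sup>+\<omega>. (\<Sum>n. ennreal (Y n \<omega>)) \<partial>white_noise) = (\<Sum>n. \<integral>\<^sup>+\<omega>. ennreal (Y n \<omega>) \<partial>white_noise)"
    by (rule nn_integral_suminf) measurable
  also have "\<dots> \<le> (\<Sum>n. ennreal (2 * (1/4)^n))" by (intro suminf_le Y1) auto
  also have "\<dots> = ennreal (\<Sum>n. 2 * (1/4)^n)"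
    by (intro suminf_ennreal2 summable_mult summable_geometric) auto
  finally have "(\<integral>\<^sup>+\<omega>. (\<Sum>n. ennreal (Y n \<omega>)) \<partial>white_noise) \<noteq> \<infinity>"
    by (metis ennreal_less_top infinity_ennreal_def leD top.extremum_strict)
  then have "AE \<omega> in white_noise. (\<Sum>n. ennreal (Y n \<omega>)) \<noteq> \<infinity>"
    by (intro nn_integral_noteq_infinite) measurable
  then have "AE \<omega> in white_noise. convergent (\<lambda>n. X n \<omega>)"
  proof (rule eventually_mono)
    fix \<omega> assume "(\<Sum>n. ennreal (Y n \<omega>)) \<noteq> \<infinity>"
    then have "summable (\<lambda>n. Y n \<omega>)" by (intro summable_suminf_not_top) (auto simp: Y_def)
    then show "convergent (\<lambda>n. X n \<omega>)" unfolding Y_def by (rule convergent_if_summable_increments)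
  qed
  then obtain N where N: "\<And>\<omega>. \<omega> \<in> space white_noise - N \<Longrightarrow> convergent (\<lambda>n. X n \<omega>)" "N \<in> null_sets white_noise"
    by (rule AE_E3) blast
  define W where "W \<omega> = (if \<omega> \<in> N then 0 else lim (\<lambda>n. X n \<omega>))" for \<omega>
  have W: "(\<lambda>n. X n \<omega>) \<longlonglongrightarrow> W \<omega>" if "\<omega> \<in> space white_noise - N" for \<omega>
    using N(1)[OF that] that by (simp add: W_def convergent_LIMSEQ_iff)
  have smW: "strongly_measurable white_noise W"
  proof (rule strongly_measurable_LIMSEQ)
    have [measurable]: "N \<in> sets white_noise" using N(2) by auto
    show "strongly_measurable white_noise (\<lambda>\<omega>. (if \<omega> \<in> N then 0 else 1) *\<^sub>C X n \<omega>)" for n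
      by (intro strongly_measurable_scaleC smX) measurable
    show "(\<lambda>n. (if \<omega> \<in> N then 0 else 1) *\<^sub>C X n \<omega>) \<longlonglongrightarrow> W \<omega>" if "\<omega> \<in> space white_noise" for \<omega>
      using W[of \<omega>] that by (auto simp: W_def)
  qed
  have aeW: "AE \<omega> in white_noise. (\<lambda>n. X n \<omega>) \<longlonglongrightarrow> W \<omega>"
    by (rule AE_I'[OF N(2)]) (use W in auto)
  have smD: "(\<lambda>\<omega>. (norm (W \<omega> - noise_sum v G \<omega>))\<^sup>2) \<in> borel_measurable white_noise" for G
    by (intro borel_measurable_power strongly_measurable_norm strongly_measurable_diff smW strongly_measurable_noise_sum)
  have nnW: "(\<integral>\<^sup>+\<omega>. ennreal ((norm (W \<omega> - noise_sum v G \<omega>))\<^sup>2) \<partial>white_noise) \<le> ennreal (s - sum f G)"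
    if G: "finite G" for G
  proof -
    let ?d = "\<lambda>n \<omega>. (norm (X n \<omega> - noise_sum v G \<omega>))\<^sup>2"
    have [measurable]: "?d n \<in> borel_measurable white_noise" for n
      by (intro borel_measurable_power strongly_measurable_norm strongly_measurable_diff smX strongly_measurable_noise_sum)
    have "(\<integral>\<^sup>+\<omega>. ennreal ((norm (W \<omega> - noise_sum v G \<omega>))\<^sup>2) \<partial>white_noise)
        = (\<integral>\<^sup>+\<omega>. liminf (\<lambda>n. ennreal (?d n \<omega>)) \<partial>white_noise)"
    proof (rule nn_integral_cong_AE, use aeW in \<open>rule eventually_mono\<close>)
      fix \<omega> assume "(\<lambda>n. X n \<omega>) \<longlonglongrightarrow> W \<omega>"
      then have "(\<lambda>n. ennreal (?d n \<omega>)) \<longlonglongrightarrow> ennreal ((norm (W \<omega> - noise_sum v G \<omega>))\<^sup>2)"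
        by (intro tendsto_ennrealI tendsto_intros)
      then show "ennreal ((norm (W \<omega> - noise_sum v G \<omega>))\<^sup>2) = liminf (\<lambda>n. ennreal (?d n \<omega>))"
        by (intro lim_imp_Liminf[symmetric]) auto
    qed
    also have "\<dots> \<le> liminf (\<lambda>n. \<integral>\<^sup>+\<omega>. ennreal (?d n \<omega>) \<partial>white_noise)"
      by (rule nn_integral_liminf) measurable
    also have "\<dots> \<le> liminf (\<lambda>n. ennreal ((1/16)^n + (s - sum f G)))"
    proof (rule Liminf_mono, rule always_eventually, rule allI)
      fix n
      have "(\<integral>\<^sup>+\<omega>. ennreal (?d n \<omega>) \<partial>white_noise) = ennreal (\<integral>\<omega>. ?d n \<omega> \<partial>white_noise)"
        by (intro nn_integral_eq_integral dX(1) G) auto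
      also have "\<dots> \<le> ennreal ((1/16)^n + (s - sum f G))" by (intro ennreal_leI dX(2) G)
      finally show "(\<integral>\<^sup>+\<omega>. ennreal (?d n \<omega>) \<partial>white_noise) \<le> ennreal ((1/16)^n + (s - sum f G))" .
    qed
    also have "\<dots> = ennreal (0 + (s - sum f G))"
      by (intro lim_imp_Liminf tendsto_ennrealI tendsto_add LIMSEQ_realpow_zero tendsto_const) auto
    finally show ?thesis by simp
  qed
  have intD: "integrable white_noise (\<lambda>\<omega>. (norm (W \<omega> - noise_sum v G \<omega>))\<^sup>2)" if "finite G" for G
    by (rule integrableI_nonneg[OF smD]) (use nnW[OF that] in \<open>auto intro: le_less_trans\<close>)
  have leD: "(\<integral>\<omega>. (norm (W \<omega> - noise_sum v G \<omega>))\<^sup>2 \<partial>white_noise) \<le> s - sum f G" if "finite G" for G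
  proof -
    have "ennreal (\<integral>\<omega>. (norm (W \<omega> - noise_sum v G \<omega>))\<^sup>2 \<partial>white_noise) \<le> ennreal (s - sum f G)"
      using nnW[OF that] nn_integral_eq_integral[OF intD[OF that]] by simp
    then show ?thesis using le_s[OF that] by simp
  qed
  have "((\<lambda>F. \<integral>\<omega>. (norm (W \<omega> - noise_sum v F \<omega>))\<^sup>2 \<partial>white_noise) \<longlongrightarrow> 0) (finite_subsets_at_top UNIV)"
  proof (rule real_tendsto_sandwich)
    show "\<forall>\<^sub>F F in finite_subsets_at_top UNIV. 0 \<le> (\<integral>\<omega>. (norm (W \<omega> - noise_sum v F \<omega>))\<^sup>2 \<partial>white_noise)" by simp
    show "\<forall>\<^sub>F F in finite_subsets_at_top UNIV. (\<integral>\<omega>. (norm (W \<omega> - noise_sum v F \<omega>))\<^sup>2 \<partial>white_noise) \<le> s - sum f F"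
      by (rule eventually_finite_subsets_at_top_weakI) (rule leD)
    have "((\<lambda>F. s - sum f F) \<longlongrightarrow> s - s) (finite_subsets_at_top UNIV)"
      using hs unfolding has_sum_def by (intro tendsto_intros)
    then show "((\<lambda>F. s - sum f F) \<longlongrightarrow> 0) (finite_subsets_at_top UNIV)" by simp
  qed simp
  moreover have "in_L2 white_noise W" unfolding in_L2_def using smW intD[of "{}"] by (simp add: noise_sum_def)
  ultimately show ?thesis unfolding noise_series_def using intD by blast
qed

lemma norm_iexp_diff_le: "cmod (iexp x - iexp y) \<le> \<bar>x - y\<bar>"
proof -
  have "iexp x - iexp y = iexp y * (iexp (x - y) - 1)"
    by (simp add: algebra_simps flip: exp_add)
  moreover have "cmod (iexp (x - y) - 1) \<le> \<bar>x - y\<bar>" using iexp_approx1[of "x - y" 0] by simp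
  ultimately show ?thesis by (simp add: norm_mult)
qed

lemma char_noise_combination:
  assumes "finite F"
  shows "char (distr white_noise borel (\<lambda>\<omega>. \<Sum>m\<in>F. \<alpha> m * noise m \<omega>)) t
    = complex_of_real (exp (- (t\<^sup>2 * (\<Sum>m\<in>F. (\<alpha> m)\<^sup>2)) / 2))"
proof -
  have "white_noise.indep_vars (\<lambda>_. borel) (\<lambda>m \<omega>. \<alpha> m * noise m \<omega>) F"
    by (rule white_noise.indep_vars_compose2[OF white_noise.indep_vars_subset[OF indep_noise]]) auto
  then have "char (distr white_noise borel (\<lambda>\<omega>. \<Sum>m\<in>F. \<alpha> m * noise m \<omega>)) t
      = (\<Prod>m\<in>F. char (distr white_noise borel (\<lambda>\<omega>. \<alpha> m * noise m \<omega>)) t)"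
    by (rule white_noise.char_distr_sum)
  also have "\<dots> = (\<Prod>m\<in>F. complex_of_real (exp (- ((t * \<alpha> m)\<^sup>2) / 2)))"
  proof (rule prod.cong)
    fix m
    have "char (distr white_noise borel (\<lambda>\<omega>. \<alpha> m * noise m \<omega>)) t = char (distr white_noise borel (noise m)) (t * \<alpha> m)"
      unfolding char_def by (subst (1 2) integral_distr) (auto simp: mult_ac)
    then show "char (distr white_noise borel (\<lambda>\<omega>. \<alpha> m * noise m \<omega>)) t = complex_of_real (exp (- ((t * \<alpha> m)\<^sup>2) / 2))"
      unfolding distr_noise char_std_normal_distribution .
  qed simp
  also have "\<dots> = complex_of_real (exp (\<Sum>m\<in>F. - ((t * \<alpha> m)\<^sup>2) / 2))"
    using assms by (simp add: exp_sum)
  also have "(\<Sum>m\<in>F. - ((t * \<alpha> m)\<^sup>2) / 2) = - (t\<^sup>2 * (\<Sum>m\<in>F. (\<alpha> m)\<^sup>2)) / 2"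
    by (simp add: power_mult_distrib sum_distrib_left sum_negf sum_divide_distrib)
  finally show ?thesis .
qed

text \<open>Mean-square convergence makes the variances converge and, since \<open>x \<mapsto> exp (i t x)\<close> is Lipschitz,
  also the characteristic functions.  The limit therefore has the characteristic function of a
  centered normal law, which determines the distribution.\<close>

lemma centered_gaussian_L2_limit:
  fixes Y :: "('i \<Rightarrow> complex) \<Rightarrow> real"
  assumes Y[measurable]: "Y \<in> borel_measurable white_noise" and Y2: "integrable white_noise (\<lambda>\<omega>. (Y \<omega>)\<^sup>2)"
    and lim: "((\<lambda>F. \<integral>\<omega>. (Y \<omega> - (\<Sum>m\<in>F. \<alpha> m * noise m \<omega>))\<^sup>2 \<partial>white_noise) \<longlongrightarrow> 0) (finite_subsets_at_top UNIV)"
  shows "centered_gaussian white_noise Y"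
proof -
  define YF where "YF F \<omega> = (\<Sum>m\<in>F. \<alpha> m * noise m \<omega>)" for F \<omega>
  have [measurable]: "YF F \<in> borel_measurable white_noise" for F unfolding YF_def by measurable
  have YF_eq: "YF F \<omega> * YF F \<omega> = (\<Sum>m\<in>F. \<Sum>l\<in>F. (\<alpha> m * \<alpha> l) * (noise m \<omega> * noise l \<omega>))" for F \<omega>
    unfolding YF_def sum_product by (intro sum.cong refl) (simp add: mult_ac)
  have iYF: "integrable white_noise (\<lambda>\<omega>. YF F \<omega> * YF F \<omega>)" for F
    unfolding YF_eq by (intro Bochner_Integration.integrable_sum integrable_mult_right noise_orthonormal)
  have EYF: "(\<integral>\<omega>. YF F \<omega> * YF F \<omega> \<partial>white_noise) = (\<Sum>m\<in>F. (\<alpha> m)\<^sup>2)" if "finite F" for F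
  proof -
    have "(\<integral>\<omega>. YF F \<omega> * YF F \<omega> \<partial>white_noise) = (\<Sum>m\<in>F. \<Sum>l\<in>F. (\<alpha> m * \<alpha> l) * (\<integral>\<omega>. noise m \<omega> * noise l \<omega> \<partial>white_noise))"
      unfolding YF_eq by (simp add: Bochner_Integration.integral_sum Bochner_Integration.integrable_sum noise_orthonormal)
    also have "\<dots> = (\<Sum>m\<in>F. \<Sum>l\<in>F. if m = l then (\<alpha> m)\<^sup>2 else 0)"
      by (intro sum.cong refl) (simp add: noise_orthonormal power2_eq_square)
    also have "\<dots> = (\<Sum>m\<in>F. (\<alpha> m)\<^sup>2)" using that by simp
    finally show ?thesis .
  qed
  define V where "V = (\<integral>\<omega>. Y \<omega> * Y \<omega> \<partial>white_noise)"
  have V0: "V \<ge> 0" unfolding V_def by simp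
  let ?L = "finite_subsets_at_top (UNIV :: 'i set)"
  have "((\<lambda>F. \<integral>\<omega>. YF F \<omega> * YF F \<omega> \<partial>white_noise) \<longlongrightarrow> V) ?L"
    unfolding V_def
    by (rule L2_mult_tendsto) (use Y2 iYF lim in \<open>simp_all add: YF_def[symmetric] power2_eq_square\<close>)
  then have varlim: "((\<lambda>F. \<Sum>m\<in>F. (\<alpha> m)\<^sup>2) \<longlongrightarrow> V) ?L"
    by (rule Lim_transform_eventually) (rule eventually_finite_subsets_at_top_weakI, rule EYF)
  have iD: "integrable white_noise (\<lambda>\<omega>. (Y \<omega> - YF F \<omega>)\<^sup>2)" for F
    using integrable_norm_diff_square[of Y white_noise "YF F"] Y2 iYF by (simp add: power2_eq_square)
  have char: "char (distr white_noise borel Y) t = complex_of_real (exp (- (t\<^sup>2 * V) / 2))" for t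
  proof (rule tendsto_unique)
    show "?L \<noteq> bot" by simp
    have "((\<lambda>F. complex_of_real (exp (- (t\<^sup>2 * (\<Sum>m\<in>F. (\<alpha> m)\<^sup>2)) / 2))) \<longlongrightarrow> complex_of_real (exp (- (t\<^sup>2 * V) / 2))) ?L"
      by (intro tendsto_intros varlim) simp
    then show "((\<lambda>F. char (distr white_noise borel (YF F)) t) \<longlongrightarrow> complex_of_real (exp (- (t\<^sup>2 * V) / 2))) ?L"
      by (rule Lim_transform_eventually)
         (rule eventually_finite_subsets_at_top_weakI, simp add: YF_def[abs_def] char_noise_combination)
    have b: "cmod (char (distr white_noise borel (YF F)) t - char (distr white_noise borel Y) t)
        \<le> \<bar>t\<bar> * (r + (\<integral>\<omega>. (Y \<omega> - YF F \<omega>)\<^sup>2 \<partial>white_noise) / r)" if r: "r > 0" for r F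
    proof -
      have "cmod (char (distr white_noise borel (YF F)) t - char (distr white_noise borel Y) t)
          = cmod (\<integral>\<omega>. iexp (t * YF F \<omega>) - iexp (t * Y \<omega>) \<partial>white_noise)"
        unfolding char_def
        by (subst (1 2) integral_distr) (auto simp: Bochner_Integration.integral_diff[OF white_noise.integrable_iexp white_noise.integrable_iexp])
      also have "\<dots> \<le> (\<integral>\<omega>. cmod (iexp (t * YF F \<omega>) - iexp (t * Y \<omega>)) \<partial>white_noise)"
        by (rule integral_norm_bound)
      also have "\<dots> \<le> (\<integral>\<omega>. \<bar>t\<bar> * (r + (Y \<omega> - YF F \<omega>)\<^sup>2 / r) \<partial>white_noise)"
      proof (rule integral_mono)
        show "integrable white_noise (\<lambda>\<omega>. cmod (iexp (t * YF F \<omega>) - iexp (t * Y \<omega>)))"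
          by (intro integrable_norm Bochner_Integration.integrable_diff white_noise.integrable_iexp) auto
        show "integrable white_noise (\<lambda>\<omega>. \<bar>t\<bar> * (r + (Y \<omega> - YF F \<omega>)\<^sup>2 / r))"
          using iD[of F] by auto
        fix \<omega>
        have "cmod (iexp (t * YF F \<omega>) - iexp (t * Y \<omega>)) \<le> \<bar>t * YF F \<omega> - t * Y \<omega>\<bar>" by (rule norm_iexp_diff_le)
        also have "\<dots> = \<bar>t\<bar> * \<bar>Y \<omega> - YF F \<omega>\<bar>" by (simp add: abs_mult[symmetric] algebra_simps)
        also have "\<bar>Y \<omega> - YF F \<omega>\<bar> \<le> r + (Y \<omega> - YF F \<omega>)\<^sup>2 / r"
          using mult_le_weighted_squares[OF r, of 1 "\<bar>Y \<omega> - YF F \<omega>\<bar>"] by simp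
        finally show "cmod (iexp (t * YF F \<omega>) - iexp (t * Y \<omega>)) \<le> \<bar>t\<bar> * (r + (Y \<omega> - YF F \<omega>)\<^sup>2 / r)"
          by (simp add: mult_left_mono)
      qed
      also have "\<dots> = \<bar>t\<bar> * (r + (\<integral>\<omega>. (Y \<omega> - YF F \<omega>)\<^sup>2 \<partial>white_noise) / r)"
        using iD[of F] by (simp add: white_noise.prob_space)
      finally show ?thesis .
    qed
    show "((\<lambda>F. char (distr white_noise borel (YF F)) t) \<longlongrightarrow> char (distr white_noise borel Y) t) ?L"
    proof (rule tendstoI)
      fix e :: real assume e: "e > 0"
      define r where "r = e / (2 * (\<bar>t\<bar> + 1))"
      have r: "r > 0" using e by (simp add: r_def add_nonneg_pos)
      have tr: "\<bar>t\<bar> * r < e / 2"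
      proof -
        have "\<bar>t\<bar> * r < (\<bar>t\<bar> + 1) * r" using r by simp
        also have "\<dots> = e / 2" by (simp add: r_def field_simps add_nonneg_eq_0_iff)
        finally show ?thesis .
      qed
      have "((\<lambda>F. \<bar>t\<bar> * ((\<integral>\<omega>. (Y \<omega> - YF F \<omega>)\<^sup>2 \<partial>white_noise) / r)) \<longlongrightarrow> \<bar>t\<bar> * (0 / r)) ?L"
        using lim r unfolding YF_def[symmetric] by (intro tendsto_intros) auto
      then have "\<forall>\<^sub>F F in ?L. \<bar>t\<bar> * ((\<integral>\<omega>. (Y \<omega> - YF F \<omega>)\<^sup>2 \<partial>white_noise) / r) < e / 2"
        using e by (intro order_tendstoD(2)) auto
      then show "\<forall>\<^sub>F F in ?L. dist (char (distr white_noise borel (YF F)) t) (char (distr white_noise borel Y) t) < e"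
      proof (rule eventually_mono)
        fix F assume "\<bar>t\<bar> * ((\<integral>\<omega>. (Y \<omega> - YF F \<omega>)\<^sup>2 \<partial>white_noise) / r) < e / 2"
        with b[OF r, of F] tr show "dist (char (distr white_noise borel (YF F)) t) (char (distr white_noise borel Y) t) < e"
          unfolding dist_norm distrib_left by linarith
      qed
    qed
  qed
  show ?thesis
  proof (cases "V = 0")
    case True
    have "AE \<omega> in white_noise. Y \<omega> * Y \<omega> = 0"
      using True Y2 unfolding V_def
      by (subst (asm) integral_nonneg_eq_0_iff_AE) (auto simp: power2_eq_square)
    then show ?thesis unfolding centered_gaussian_def by auto
  next
    case False
    define \<sigma> where "\<sigma> = sqrt V"
    have \<sigma>: "\<sigma> > 0" "\<sigma>\<^sup>2 = V" using False V0 by (simp_all add: \<sigma>_def)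
    have "distr white_noise borel (\<lambda>\<omega>. Y \<omega> / \<sigma>) = std_normal_distribution"
    proof (rule Levy_uniqueness)
      show "real_distribution (distr white_noise borel (\<lambda>\<omega>. Y \<omega> / \<sigma>))"
        by (rule white_noise.real_distribution_distr) measurable
      show "real_distribution std_normal_distribution" by (rule real_dist_normal_dist)
      show "char (distr white_noise borel (\<lambda>\<omega>. Y \<omega> / \<sigma>)) = char std_normal_distribution"
      proof
        fix t
        have "char (distr white_noise borel (\<lambda>\<omega>. Y \<omega> / \<sigma>)) t = char (distr white_noise borel Y) (t / \<sigma>)"
          unfolding char_def by (subst (1 2) integral_distr) auto
        also have "\<dots> = complex_of_real (exp (- (t\<^sup>2) / 2))"
          using \<sigma> False unfolding char by (simp add: power_divide)
        finally show "char (distr white_noise borel (\<lambda>\<omega>. Y \<omega> / \<sigma>)) t = char std_normal_distribution t"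
          by (simp add: char_std_normal_distribution)
      qed
    qed
    moreover have "distr white_noise lborel (\<lambda>\<omega>. Y \<omega> / \<sigma>) = distr white_noise borel (\<lambda>\<omega>. Y \<omega> / \<sigma>)"
      by (rule distr_cong) simp_all
    ultimately have "distributed white_noise lborel (\<lambda>\<omega>. (Y \<omega> - 0) / \<sigma>) std_normal_density"
      unfolding distributed_def by simp
    then have "distributed white_noise lborel Y (normal_density 0 \<sigma>)"
      using white_noise.normal_standard_normal_convert[OF \<sigma>(1), of Y 0] by simp
    then show ?thesis unfolding centered_gaussian_def using \<sigma>(1) Y by blast
  qed
qed

section \<open>Random positive definite kernels\<close>

lemma pd_kernel_of_pd:
  fixes p :: "'i \<Rightarrow> 'x \<times> 'h::complex_hilbert"
  assumes K: "K \<in> pd X" and p: "\<And>i. fst (p i) \<in> X"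
  shows "pd_kernel (\<lambda>i j. cinner (snd (p i)) (K (fst (p i)) (fst (p j)) (snd (p j))))"
  unfolding pd_kernel_def
proof (intro allI impI)
  fix J :: "'i set" and c :: "'i \<Rightarrow> complex"
  assume "finite J"
  then obtain h where h: "bij_betw h {..<card J} J" using ex_bij_betw_nat_finite[of J] by (auto simp: atLeast0LessThan)
  let ?G = "\<lambda>i j. cinner (snd (p i)) (K (fst (p i)) (fst (p j)) (snd (p j)))"
  have lin: "K (fst (p i)) (fst (p j)) (z *\<^sub>C x) = z *\<^sub>C K (fst (p i)) (fst (p j)) x" for i j z x
    using K p unfolding pd_def bounded_clinear_def by blast
  have "0 \<le> (\<Sum>i<card J. \<Sum>j<card J. cinner (c (h i) *\<^sub>C snd (p (h i)))
      (K (fst (p (h i))) (fst (p (h j))) (c (h j) *\<^sub>C snd (p (h j)))))"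
    using K p unfolding pd_def mem_Collect_eq
    by (elim conjE allE[of _ "card J"] allE[of _ "\<lambda>i. c (h i) *\<^sub>C snd (p (h i))"] allE[of _ "\<lambda>i. fst (p (h i))"]) simp
  also have "\<dots> = (\<Sum>i<card J. \<Sum>j<card J. cnj (c (h i)) * c (h j) * ?G (h i) (h j))"
    unfolding lin cinner_scaleC_left cinner_scaleC_right by (simp add: mult_ac)
  also have "\<dots> = (\<Sum>i<card J. \<Sum>j\<in>J. cnj (c (h i)) * c j * ?G (h i) j)"
    by (intro sum.cong refl sum.reindex_bij_betw[OF h])
  also have "\<dots> = kernel_form ?G J c"
    unfolding kernel_form_def by (rule sum.reindex_bij_betw[OF h])
  finally show "0 \<le> kernel_form ?G J c" .
qed

lemma pd_diag_positive_op:
  assumes "K \<in> pd X" "s \<in> X"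
  shows "positive_op (K s s)"
  unfolding positive_op_def
proof (intro conjI allI)
  show "bounded_clinear (K s s)" using assms unfolding pd_def by blast
  fix x
  have "0 \<le> kernel_form (\<lambda>i j. cinner (snd (s, x)) (K (fst (s, x)) (fst (s, x)) (snd (s, x)))) {()} (\<lambda>_. 1)"
    by (intro pd_kernelD pd_kernel_of_pd[OF assms(1)]) (simp_all add: assms)
  then show "0 \<le> cinner x (K s s x)" by (simp add: kernel_form_def)
qed

text \<open>A combination of features has square sum \<open>\<langle>w, T w\<rangle>\<close> with \<open>w = \<Sum>\<^sub>k c\<^sub>k a\<^sub>k\<close>; for \<open>w = 0\<close>
  this shows that every feature respects linear relations, and for a single vector that it is bounded.\<close>

lemma features_representable:
  fixes T :: "'h::complex_hilbert \<Rightarrow> 'h" and \<psi> :: "'l \<Rightarrow> 'h \<Rightarrow> complex"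
  assumes T: "bounded_clinear T"
    and \<psi>: "\<And>a b. ((\<lambda>l. cnj (\<psi> l a) * \<psi> l b) has_sum cinner a (T b)) UNIV"
  shows "\<exists>v. \<forall>l a. \<psi> l a = cinner (v l) a"
proof -
  have form: "(cmod (\<Sum>k\<in>J. c k * \<psi> l (a k)))\<^sup>2 \<le> cmod (cinner w (T w))"
    if J: "finite J" and w: "w = (\<Sum>k\<in>J. c k *\<^sub>C a k)" for J :: "nat set" and c a w l
  proof -
    have hs: "((\<lambda>l. (cmod (\<Sum>k\<in>J. c k * \<psi> l (a k)))\<^sup>2) has_sum Re (kernel_form (\<lambda>i j. cinner (a i) (T (a j))) J c)) UNIV"
      by (rule kernel_form_has_sum[OF J, where \<phi> = "\<lambda>l k. \<psi> l (a k)"]) (rule \<psi>)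
    have "kernel_form (\<lambda>i j. cinner (a i) (T (a j))) J c = cinner w (T w)"
      unfolding w kernel_form_def bounded_clinearD(6)[OF T] bounded_clinearD(4)[OF T] cinner_sum_left cinner_sum_right
      by (subst sum.swap) (simp add: cinner_simps mult_ac)
    then have "(cmod (\<Sum>k\<in>J. c k * \<psi> l (a k)))\<^sup>2 \<le> Re (cinner w (T w))"
      using finite_sum_le_has_sum[OF hs, of "{l}"] by simp
    then show ?thesis using complex_Re_le_cmod[of "cinner w (T w)"] by linarith
  qed
  obtain C where C: "C > 0" "\<And>x. norm (T x) \<le> norm x * C" using bounded_clinear_bound[OF T] by blast
  have "\<exists>v. \<forall>a. \<psi> l a = cinner v a" for l
  proof (rule Riesz_representation)
    fix x y :: 'h and c :: complex
    \<comment> \<open>Additivity and homogeneity are the relations \<open>(x + y) - x - y = 0\<close> and \<open>c x - c x = 0\<close>.\<close>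
    have "(cmod (\<Sum>k\<in>{0, 1, 2::nat}. (if k = 0 then 1 else - 1) * \<psi> l (if k = 0 then x + y else if k = 1 then x else y)))\<^sup>2
        \<le> cmod (cinner 0 (T 0))"
    proof (rule form)
      have neg: "(- 1) *\<^sub>C z = - z" for z :: 'h using scaleR_scaleC[of "- 1" z] by simp
      show "0 = (\<Sum>k\<in>{0, 1, 2::nat}. (if k = 0 then 1 else - 1) *\<^sub>C (if k = 0 then x + y else if k = 1 then x else y))"
        by (simp add: neg)
    qed simp
    then show "\<psi> l (x + y) = \<psi> l x + \<psi> l y" by (simp add: algebra_simps)
    have "(cmod (\<Sum>k\<in>{0, 1::nat}. (if k = 0 then 1 else - c) * \<psi> l (if k = 0 then c *\<^sub>C x else x)))\<^sup>2
        \<le> cmod (cinner 0 (T 0))"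
    proof (rule form)
      have "c *\<^sub>C x + (- c) *\<^sub>C x = 0" unfolding scaleC_add_left[symmetric] by simp
      then show "0 = (\<Sum>k\<in>{0, 1::nat}. (if k = 0 then 1 else - c) *\<^sub>C (if k = 0 then c *\<^sub>C x else x))" by simp
    qed simp
    then show "\<psi> l (c *\<^sub>C x) = c * \<psi> l x" by simp
    have "(cmod (\<psi> l x))\<^sup>2 \<le> cmod (cinner x (T x))"
      using form[of "{0}" x "\<lambda>_. 1" "\<lambda>_. x" l] by simp
    also have "\<dots> \<le> norm x * (norm x * C)"
      by (rule order_trans[OF cinner_Cauchy_Schwarz mult_left_mono[OF C(2)]]) simp
    also have "\<dots> = (sqrt C * norm x)\<^sup>2" using C(1) by (simp add: power_mult_distrib power2_eq_square mult_ac)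
    finally show "cmod (\<psi> l x) \<le> sqrt C * norm x" by (rule power2_le_imp_le) (use C in simp)
  qed
  then show ?thesis by metis
qed

text \<open>By Parseval's identity, the square sum of finitely many \<open>\<parallel>v\<^sub>l\<parallel>\<close> can be computed by summing
  over an orthonormal basis first, which gives at most the trace of \<open>T\<close>.\<close>

lemma features_square_summable:
  fixes T :: "'h::complex_hilbert \<Rightarrow> 'h" and v :: "'l \<Rightarrow> 'h"
  assumes T: "positive_op T" "trace_class T"
    and v: "\<And>a b. ((\<lambda>l. cinner a (v l) * cinner (v l) b) has_sum cinner a (T b)) UNIV"
  shows "(\<lambda>l. (norm (v l))\<^sup>2) summable_on UNIV"
proof -
  obtain B where B: "is_onb B" and tr: "(\<lambda>e. Re (cinner e (T e))) summable_on B"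
    using trace_class_positive_summable[OF T] by blast
  have hv: "((\<lambda>l. (cmod (cinner e (v l)))\<^sup>2) has_sum Re (cinner e (T e))) UNIV" for e
  proof -
    have "cinner e (v l) * cinner (v l) e = complex_of_real ((cmod (cinner e (v l)))\<^sup>2)" for l
      unfolding complex_norm_square by (subst cinner_commute[of "v l" e]) simp
    then show ?thesis using has_sum_Re[OF v[of e e]] by simp
  qed
  have "(\<Sum>l\<in>F. (norm (v l))\<^sup>2) \<le> infsum (\<lambda>e. Re (cinner e (T e))) B" if F: "finite F" for F
  proof (rule has_sum_mono)
    show "((\<lambda>e. \<Sum>l\<in>F. (cmod (cinner e (v l)))\<^sup>2) has_sum (\<Sum>l\<in>F. (norm (v l))\<^sup>2)) B"
      by (rule has_sum_finite_sum[OF F Parseval_onb[OF B]])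
    show "((\<lambda>e. Re (cinner e (T e))) has_sum infsum (\<lambda>e. Re (cinner e (T e))) B) B"
      by (rule has_sum_infsum[OF tr])
    show "(\<Sum>l\<in>F. (cmod (cinner e (v l)))\<^sup>2) \<le> Re (cinner e (T e))" for e
      by (rule finite_sum_le_has_sum[OF hv]) (use F in auto)
  qed
  then show ?thesis by (intro nonneg_bdd_above_summable_on bdd_aboveI2) auto
qed

text \<open>The vectors \<open>v\<^sub>s\<^sub>,\<^sub>l\<close> play the role of \<open>V\<^sub>s\<^sup>* e\<^sub>l\<close> for a factorization \<open>K(s, t) = V\<^sub>s\<^sup>* V\<^sub>t\<close> and an
  orthonormal basis \<open>e\<^sub>l\<close>.\<close>

lemma pd_feature_vectors:
  fixes K :: "'x \<Rightarrow> 'x \<Rightarrow> 'h::complex_hilbert \<Rightarrow> 'h"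
  assumes K: "K \<in> pd X" and X: "X \<noteq> {}"
  shows "\<exists>v :: 'x \<Rightarrow> 'x \<times> 'h \<Rightarrow> 'h. \<forall>s\<in>X. \<forall>t\<in>X. \<forall>a b.
    ((\<lambda>l. cinner a (v s l) * cinner (v t l) b) has_sum cinner a (K s t b)) UNIV"
proof -
  obtain x0 where x0: "x0 \<in> X" using X by blast
  \<comment> \<open>Pairs outside \<open>X\<close> are sent to a zero vector, so that the kernel is defined on all pairs.\<close>
  define p where "p i = (if fst i \<in> X then i else (x0, 0))" for i :: "'x \<times> 'h"
  have p: "fst (p i) \<in> X" for i using x0 by (simp add: p_def)
  obtain \<phi> :: "'x \<times> 'h \<Rightarrow> 'x \<times> 'h \<Rightarrow> complex" where
    \<phi>: "\<And>i j. ((\<lambda>l. cnj (\<phi> l i) * \<phi> l j) has_sum cinner (snd (p i)) (K (fst (p i)) (fst (p j)) (snd (p j)))) UNIV"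
    using pd_kernel_Cholesky[OF pd_kernel_of_pd[of K X p, OF K p]] by blast
  have \<phi>X: "((\<lambda>l. cnj (\<phi> l (s, a)) * \<phi> l (t, b)) has_sum cinner a (K s t b)) UNIV" if "s \<in> X" "t \<in> X" for s t a b
    using \<phi>[of "(s, a)" "(t, b)"] that by (simp add: p_def)
  have "\<exists>v. \<forall>l a. \<phi> l (s, a) = cinner (v l) a" if "s \<in> X" for s
    by (rule features_representable[where T = "K s s"])
       (use K that \<phi>X in \<open>auto simp: pd_def\<close>)
  then obtain v where v: "\<And>s l a. s \<in> X \<Longrightarrow> \<phi> l (s, a) = cinner (v s l) a" by metis
  have "((\<lambda>l. cinner a (v s l) * cinner (v t l) b) has_sum cinner a (K s t b)) UNIV"
    if "s \<in> X" "t \<in> X" for s t a b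
    using \<phi>X[OF that, of a b] unfolding v[OF that(1)] v[OF that(2)] cinner_commute[of "v s _" a, symmetric]
    by (simp add: cinner_commute[of a "v s _"])
  then show ?thesis by blast
qed

lemma cinner_L2:
  assumes "in_L2 M f"
  shows "integrable M (\<lambda>\<omega>. (cmod (cinner a (f \<omega>)))\<^sup>2)" "integrable M (\<lambda>\<omega>. (cmod (cinner (f \<omega>) a))\<^sup>2)"
proof -
  have sm: "strongly_measurable M f" and i: "integrable M (\<lambda>\<omega>. (norm a)\<^sup>2 * (norm (f \<omega>))\<^sup>2)"
    using assms by (auto simp: in_L2_def)
  have b: "(cmod (cinner a x))\<^sup>2 \<le> (norm a)\<^sup>2 * (norm x)\<^sup>2" for x
    using power_mono[OF cinner_Cauchy_Schwarz[of a x] norm_ge_zero, of 2] by (simp add: power_mult_distrib)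
  show "integrable M (\<lambda>\<omega>. (cmod (cinner a (f \<omega>)))\<^sup>2)"
    by (rule Bochner_Integration.integrable_bound[OF i])
       (use strongly_measurable_cinner[OF sm] b in auto)
  then show "integrable M (\<lambda>\<omega>. (cmod (cinner (f \<omega>) a))\<^sup>2)" by (simp add: norm_cinner_commute[of _ a])
qed

lemma in_L2_noise_sum: "in_L2 white_noise (noise_sum v F)"
proof (cases "finite F")
  case False
  then have "noise_sum v F = (\<lambda>_. 0)" by (simp add: noise_sum_def fun_eq_iff)
  then show ?thesis by (simp add: in_L2_def strongly_measurable_const)
qed (simp add: in_L2_def strongly_measurable_noise_sum noise_sum_norm_square)

lemma noise_series_cinner_tendsto:
  assumes "noise_series v W"
  shows "((\<lambda>F. \<integral>\<omega>. (cmod (cinner a (W \<omega>) - cinner a (noise_sum v F \<omega>)))\<^sup>2 \<partial>white_noise) \<longlongrightarrow> 0) (finite_subsets_at_top UNIV)"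
    and "((\<lambda>F. \<integral>\<omega>. (cmod (cinner (W \<omega>) a - cinner (noise_sum v F \<omega>) a))\<^sup>2 \<partial>white_noise) \<longlongrightarrow> 0) (finite_subsets_at_top UNIV)"
proof -
  have int: "integrable white_noise (\<lambda>\<omega>. (norm (W \<omega> - noise_sum v F \<omega>))\<^sup>2)" if "finite F" for F
    using assms that unfolding noise_series_def by blast
  show lim: "((\<lambda>F. \<integral>\<omega>. (cmod (cinner a (W \<omega>) - cinner a (noise_sum v F \<omega>)))\<^sup>2 \<partial>white_noise) \<longlongrightarrow> 0) (finite_subsets_at_top UNIV)"
  proof (rule real_tendsto_sandwich)
    show "\<forall>\<^sub>F F in finite_subsets_at_top UNIV. 0 \<le> (\<integral>\<omega>. (cmod (cinner a (W \<omega>) - cinner a (noise_sum v F \<omega>)))\<^sup>2 \<partial>white_noise)"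
      by simp
    show "\<forall>\<^sub>F F in finite_subsets_at_top UNIV. (\<integral>\<omega>. (cmod (cinner a (W \<omega>) - cinner a (noise_sum v F \<omega>)))\<^sup>2 \<partial>white_noise)
        \<le> (norm a)\<^sup>2 * (\<integral>\<omega>. (norm (W \<omega> - noise_sum v F \<omega>))\<^sup>2 \<partial>white_noise)"
    proof (rule eventually_finite_subsets_at_top_weakI)
      fix F :: "'a set" assume "finite F"
      have "(cmod (cinner a x - cinner a y))\<^sup>2 \<le> (norm a)\<^sup>2 * (norm (x - y))\<^sup>2" for x y
        using power_mono[OF cinner_Cauchy_Schwarz[of a "x - y"] norm_ge_zero, of 2]
        by (simp add: power_mult_distrib cinner_diff_right)
      then show "(\<integral>\<omega>. (cmod (cinner a (W \<omega>) - cinner a (noise_sum v F \<omega>)))\<^sup>2 \<partial>white_noise)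
        \<le> (norm a)\<^sup>2 * (\<integral>\<omega>. (norm (W \<omega> - noise_sum v F \<omega>))\<^sup>2 \<partial>white_noise)"
        unfolding integral_mult_right_zero[symmetric]
        by (intro integral_mono' integrable_mult_right int \<open>finite F\<close>) auto
    qed
    have "((\<lambda>F. (norm a)\<^sup>2 * (\<integral>\<omega>. (norm (W \<omega> - noise_sum v F \<omega>))\<^sup>2 \<partial>white_noise)) \<longlongrightarrow> (norm a)\<^sup>2 * 0) (finite_subsets_at_top UNIV)"
      using assms unfolding noise_series_def by (intro tendsto_intros) auto
    then show "((\<lambda>F. (norm a)\<^sup>2 * (\<integral>\<omega>. (norm (W \<omega> - noise_sum v F \<omega>))\<^sup>2 \<partial>white_noise)) \<longlongrightarrow> 0) (finite_subsets_at_top UNIV)"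
      by simp
  qed simp
  show "((\<lambda>F. \<integral>\<omega>. (cmod (cinner (W \<omega>) a - cinner (noise_sum v F \<omega>) a))\<^sup>2 \<partial>white_noise) \<longlongrightarrow> 0) (finite_subsets_at_top UNIV)"
    using lim unfolding cinner_diff_left[symmetric] cinner_diff_right[symmetric] by (simp only: norm_cinner_commute[of _ a])
qed

text \<open>Both sides are limits of the covariances of the finite partial sums.\<close>

lemma noise_series_covariance:
  fixes v w :: "'i \<Rightarrow> 'h::complex_hilbert"
  assumes U: "noise_series v U" and W: "noise_series w W"
    and sum: "((\<lambda>l. cinner a (v l) * cinner (w l) b) has_sum k) UNIV"
  shows "(\<integral>\<omega>. cinner a (U \<omega>) * cinner (W \<omega>) b \<partial>white_noise) = k"
proof (rule tendsto_unique)
  have L2: "in_L2 white_noise U" "in_L2 white_noise W" using U W by (auto simp: noise_series_def)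
  then have sm: "strongly_measurable white_noise U" "strongly_measurable white_noise W" by (auto simp: in_L2_def)
  show "((\<lambda>F. \<integral>\<omega>. cinner a (noise_sum v F \<omega>) * cinner (noise_sum w F \<omega>) b \<partial>white_noise)
      \<longlongrightarrow> (\<integral>\<omega>. cinner a (U \<omega>) * cinner (W \<omega>) b \<partial>white_noise)) (finite_subsets_at_top UNIV)"
    by (intro L2_mult_tendsto strongly_measurable_cinner sm strongly_measurable_noise_sum cinner_L2 L2 in_L2_noise_sum
      noise_series_cinner_tendsto U W)
  show "((\<lambda>F. \<integral>\<omega>. cinner a (noise_sum v F \<omega>) * cinner (noise_sum w F \<omega>) b \<partial>white_noise) \<longlongrightarrow> k) (finite_subsets_at_top UNIV)"
    by (rule Lim_transform_eventually[OF sum[unfolded has_sum_def]])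
       (rule eventually_finite_subsets_at_top_weakI, rule noise_sum_covariance[symmetric])
qed simp

definition part :: "bool \<Rightarrow> complex \<Rightarrow> real" where
  "part re z = (if re then Re z else Im z)"

lemma part_simps:
  "part re (x - y) = part re x - part re y" "part re (complex_of_real r * x) = r * part re x"
  "part re (\<Sum>i\<in>A. f i) = (\<Sum>i\<in>A. part re (f i))" "(part re x)\<^sup>2 \<le> (cmod x)\<^sup>2"
  by (auto simp: part_def cmod_power2)

text \<open>A finite real combination of the coordinates of the series is the mean-square limit of the
  corresponding combinations of finitely many independent normal variables.\<close>

lemma noise_series_gaussian:
  fixes v :: "'s \<Rightarrow> 'i \<Rightarrow> 'h::complex_hilbert" and W :: "'s \<Rightarrow> ('i \<Rightarrow> complex) \<Rightarrow> 'h"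
  assumes W: "\<And>s. s \<in> X \<Longrightarrow> noise_series (v s) (W s)"
  shows "jointly_centered_gaussian_complex white_noise (X \<times> (UNIV :: 'h set)) (\<lambda>(s, a) \<omega>. cinner (W s \<omega>) a)"
  unfolding jointly_centered_gaussian_complex_def jointly_centered_gaussian_def
proof (intro allI impI)
  fix J :: "(('s \<times> 'h) \<times> bool) set" and c :: "('s \<times> 'h) \<times> bool \<Rightarrow> real"
  assume J: "finite J" "J \<subseteq> (X \<times> UNIV) \<times> UNIV"
  define S where "S j = fst (fst j)" for j :: "('s \<times> 'h) \<times> bool"
  define A where "A j = snd (fst j)" for j :: "('s \<times> 'h) \<times> bool"
  have SX: "S j \<in> X" if "j \<in> J" for j using J(2) that by (auto simp: S_def)
  define Y where "Y \<omega> = (\<Sum>j\<in>J. c j * part (snd j) (cinner (W (S j) \<omega>) (A j)))" for \<omega>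
  define \<alpha> where "\<alpha> m = (\<Sum>j\<in>J. c j * part (snd j) (cinner (v (S j) m) (A j)))" for m
  define YF where "YF F \<omega> = (\<Sum>j\<in>J. c j * part (snd j) (cinner (noise_sum (v (S j)) F \<omega>) (A j)))" for F \<omega>
  have YF: "YF F \<omega> = (\<Sum>m\<in>F. \<alpha> m * noise m \<omega>)" for F \<omega>
  proof -
    have "YF F \<omega> = (\<Sum>j\<in>J. \<Sum>m\<in>F. c j * part (snd j) (cinner (v (S j) m) (A j)) * noise m \<omega>)"
      unfolding YF_def noise_sum_def cinner_sum_left part_simps cinner_scaleR_left sum_distrib_left
      by (simp add: mult_ac)
    also have "\<dots> = (\<Sum>m\<in>F. \<alpha> m * noise m \<omega>)"
      unfolding \<alpha>_def sum_distrib_right by (rule sum.swap)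
    finally show ?thesis .
  qed
  define C where "C j = real (card J) * (c j)\<^sup>2" for j
  have bound: "(\<Sum>j\<in>J. c j * part (snd j) (z j))\<^sup>2 \<le> (\<Sum>j\<in>J. C j * (cmod (z j))\<^sup>2)" for z
  proof -
    have "(\<Sum>j\<in>J. c j * part (snd j) (z j))\<^sup>2 \<le> (\<Sum>j\<in>J. (c j * part (snd j) (z j))\<^sup>2) * real (card J)"
      by (rule sum_squared_le_sum_of_squares)
    also have "\<dots> = (\<Sum>j\<in>J. C j * (part (snd j) (z j))\<^sup>2)"
      unfolding C_def sum_distrib_right by (simp add: power_mult_distrib mult_ac)
    also have "\<dots> \<le> (\<Sum>j\<in>J. C j * (cmod (z j))\<^sup>2)"
      by (intro sum_mono mult_left_mono part_simps) (simp add: C_def)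
    finally show ?thesis .
  qed
  have L2: "in_L2 white_noise (W (S j))" if "j \<in> J" for j using W[OF SX[OF that]] by (simp add: noise_series_def)
  have [measurable]: "(\<lambda>\<omega>. cinner (W (S j) \<omega>) (A j)) \<in> borel_measurable white_noise" if "j \<in> J" for j
    using L2[OF that] by (intro strongly_measurable_cinner) (simp add: in_L2_def)
  have mY: "Y \<in> borel_measurable white_noise" unfolding Y_def part_def by measurable
  have "centered_gaussian white_noise Y"
  proof (rule centered_gaussian_L2_limit[where \<alpha> = \<alpha>])
    show "Y \<in> borel_measurable white_noise" by (rule mY)
    show "integrable white_noise (\<lambda>\<omega>. (Y \<omega>)\<^sup>2)"
    proof (rule Bochner_Integration.integrable_bound)
      show "integrable white_noise (\<lambda>\<omega>. \<Sum>j\<in>J. C j * (cmod (cinner (W (S j) \<omega>) (A j)))\<^sup>2)"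
        by (intro Bochner_Integration.integrable_sum integrable_mult_right cinner_L2 L2)
      show "(\<lambda>\<omega>. (Y \<omega>)\<^sup>2) \<in> borel_measurable white_noise" using mY by measurable
      show "AE \<omega> in white_noise. norm ((Y \<omega>)\<^sup>2) \<le> norm (\<Sum>j\<in>J. C j * (cmod (cinner (W (S j) \<omega>) (A j)))\<^sup>2)"
        using order_trans[OF bound abs_ge_self] by (simp add: Y_def)
    qed
    show "((\<lambda>F. \<integral>\<omega>. (Y \<omega> - (\<Sum>m\<in>F. \<alpha> m * noise m \<omega>))\<^sup>2 \<partial>white_noise) \<longlongrightarrow> 0) (finite_subsets_at_top UNIV)"
      unfolding YF[symmetric]
    proof (rule real_tendsto_sandwich)
      let ?d = "\<lambda>j F \<omega>. (cmod (cinner (W (S j) \<omega>) (A j) - cinner (noise_sum (v (S j)) F \<omega>) (A j)))\<^sup>2"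
      show "\<forall>\<^sub>F F in finite_subsets_at_top UNIV. 0 \<le> (\<integral>\<omega>. (Y \<omega> - YF F \<omega>)\<^sup>2 \<partial>white_noise)" by simp
      show "\<forall>\<^sub>F F in finite_subsets_at_top UNIV. (\<integral>\<omega>. (Y \<omega> - YF F \<omega>)\<^sup>2 \<partial>white_noise)
          \<le> (\<Sum>j\<in>J. C j * (\<integral>\<omega>. ?d j F \<omega> \<partial>white_noise))"
      proof (rule always_eventually, rule allI)
        fix F
        have i: "integrable white_noise (?d j F)" if "j \<in> J" for j
          using L2[OF that] in_L2_noise_sum[of "v (S j)" F]
          by (intro integrable_norm_diff_square strongly_measurable_cinner cinner_L2) (auto simp: in_L2_def)
        have "(\<integral>\<omega>. (Y \<omega> - YF F \<omega>)\<^sup>2 \<partial>white_noise) \<le> (\<integral>\<omega>. (\<Sum>j\<in>J. C j * ?d j F \<omega>) \<partial>white_noise)"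
        proof (rule integral_mono')
          show "integrable white_noise (\<lambda>\<omega>. \<Sum>j\<in>J. C j * ?d j F \<omega>)"
            by (intro Bochner_Integration.integrable_sum integrable_mult_right i)
          fix \<omega>
          have "Y \<omega> - YF F \<omega> = (\<Sum>j\<in>J. c j * part (snd j) (cinner (W (S j) \<omega>) (A j) - cinner (noise_sum (v (S j)) F \<omega>) (A j)))"
            unfolding Y_def YF_def part_simps by (simp add: right_diff_distrib sum_subtractf)
          then show "(Y \<omega> - YF F \<omega>)\<^sup>2 \<le> (\<Sum>j\<in>J. C j * ?d j F \<omega>)" using bound by simp
          show "0 \<le> (\<Sum>j\<in>J. C j * ?d j F \<omega>)" by (intro sum_nonneg) (simp add: C_def)
        qed
        also have "\<dots> = (\<Sum>j\<in>J. C j * (\<integral>\<omega>. ?d j F \<omega> \<partial>white_noise))"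
          using i by (simp add: Bochner_Integration.integral_sum)
        finally show "(\<integral>\<omega>. (Y \<omega> - YF F \<omega>)\<^sup>2 \<partial>white_noise) \<le> (\<Sum>j\<in>J. C j * (\<integral>\<omega>. ?d j F \<omega> \<partial>white_noise))" .
      qed
      have "((\<lambda>F. \<Sum>j\<in>J. C j * (\<integral>\<omega>. ?d j F \<omega> \<partial>white_noise)) \<longlongrightarrow> (\<Sum>j\<in>J. C j * 0)) (finite_subsets_at_top UNIV)"
        by (intro tendsto_sum tendsto_mult tendsto_const noise_series_cinner_tendsto W SX)
      then show "((\<lambda>F. \<Sum>j\<in>J. C j * (\<integral>\<omega>. ?d j F \<omega> \<partial>white_noise)) \<longlongrightarrow> 0) (finite_subsets_at_top UNIV)" by simp
    qed simp
  qed
  also have "Y = (\<lambda>\<omega>. \<Sum>j\<in>J. c j * (case j of (i, re) \<Rightarrow> \<lambda>\<omega>. if re then Re ((case i of (s, a) \<Rightarrow> \<lambda>\<omega>. cinner (W s \<omega>) a) \<omega>)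
      else Im ((case i of (s, a) \<Rightarrow> \<lambda>\<omega>. cinner (W s \<omega>) a) \<omega>)) \<omega>)"
    unfolding Y_def part_def S_def A_def by (intro ext sum.cong refl) (simp split: prod.splits)
  finally show "centered_gaussian white_noise (\<lambda>\<omega>. \<Sum>j\<in>J. c j * (case j of (i, re) \<Rightarrow> \<lambda>\<omega>. if re then Re ((case i of (s, a) \<Rightarrow> \<lambda>\<omega>. cinner (W s \<omega>) a) \<omega>)
      else Im ((case i of (s, a) \<Rightarrow> \<lambda>\<omega>. cinner (W s \<omega>) a) \<omega>)) \<omega>)" .
qed

lemma bounded_clinear_ketbra: "bounded_clinear (ketbra u v)"
  unfolding bounded_clinear_def ketbra_def
proof (intro conjI allI)
  show "bounded_linear (\<lambda>b. cinner v b *\<^sub>C u)"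
    by (rule bounded_linear_compose[OF bounded_bilinear.bounded_linear_left[OF bounded_bilinear_scaleC] bounded_linear_cinner_right])
qed (simp add: cinner_scaleC_right scaleC_scaleC)

lemma cinner_ketbra: "cinner a (ketbra u v b) = cinner a u * cinner v b"
  by (simp add: ketbra_def cinner_scaleC_right mult.commute)

lemma ketbra_form:
  "(\<Sum>i<N. \<Sum>j<N. cinner (a i) (ketbra (u (s i)) (u (s j)) (a j)))
    = complex_of_real ((cmod (\<Sum>j<N. cinner (u (s j)) (a j)))\<^sup>2)"
proof -
  have "(\<Sum>i<N. cinner (a i) (u (s i))) = cnj (\<Sum>j<N. cinner (u (s j)) (a j))"
    unfolding cnj_sum by (intro sum.cong refl cinner_commute)
  then show ?thesis
    unfolding cinner_ketbra complex_norm_square sum_product[symmetric] by (simp add: mult.commute)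
qed

lemma ketbra_in_pd: "(\<lambda>s t. ketbra (u s) (u t)) \<in> pd X"
  unfolding pd_def mem_Collect_eq ketbra_form by (auto simp: bounded_clinear_ketbra less_eq_complex_def)

theorem theorem2:
  fixes X :: "'x set"
  assumes "X \<noteq> {}"
  shows
    "(\<forall>(M :: 'w measure) (k :: 'w \<Rightarrow> 'x \<Rightarrow> 'x \<Rightarrow> 'h::complex_hilbert \<Rightarrow> 'h).
        prob_space M \<longrightarrow> k \<in> rpd M X \<longrightarrow>
        (\<lambda>s t. op_expectation M (\<lambda>\<omega>. k \<omega> s t)) \<in> pd X)
   \<and> (\<forall>K :: 'x \<Rightarrow> 'x \<Rightarrow> 'h \<Rightarrow> 'h.
        K \<in> pd X \<longrightarrow> (\<forall>s\<in>X. trace_class (K s s)) \<longrightarrow>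
        (\<exists>(M :: ('x \<times> 'h \<Rightarrow> complex) measure) (W :: 'x \<Rightarrow> ('x \<times> 'h \<Rightarrow> complex) \<Rightarrow> 'h).
           prob_space M \<and> gaussian_process M X W \<and>
           (\<forall>s\<in>X. \<forall>t\<in>X. has_op_expectation M (\<lambda>\<omega>. ketbra (W s \<omega>) (W t \<omega>)) (K s t)) \<and>
           (\<lambda>\<omega> s t. ketbra (W s \<omega>) (W t \<omega>)) \<in> rpd M X \<and>
           (AE \<omega> in M. (\<lambda>s t. ketbra (W s \<omega>) (W t \<omega>)) \<in> pd X)))"
proof (intro conjI allI impI)
  fix M :: "'w measure" and k :: "'w \<Rightarrow> 'x \<Rightarrow> 'x \<Rightarrow> 'h \<Rightarrow> 'h"
  assume "k \<in> rpd M X"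
  then show "(\<lambda>s t. op_expectation M (\<lambda>\<omega>. k \<omega> s t)) \<in> pd X" by (rule op_expectation_rpd_in_pd)
next
  fix K :: "'x \<Rightarrow> 'x \<Rightarrow> 'h \<Rightarrow> 'h"
  assume K: "K \<in> pd X" and tr: "\<forall>s\<in>X. trace_class (K s s)"
  obtain v :: "'x \<Rightarrow> 'x \<times> 'h \<Rightarrow> 'h" where v: "\<And>s t a b. s \<in> X \<Longrightarrow> t \<in> X \<Longrightarrow>
      ((\<lambda>l. cinner a (v s l) * cinner (v t l) b) has_sum cinner a (K s t b)) UNIV"
    using pd_feature_vectors[OF K assms] by metis
  have "\<exists>W. noise_series (v s) W" if s: "s \<in> X" for s
  proof (rule noise_series_exists, rule features_square_summable)
    show "positive_op (K s s)" by (rule pd_diag_positive_op[OF K s])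
    show "trace_class (K s s)" using tr s by (rule bspec)
    show "((\<lambda>l. cinner a (v s l) * cinner (v s l) b) has_sum cinner a (K s s b)) UNIV" for a b
      by (rule v[OF s s])
  qed
  then obtain W where W: "\<And>s. s \<in> X \<Longrightarrow> noise_series (v s) (W s)" by metis
  have L2: "in_L2 white_noise (W s)" if "s \<in> X" for s using W[OF that] by (simp add: noise_series_def)
  have sm: "strongly_measurable white_noise (W s)" if "s \<in> X" for s using L2[OF that] by (simp add: in_L2_def)
  have int: "integrable white_noise (\<lambda>\<omega>. cinner a (ketbra (W s \<omega>) (W t \<omega>) b))" if "s \<in> X" "t \<in> X" for s t a b
    unfolding cinner_ketbra by (intro integrable_mult_L2 strongly_measurable_cinner cinner_L2 sm L2 that)
  show "\<exists>(M :: ('x \<times> 'h \<Rightarrow> complex) measure) (W :: 'x \<Rightarrow> ('x \<times> 'h \<Rightarrow> complex) \<Rightarrow> 'h).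
           prob_space M \<and> gaussian_process M X W \<and>
           (\<forall>s\<in>X. \<forall>t\<in>X. has_op_expectation M (\<lambda>\<omega>. ketbra (W s \<omega>) (W t \<omega>)) (K s t)) \<and>
           (\<lambda>\<omega> s t. ketbra (W s \<omega>) (W t \<omega>)) \<in> rpd M X \<and>
           (AE \<omega> in M. (\<lambda>s t. ketbra (W s \<omega>) (W t \<omega>)) \<in> pd X)"
  proof (intro exI[of _ white_noise] exI[of _ W] conjI ballI)
    show "prob_space (white_noise :: ('x \<times> 'h \<Rightarrow> complex) measure)" by (rule white_noise.prob_space_axioms)
    show "gaussian_process white_noise X W"
      unfolding gaussian_process_def
    proof (intro conjI ballI L2)
      show "jointly_centered_gaussian_complex white_noise (X \<times> (UNIV :: 'h set)) (\<lambda>(s, a) \<omega>. cinner (W s \<omega>) a)"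
        by (rule noise_series_gaussian[where v = v]) (rule W)
    qed
    show "has_op_expectation white_noise (\<lambda>\<omega>. ketbra (W s \<omega>) (W t \<omega>)) (K s t)" if "s \<in> X" "t \<in> X" for s t
      unfolding has_op_expectation_def
    proof (intro conjI allI int that)
      show "bounded_clinear (K s t)" using K that by (simp add: pd_def)
      show "cinner a (K s t b) = (\<integral>\<omega>. cinner a (ketbra (W s \<omega>) (W t \<omega>) b) \<partial>white_noise)" for a b
        unfolding cinner_ketbra by (rule noise_series_covariance[OF W W v, symmetric]) (rule that)+
    qed
    show "(\<lambda>\<omega> s t. ketbra (W s \<omega>) (W t \<omega>)) \<in> rpd white_noise X"
      unfolding rpd_def mem_Collect_eq
    proof (intro conjI ballI allI impI bounded_clinear_ketbra int)
      show "strongly_measurable white_noise (\<lambda>\<omega>. ketbra (W s \<omega>) (W t \<omega>) a)" if "s \<in> X" "t \<in> X" for s t a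
        unfolding ketbra_def by (intro strongly_measurable_scaleC strongly_measurable_cinner sm that)
      show "0 \<le> (\<integral>\<omega>. (\<Sum>i<N. \<Sum>j<N. cinner (a i) (ketbra (W (s i) \<omega>) (W (s j) \<omega>) (a j))) \<partial>white_noise)" for N :: nat and a s
        unfolding ketbra_form[where u = "\<lambda>s. W s _"] integral_complex_of_real by (simp add: less_eq_complex_def)
    qed
    show "AE \<omega> in white_noise. (\<lambda>s t. ketbra (W s \<omega>) (W t \<omega>)) \<in> pd X"
      by (intro always_eventually allI ketbra_in_pd)
  qed
qed

end
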